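(* Fix integers $r\ge1$, $m\ge3$ and probabilities $p_1,\dots,p_m>0$ with $\sum_ip_i=1$. For each $n$ let $G_n$ be an $r$-regular graph on $n$ vertices, colour its vertices independently with colour $i$ having probability $p_i$, let $N_i$ be the number of vertices of colour $i$ and $M_i$ the number of edges both of whose endpoints have colour $i$, and set $W:=(M_1,\dots,M_m,N_1,\dots,N_{m-1})\in\mathbb{Z}^{2m-1}$. Let $\nu:=n^{-1}\mathbb{E}W$, i.e. $\nu_i=rp_i^2/2$ ($1\le i\le m$), $\nu_{m+i}=p_i$ ($1\le i\le m-1$), and $\Sigma:=n^{-1}\mathrm{Cov}(W)$, determined for $1\le i\ne l\le m$ by $\mathrm{Var}(M_i)=\tfrac12nrp_i^2(1-p_i)\{1+(2r-1)p_i\}$, $\mathrm{Cov}(M_i,M_l)=-\tfrac12nr(2r-1)p_i^2p_l^2$, $\mathrm{Cov}(M_i,N_i)=nrp_i^2(1-p_i)$, $\mathrm{Cov}(M_i,N_l)=-nrp_i^2p_l$, $\mathrm{Var}(N_i)=np_i(1-p_i)$, $\mathrm{Cov}(N_i,N_l)=-np_ip_l$. Then, as $n\to\infty$, $d_{TV}(\mathcal{L}(W),\mathcal{DN}_{2m-1}(n\nu,n\Sigma))=O(n^{-1/2}\log n)$.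
   Context: $\mathcal{DN}_k(a,V)$ is the discrete normal distribution on $\mathbb{Z}^k$: it assigns to $(i_1,\dots,i_k)\in\mathbb{Z}^k$ the $\mathcal N_k(a,V)$-probability of the box $\prod_t[i_t-\tfrac12,i_t+\tfrac12)$. A graph is $r$-regular if every vertex has exactly $r$ neighbours. *)

theory Defs
  imports "HOL-Probability.Probability"
begin

definition regular_graph :: "(nat \<Rightarrow> nat \<Rightarrow> bool) \<Rightarrow> nat \<Rightarrow> nat \<Rightarrow> bool" where
  "regular_graph E n r \<longleftrightarrow>
     (\<forall>u<n. \<forall>v<n. E u v \<longleftrightarrow> E v u) \<and> (\<forall>u<n. \<not> E u u) \<and>
     (\<forall>u<n. card {v. v < n \<and> E u v} = r)"

definition lattice :: "nat \<Rightarrow> (nat \<Rightarrow> int) set" where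
  "lattice k = {x. \<forall>t\<ge>k. x t = 0}"

definition std_normal_vec :: "nat \<Rightarrow> (nat \<Rightarrow> real) measure" where
  "std_normal_vec k = PiM {..<k} (\<lambda>_. density lborel std_normal_density)"

text \<open>N_k(a,V) is the law of a + A Z with Z standard normal on R^k and A A^T = V.
  The law does not depend on the choice of A.\<close>
definition sqrt_factor :: "nat \<Rightarrow> (nat \<Rightarrow> nat \<Rightarrow> real) \<Rightarrow> (nat \<Rightarrow> nat \<Rightarrow> real)" where
  "sqrt_factor k V = (SOME A. \<forall>i<k. \<forall>l<k. (\<Sum>j<k. A i j * A l j) = V i l)"

definition normal_prob :: "nat \<Rightarrow> (nat \<Rightarrow> real) \<Rightarrow> (nat \<Rightarrow> nat \<Rightarrow> real) \<Rightarrow> ((nat \<Rightarrow> real) \<Rightarrow> bool) \<Rightarrow> real" where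
  "normal_prob k a V P =
     measure (std_normal_vec k)
       {z \<in> space (std_normal_vec k).
          P (\<lambda>t. if t < k then a t + (\<Sum>j<k. sqrt_factor k V t j * z j) else 0)}"

definition discrete_normal :: "nat \<Rightarrow> (nat \<Rightarrow> real) \<Rightarrow> (nat \<Rightarrow> nat \<Rightarrow> real) \<Rightarrow> (nat \<Rightarrow> int) \<Rightarrow> real" where
  "discrete_normal k a V x =
     normal_prob k a V (\<lambda>y. \<forall>t<k. real_of_int (x t) - 1/2 \<le> y t \<and> y t < real_of_int (x t) + 1/2)"

definition dTV :: "nat \<Rightarrow> ((nat \<Rightarrow> int) \<Rightarrow> real) \<Rightarrow> ((nat \<Rightarrow> int) \<Rightarrow> real) \<Rightarrow> real" where
  "dTV k P Q = (SUP A \<in> Pow (lattice k). \<bar>infsum P A - infsum Q A\<bar>)"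

text \<open>Colours are 0..m-1 (colour i+1 of the paper is colour i here).\<close>
definition colourings :: "nat \<Rightarrow> nat \<Rightarrow> (nat \<Rightarrow> nat) set" where
  "colourings n m = PiE {..<n} (\<lambda>_. {..<m})"

definition colouring_prob :: "(nat \<Rightarrow> real) \<Rightarrow> nat \<Rightarrow> (nat \<Rightarrow> nat) \<Rightarrow> real" where
  "colouring_prob p n c = (\<Prod>v<n. p (c v))"

text \<open>W = (M_1,..,M_m,N_1,..,N_{m-1}); component t<m is M_{t+1}, component m+i
  (i < m-1) is N_{i+1}; components from 2m-1 on are 0.\<close>
definition W_stat :: "(nat \<Rightarrow> nat \<Rightarrow> bool) \<Rightarrow> nat \<Rightarrow> nat \<Rightarrow> (nat \<Rightarrow> nat) \<Rightarrow> nat \<Rightarrow> int" where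
  "W_stat E n m c t =
     (if t < m then int (card {(u, v). u < v \<and> v < n \<and> E u v \<and> c u = t \<and> c v = t})
      else if t < 2 * m - 1 then int (card {v. v < n \<and> c v = t - m})
      else 0)"

definition law_W :: "(nat \<Rightarrow> nat \<Rightarrow> bool) \<Rightarrow> nat \<Rightarrow> nat \<Rightarrow> (nat \<Rightarrow> real) \<Rightarrow> (nat \<Rightarrow> int) \<Rightarrow> real" where
  "law_W E n m p x = (\<Sum>c \<in> {c \<in> colourings n m. W_stat E n m c = x}. colouring_prob p n c)"

section \<open>The mean nu and covariance Sigma (per vertex, i.e. divided by n)\<close>

definition nu :: "nat \<Rightarrow> nat \<Rightarrow> (nat \<Rightarrow> real) \<Rightarrow> nat \<Rightarrow> real" where
  "nu r m p t =
     (if t < m then real r * (p t)\<^sup>2 / 2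
      else if t < 2 * m - 1 then p (t - m) else 0)"

definition Sigma_cov :: "nat \<Rightarrow> nat \<Rightarrow> (nat \<Rightarrow> real) \<Rightarrow> nat \<Rightarrow> nat \<Rightarrow> real" where
  "Sigma_cov r m p s t =
     (if s < m \<and> t < m then
        (if s = t then real r * (p s)\<^sup>2 * (1 - p s) * (1 + (2 * real r - 1) * p s) / 2
         else - real r * (2 * real r - 1) * (p s)\<^sup>2 * (p t)\<^sup>2 / 2)
      else if s < m \<and> m \<le> t \<and> t < 2 * m - 1 then
        (if s = t - m then real r * (p s)\<^sup>2 * (1 - p s)
         else - real r * (p s)\<^sup>2 * p (t - m))
      else if m \<le> s \<and> s < 2 * m - 1 \<and> t < m then
        (if t = s - m then real r * (p t)\<^sup>2 * (1 - p t)
         else - real r * (p t)\<^sup>2 * p (s - m))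
      else if m \<le> s \<and> s < 2 * m - 1 \<and> m \<le> t \<and> t < 2 * m - 1 then
        (if s = t then p (s - m) * (1 - p (s - m))
         else - p (s - m) * p (t - m))
      else 0)"

end

(*
  The proof is Fourier inversion on Z^k, k = 2m - 1, with exponential tilting. For z = theta + i eta
  with |eta| of order n^(-1/2), write E exp(i z.(W - n nu)) through the Hoeffding decomposition of W
  as a sum of locally dependent terms. Stein's method along the ray s z compares it with
  exp(-n q(z)/2), where q is the quadratic form of Sigma. The error is
  C n (|theta| + n^(-1/2))^3 exp(-c n |theta|^2) on all of [-pi, pi]^k, the exponential factor coming
  from order n vertices with disjoint neighbourhoods, each of which, given the colours of the other
  vertices, still fluctuates; here m >= 3 ensures that Sigma and the lattice are non-degenerate.
  The cube probabilities of the normal law are inverted in the same way, with the additional factor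
  prod sinc(theta_j/2). Choosing eta against the direction of x - n nu bounds the pointwise difference
  by C n^(-(k+1)/2) exp(-c |x - n nu|/sqrt n) plus O(n^(-1/2)) times the normal probability itself.
  Summing over x gives the rate n^(-1/2), so that the logarithm in the statement is not needed.
*)
theory Submission
  imports Defs
begin

section \<open>Averages over independent colours\<close>

text \<open>Without a tilt, inversion gives one error of order n^(-(k+1)/2) for all x, and summing
  it over the range of W costs powers of a logarithm. An eta of size n^(-1/2) is as large as bounded
  exponential moments of z.(W - n nu) permit; it costs a constant factor, and the decay it buys sums
  over the lattice to O(n^(k/2)), which cancels the power of n exactly. The price is that the
  modulus of the exponential is no longer 1: decay estimates that condition on most colours have to
  normalise by the conditional mean of the modulus (\<open>rho\<close>) and to control the modulus
  itself by bounded differences. A second obstacle comes from Stein's method, whose errors are local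
  functions times exp(i s Z): taking absolute values there would lose the decay in theta. So decay
  is proved for the product of exp(i s Z) with any function of boundedly many colours, the
  fluctuating vertices being chosen away from these. Expectations over colourings are finite
  weighted sums, so independence is handled pointwise by \<open>depends_on\<close> and
  \<open>EE\<close>.\<close>

definition depends_on :: "nat set \<Rightarrow> ((nat \<Rightarrow> nat) \<Rightarrow> 'a) \<Rightarrow> bool" where
  "depends_on B f \<longleftrightarrow> (\<forall>c c'. (\<forall>v\<in>B. c v = c' v) \<longrightarrow> f c = f c')"

lemma depends_onI:
  assumes "\<And>c c'. (\<And>v. v \<in> B \<Longrightarrow> c v = c' v) \<Longrightarrow> f c = f c'"
  shows "depends_on B f"
  unfolding depends_on_def using assms by blast

lemma depends_onD:
  assumes "depends_on B f" and "\<And>v. v \<in> B \<Longrightarrow> c v = c' v"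
  shows "f c = f c'"
  using assms unfolding depends_on_def by blast

lemma depends_on_mono: "depends_on A f \<Longrightarrow> A \<subseteq> B \<Longrightarrow> depends_on B f"
  unfolding depends_on_def by blast

lemma depends_on_const: "depends_on B (\<lambda>_. k)"
  unfolding depends_on_def by simp

lemma depends_on_comp:
  assumes "depends_on B f"
  shows "depends_on B (\<lambda>c. g (f c))"
proof (rule depends_onI)
  fix c c' :: "nat \<Rightarrow> nat"
  assume "\<And>v. v \<in> B \<Longrightarrow> c v = c' v"
  then have "f c = f c'" by (rule depends_onD[OF assms])
  then show "g (f c) = g (f c')" by simp
qed

lemma depends_on_comp2:
  assumes "depends_on B f" "depends_on B g"
  shows "depends_on B (\<lambda>c. h (f c) (g c))"
proof (rule depends_onI)
  fix c c' :: "nat \<Rightarrow> nat"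
  assume *: "\<And>v. v \<in> B \<Longrightarrow> c v = c' v"
  have "f c = f c'" by (rule depends_onD[OF assms(1) *])
  moreover have "g c = g c'" by (rule depends_onD[OF assms(2) *])
  ultimately show "h (f c) (g c) = h (f c') (g c')" by simp
qed

lemma depends_on_sum:
  assumes "\<And>i. i \<in> I \<Longrightarrow> depends_on B (f i)"
  shows "depends_on B (\<lambda>c. \<Sum>i\<in>I. f i c)"
proof (rule depends_onI, rule sum.cong[OF refl])
  fix c c' :: "nat \<Rightarrow> nat" and i
  assume *: "\<And>v. v \<in> B \<Longrightarrow> c v = c' v" and i: "i \<in> I"
  show "f i c = f i c'" by (rule depends_onD[OF assms[OF i] *])
qed

lemma depends_on_prod:
  assumes "\<And>i. i \<in> I \<Longrightarrow> depends_on B (f i)"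
  shows "depends_on B (\<lambda>c. \<Prod>i\<in>I. f i c)"
proof (rule depends_onI, rule prod.cong[OF refl])
  fix c c' :: "nat \<Rightarrow> nat" and i
  assume *: "\<And>v. v \<in> B \<Longrightarrow> c v = c' v" and i: "i \<in> I"
  show "f i c = f i c'" by (rule depends_onD[OF assms[OF i] *])
qed

text \<open>Recolouring a finite set is a succession of single recolourings, so invariance under
  each of these is enough.\<close>

lemma depends_on_compl:
  assumes "finite A" and "\<And>v c i. v \<in> A \<Longrightarrow> f (c(v := i)) = f c"
  shows "depends_on (- A) f"
proof -
  have *: "f (override_on c c' A) = f c" for c c'
    using assms
  proof (induction A rule: finite_induct)
    case (insert v A)
    have "override_on c c' (insert v A) = (override_on c c' A)(v := c' v)"
      by (auto simp: override_on_def fun_eq_iff)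
    then show ?case using insert by simp
  qed simp
  show ?thesis
  proof (rule depends_onI)
    fix c c' :: "nat \<Rightarrow> nat"
    assume "\<And>v. v \<in> - A \<Longrightarrow> c v = c' v"
    then have "override_on c c' A = c'" by (auto simp: override_on_def fun_eq_iff)
    then show "f c = f c'" using *[of c c'] by simp
  qed
qed

locale palette =
  fixes m :: nat and p :: "nat \<Rightarrow> real"
  assumes m_ge: "m \<ge> 3" and p_pos: "\<And>i. i < m \<Longrightarrow> p i > 0" and p_sum: "(\<Sum>i<m. p i) = 1"
begin

text \<open>\<open>EE A f c\<close> is the conditional expectation of \<open>f\<close> given that the colours outside \<open>A\<close> are those of \<open>c\<close>.\<close>
definition EE :: "nat set \<Rightarrow> ((nat \<Rightarrow> nat) \<Rightarrow> 'a::real_vector) \<Rightarrow> (nat \<Rightarrow> nat) \<Rightarrow> 'a" where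
  "EE A f c = (\<Sum>x\<in>PiE A (\<lambda>_. {..<m}). (\<Prod>v\<in>A. p (x v)) *\<^sub>R f (override_on c x A))"

lemma p_le_1: "i < m \<Longrightarrow> p i \<le> 1"
  using member_le_sum[of i "{..<m}" p] p_pos p_sum by (auto simp: less_imp_le)

lemma weight_nonneg: "x \<in> PiE A (\<lambda>_. {..<m}) \<Longrightarrow> 0 \<le> (\<Prod>v\<in>A. p (x v))"
  using p_pos by (intro prod_nonneg) (auto simp: PiE_iff less_imp_le)

lemma weight_sum: "finite A \<Longrightarrow> (\<Sum>x\<in>PiE A (\<lambda>_. {..<m}). (\<Prod>v\<in>A. p (x v))) = 1"
  using prod_sum_PiE[of A "\<lambda>_. {..<m}" "\<lambda>_ i. p i"] by (simp add: p_sum)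

lemma EE_empty [simp]: "EE {} f c = f c"
  by (simp add: EE_def)

lemma EE_insert:
  assumes "finite A" "v \<notin> A"
  shows "EE (insert v A) f c = (\<Sum>i<m. p i *\<^sub>R EE A f (c(v := i)))"
proof -
  have inj: "inj_on (\<lambda>(y, g). g(v := y)) ({..<m} \<times> PiE A (\<lambda>_. {..<m}))"
    using assms by (intro inj_combinator) auto
  have "EE (insert v A) f c =
    (\<Sum>(i, x)\<in>{..<m} \<times> PiE A (\<lambda>_. {..<m}).
      (\<Prod>w\<in>insert v A. p ((x(v := i)) w)) *\<^sub>R f (override_on c (x(v := i)) (insert v A)))"
    unfolding EE_def PiE_insert_eq by (subst sum.reindex[OF inj]) (simp add: case_prod_unfold)
  also have "\<dots> = (\<Sum>(i, x)\<in>{..<m} \<times> PiE A (\<lambda>_. {..<m}).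
      (p i * (\<Prod>w\<in>A. p (x w))) *\<^sub>R f (override_on (c(v := i)) x A))"
  proof (intro sum.cong refl, clarify)
    fix i x
    have "(\<Prod>w\<in>A. p ((x(v := i)) w)) = (\<Prod>w\<in>A. p (x w))"
      using assms by (intro prod.cong) auto
    moreover have "override_on c (x(v := i)) (insert v A) = override_on (c(v := i)) x A"
      using assms by (auto simp: override_on_def fun_eq_iff)
    ultimately show "(\<Prod>w\<in>insert v A. p ((x(v := i)) w)) *\<^sub>R f (override_on c (x(v := i)) (insert v A))
      = (p i * (\<Prod>w\<in>A. p (x w))) *\<^sub>R f (override_on (c(v := i)) x A)"
      using assms by simp
  qed
  also have "\<dots> = (\<Sum>i<m. p i *\<^sub>R EE A f (c(v := i)))"
    by (simp add: EE_def scaleR_sum_right sum.cartesian_product)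
  finally show ?thesis .
qed

lemma EE_singleton: "EE {v} f c = (\<Sum>i<m. p i *\<^sub>R f (c(v := i)))"
  by (simp add: EE_insert)

text \<open>Tower property. It holds for every base colouring \<open>c\<close>, so conditional
  averages can be rewritten as plain equations.\<close>

lemma EE_Un:
  assumes "finite A" "finite B" "A \<inter> B = {}"
  shows "EE (A \<union> B) f c = EE A (EE B f) c"
  using assms
proof (induction A arbitrary: c rule: finite_induct)
  case (insert v A)
  then show ?case by (simp add: EE_insert)
qed simp

lemma EE_diff_eq:
  assumes "finite A" "B \<subseteq> A"
  shows "EE A f c = EE (A - B) (EE B f) c"
proof -
  have "finite B" using assms finite_subset by blast
  then have "EE (A - B \<union> B) f c = EE (A - B) (EE B f) c"
    using assms by (intro EE_Un) auto
  then show ?thesis using assms by (simp add: Un_absorb2)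
qed

lemma EE_const: "finite A \<Longrightarrow> EE A (\<lambda>_. k) c = k"
  unfolding EE_def by (simp flip: scaleR_sum_left add: weight_sum)

lemma EE_add: "EE A (\<lambda>c. f c + g c) c = EE A f c + EE A g c"
  by (simp add: EE_def scaleR_add_right sum.distrib)

lemma EE_diff: "EE A (\<lambda>c. f c - g c) c = EE A f c - EE A g c"
  by (simp add: EE_def scaleR_diff_right sum_subtractf)

lemma EE_sum: "EE A (\<lambda>c. \<Sum>i\<in>I. f i c) c = (\<Sum>i\<in>I. EE A (f i) c)"
  unfolding EE_def scaleR_sum_right by (rule sum.swap)

lemma EE_mult_left: "EE A (\<lambda>c. k * f c) c = k * EE A f c" for f :: "_ \<Rightarrow> 'a::real_algebra"
  by (simp add: EE_def sum_distrib_left)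

lemma EE_mult_right: "EE A (\<lambda>c. f c * k) c = EE A f c * k" for f :: "_ \<Rightarrow> 'a::real_algebra"
  by (simp add: EE_def sum_distrib_right)

lemma EE_mono:
  fixes f g :: "_ \<Rightarrow> real"
  assumes "\<And>c. f c \<le> g c"
  shows "EE A f c \<le> EE A g c"
  unfolding EE_def by (intro sum_mono scaleR_left_mono assms weight_nonneg)

lemma norm_EE: "norm (EE A f c) \<le> EE A (\<lambda>c. norm (f c)) c" for f :: "_ \<Rightarrow> 'a::real_normed_vector"
  unfolding EE_def
  by (rule order_trans[OF norm_sum]) (auto intro!: sum_mono simp: weight_nonneg)

lemma norm_EE_le:
  fixes f :: "_ \<Rightarrow> 'a::real_normed_vector"
  assumes "finite A" "\<And>c. norm (f c) \<le> K"
  shows "norm (EE A f c) \<le> K"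
proof -
  have "norm (EE A f c) \<le> EE A (\<lambda>c. norm (f c)) c" by (rule norm_EE)
  also have "\<dots> \<le> EE A (\<lambda>_. K) c" by (rule EE_mono) (rule assms)
  finally show ?thesis using assms(1) by (simp add: EE_const)
qed

lemma EE_pull:
  fixes f g :: "_ \<Rightarrow> 'a::real_algebra"
  assumes "depends_on B f" "A \<inter> B = {}"
  shows "EE A (\<lambda>c. f c * g c) c = f c * EE A g c"
proof -
  have "f (override_on c x A) = f c" for x
    using assms(2) by (intro depends_onD[OF assms(1)]) (auto simp: override_on_def)
  then show ?thesis by (simp add: EE_def sum_distrib_left)
qed

lemma EE_id:
  assumes "finite A" "depends_on B f" "A \<inter> B = {}"
  shows "EE A f c = f c"
proof -
  have "f (override_on c x A) = f c" for x
    using assms(3) by (intro depends_onD[OF assms(2)]) (auto simp: override_on_def)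
  then show ?thesis using assms(1) by (simp add: EE_def weight_sum flip: scaleR_sum_left)
qed

lemma depends_on_EE:
  assumes "depends_on B f"
  shows "depends_on (B - A) (EE A f)"
proof (rule depends_onI)
  fix c c' :: "nat \<Rightarrow> nat"
  assume "\<And>v. v \<in> B - A \<Longrightarrow> c v = c' v"
  then have "f (override_on c x A) = f (override_on c' x A)" for x
    by (intro depends_onD[OF assms]) (auto simp: override_on_def)
  then show "EE A f c = EE A f c'" by (simp add: EE_def)
qed

text \<open>Averaging over \<open>B\<close> first leaves \<open>f\<close> alone and turns
  \<open>g\<close> into a constant; the average over the rest of \<open>U\<close> then sees only
  \<open>f\<close>.\<close>

lemma EE_indep:
  fixes f g :: "_ \<Rightarrow> 'a::{real_algebra,comm_ring}"
  assumes U: "finite U" and f: "depends_on A f" and g: "depends_on B g"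
    and AB: "A \<inter> B = {}" "B \<subseteq> U"
  shows "EE U (\<lambda>c. f c * g c) c = EE U f c * EE U g c"
proof -
  have fin: "finite B" using AB U finite_subset by auto
  have "depends_on (B - B) (EE B g)" by (rule depends_on_EE[OF g])
  then have const: "EE B g c1 = EE B g c" for c1 unfolding depends_on_def by blast
  have 1: "EE B (\<lambda>c. f c * g c) = (\<lambda>c1. f c1 * EE B g c)"
  proof
    fix c1
    have "EE B (\<lambda>c. f c * g c) c1 = f c1 * EE B g c1"
      using AB by (intro EE_pull[OF f]) auto
    then show "EE B (\<lambda>c. f c * g c) c1 = f c1 * EE B g c" by (simp only: const[of c1])
  qed
  have 2: "EE B f = f" using EE_id[OF fin f] AB(1) by (intro ext) (auto simp: Int_commute)
  have 3: "EE B g = (\<lambda>_. EE B g c)" using const by (rule ext)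
  have "EE U g c = EE (U - B) (\<lambda>_. EE B g c) c"
    unfolding EE_diff_eq[OF U AB(2), of g c] by (rule arg_cong[OF 3])
  then have 4: "EE U g c = EE B g c" using U by (simp add: EE_const)
  have 5: "EE U (\<lambda>c. f c * g c) c = EE (U - B) (\<lambda>c1. f c1 * EE B g c) c"
    using EE_diff_eq[OF U AB(2), of "\<lambda>c. f c * g c" c] by (simp only: 1)
  have 6: "EE U f c = EE (U - B) f c"
    using EE_diff_eq[OF U AB(2), of f c] by (simp only: 2)
  show ?thesis unfolding 4 5 6 by (rule EE_mult_right)
qed

lemma EE_indep_prod:
  fixes f :: "nat \<Rightarrow> _ \<Rightarrow> 'a::{real_algebra_1,comm_ring_1}"
  assumes U: "finite U" and I: "finite I" and f: "\<And>i. i \<in> I \<Longrightarrow> depends_on (N i) (f i)"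
    and N: "\<And>i. i \<in> I \<Longrightarrow> N i \<subseteq> U"
    and disj: "\<And>i j. i \<in> I \<Longrightarrow> j \<in> I \<Longrightarrow> i \<noteq> j \<Longrightarrow> N i \<inter> N j = {}"
  shows "EE U (\<lambda>c. \<Prod>i\<in>I. f i c) c = (\<Prod>i\<in>I. EE U (f i) c)"
  using I f N disj
proof (induction I rule: finite_induct)
  case empty
  then show ?case using U by (simp add: EE_const)
next
  case (insert i I)
  have "depends_on (\<Union>j\<in>I. N j) (\<lambda>c. \<Prod>j\<in>I. f j c)"
    using insert.prems by (intro depends_on_prod depends_on_mono[OF insert.prems(1)]) auto
  moreover have "depends_on (N i) (f i)" using insert.prems by auto
  moreover have "N i \<inter> (\<Union>j\<in>I. N j) = {}" using insert.prems(3)[of i] insert.hyps by auto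
  moreover have "(\<Union>j\<in>I. N j) \<subseteq> U" using insert.prems by auto
  ultimately have "EE U (\<lambda>c. f i c * (\<Prod>j\<in>I. f j c)) c = EE U (f i) c * EE U (\<lambda>c. \<Prod>j\<in>I. f j c) c"
    using U by (intro EE_indep)
  then show ?case using insert by simp
qed

text \<open>Once the colours outside \<open>I\<close> are fixed, \<open>g v\<close> is a function of
  the colour of \<open>v\<close> alone, so the factors are independent. The induction runs over
  \<open>J\<close> while locality stays relative to the fixed set \<open>I\<close>.\<close>

lemma EE_local_prod:
  fixes g :: "nat \<Rightarrow> _ \<Rightarrow> 'a::{real_algebra_1,comm_ring_1}"
  assumes "finite J" and "J \<subseteq> I" and "\<And>v. v \<in> I \<Longrightarrow> depends_on (insert v (- I)) (g v)"
  shows "EE J (\<lambda>c. \<Prod>v\<in>J. g v c) c = (\<Prod>v\<in>J. EE {v} (g v) c)"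
  using assms(1,2)
proof (induction J arbitrary: c rule: finite_induct)
  case (insert v J)
  have dJ: "depends_on (- {v}) (\<lambda>c. \<Prod>w\<in>J. g w c)"
    using insert by (intro depends_on_prod depends_on_mono[OF assms(3)]) auto
  have dv: "depends_on (- J) (EE {v} (g v))"
    using insert by (intro depends_on_mono[OF depends_on_EE[OF assms(3)]]) auto
  have "EE (insert v J) (\<lambda>c. \<Prod>w\<in>insert v J. g w c) c
      = EE J (EE {v} (\<lambda>c. (\<Prod>w\<in>J. g w c) * g v c)) c"
    using EE_Un[of J "{v}"] insert.hyps by (simp add: mult.commute)
  also have "\<dots> = EE J (\<lambda>c. EE {v} (g v) c * (\<Prod>w\<in>J. g w c)) c"
  proof -
    have "EE {v} (\<lambda>c. (\<Prod>w\<in>J. g w c) * g v c) c1 = EE {v} (g v) c1 * (\<Prod>w\<in>J. g w c1)" for c1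
      using EE_pull[OF dJ, of "{v}" "g v" c1] by (simp only: mult.commute) auto
    then show ?thesis by presburger
  qed
  also have "\<dots> = EE {v} (g v) c * EE J (\<lambda>c. \<Prod>w\<in>J. g w c) c"
    by (rule EE_pull[OF dv]) auto
  finally show ?case using insert by simp
qed simp

lemma exp_le_quadratic: "exp x \<le> 1 + x + 3 * x\<^sup>2" if "\<bar>x\<bar> \<le> 1" for x :: real
proof -
  have "norm (exp (complex_of_real x) - (\<Sum>k\<le>1. complex_of_real x ^ k / fact k))
      \<le> exp \<bar>Re (complex_of_real x)\<bar> * norm (complex_of_real x) ^ Suc 1 / fact 1"
    by (rule Taylor_exp)
  also have "(\<Sum>k\<le>1. complex_of_real x ^ k / fact k) = of_real (1 + x)" by simp
  finally have "norm (complex_of_real (exp x - (1 + x))) \<le> exp \<bar>x\<bar> * x\<^sup>2"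
    by (simp add: exp_of_real power2_eq_square)
  then have "exp x - (1 + x) \<le> exp \<bar>x\<bar> * x\<^sup>2" unfolding norm_of_real by linarith
  also have "exp \<bar>x\<bar> \<le> exp 1" using that by simp
  also have "exp 1 \<le> (3::real)" by (rule exp_le)
  finally show ?thesis by (simp add: mult_right_mono)
qed

text \<open>In the manner of McDiarmid: revealing the colour of \<open>v\<close> moves the
  conditional mean by at most \<open>D\<close>, and exp x <= 1 + x + 3 x^2 turns this into one
  factor exp (3 D^2) per vertex. It will bound the modulus created by the tilt.\<close>

lemma EE_exp_bounded_differences:
  fixes f :: "_ \<Rightarrow> real" and D :: real
  assumes "finite A" and D: "D \<le> 1"
    and bd: "\<And>v c i j. v \<in> A \<Longrightarrow> i < m \<Longrightarrow> j < m \<Longrightarrow> \<bar>f (c(v := i)) - f (c(v := j))\<bar> \<le> D"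
  shows "EE A (\<lambda>c. exp (f c)) c \<le> exp (3 * real (card A) * D\<^sup>2 + EE A f c)"
  using assms(1) bd
proof (induction A arbitrary: c rule: finite_induct)
  case (insert v A)
  define X where "X i = EE A f (c(v := i))" for i
  define \<mu> where "\<mu> = (\<Sum>i<m. p i * X i)"
  have D0: "0 \<le> D" using insert.prems[of v 0 0] m_ge by force
  \<comment> \<open>The two conditional means are coupled by using the same colours on
    \<open>A\<close>.\<close>
  have XX: "\<bar>X i - X j\<bar> \<le> D" if "i < m" "j < m" for i j
  proof -
    have eq: "X i' = EE A (\<lambda>c. f (c(v := i'))) c" for i'
    proof -
      have "override_on (c(v := i')) x A = (override_on c x A)(v := i')" for x
        using insert.hyps by (auto simp: override_on_def fun_eq_iff)
      then show ?thesis by (simp add: X_def EE_def)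
    qed
    have "X i - X j = EE A (\<lambda>c. f (c(v := i)) - f (c(v := j))) c"
      unfolding eq by (simp add: EE_diff)
    then show ?thesis using norm_EE_le[of A "\<lambda>c. f (c(v := i)) - f (c(v := j))" D c] insert that by simp
  qed
  have X\<mu>: "\<bar>X i - \<mu>\<bar> \<le> D" if "i < m" for i
  proof -
    have "X i - \<mu> = (\<Sum>j<m. p j * (X i - X j))"
      unfolding \<mu>_def right_diff_distrib sum_subtractf by (simp add: p_sum flip: sum_distrib_right)
    also have "\<bar>\<dots>\<bar> \<le> (\<Sum>j<m. p j * D)"
      by (rule order_trans[OF sum_abs]) (auto intro!: sum_mono mult_left_mono XX simp: abs_mult that p_pos less_imp_le)
    also have "\<dots> = D" by (simp add: p_sum flip: sum_distrib_right)
    finally show ?thesis .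
  qed
  have "(\<Sum>i<m. p i * exp (X i - \<mu>)) \<le> (\<Sum>i<m. p i * (1 + (X i - \<mu>) + 3 * D\<^sup>2))"
  proof (intro sum_mono mult_left_mono)
    fix i assume "i \<in> {..<m}"
    then have i: "i < m" by simp
    have "exp (X i - \<mu>) \<le> 1 + (X i - \<mu>) + 3 * (X i - \<mu>)\<^sup>2"
      using X\<mu>[OF i] D by (intro exp_le_quadratic) auto
    also have "(X i - \<mu>)\<^sup>2 \<le> D\<^sup>2" using X\<mu>[OF i] by (simp add: abs_le_square_iff[symmetric] D0)
    finally show "exp (X i - \<mu>) \<le> 1 + (X i - \<mu>) + 3 * D\<^sup>2" by simp
    show "0 \<le> p i" using p_pos i by (simp add: less_imp_le)
  qed
  also have "\<dots> = (\<Sum>i<m. p i) + (\<mu> - \<mu> * (\<Sum>i<m. p i)) + 3 * D\<^sup>2 * (\<Sum>i<m. p i)"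
  proof -
    have "p i * (1 + (X i - \<mu>) + 3 * D\<^sup>2) = p i + p i * X i - \<mu> * p i + 3 * D\<^sup>2 * p i" for i
      by (simp add: algebra_simps)
    then show ?thesis by (simp add: \<mu>_def sum.distrib sum_subtractf flip: sum_distrib_left)
  qed
  also have "\<dots> \<le> exp (3 * D\<^sup>2)" by (simp add: p_sum)
  finally have key: "(\<Sum>i<m. p i * exp (X i - \<mu>)) \<le> exp (3 * D\<^sup>2)" .
  have "EE (insert v A) (\<lambda>c. exp (f c)) c = (\<Sum>i<m. p i * EE A (\<lambda>c. exp (f c)) (c(v := i)))"
    using insert.hyps by (simp add: EE_insert)
  also have "\<dots> \<le> (\<Sum>i<m. p i * exp (3 * real (card A) * D\<^sup>2 + X i))"
    unfolding X_def using insert p_pos by (intro sum_mono mult_left_mono insert.IH) (auto simp: less_imp_le)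
  also have "\<dots> = exp (3 * real (card A) * D\<^sup>2 + \<mu>) * (\<Sum>i<m. p i * exp (X i - \<mu>))"
    by (simp add: sum_distrib_left mult.left_commute[of "exp _"] flip: exp_add)
  also have "\<dots> \<le> exp (3 * real (card A) * D\<^sup>2 + \<mu>) * exp (3 * D\<^sup>2)"
    using key by (intro mult_left_mono) auto
  also have "\<dots> = exp (3 * real (card (insert v A)) * D\<^sup>2 + EE (insert v A) f c)"
    using insert.hyps by (simp add: EE_insert \<mu>_def X_def algebra_simps flip: exp_add)
  finally show ?case .
qed simp

end

section \<open>The Gaussian approximation of the characteristic function\<close>

lemma norm_exp_minus_1_le: "norm (exp w - 1) \<le> norm w * exp (norm w)" for w :: complex
proof -
  have "norm (exp w - (\<Sum>k\<le>0. w ^ k / fact k)) \<le> exp \<bar>Re w\<bar> * norm w ^ Suc 0 / fact 0"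
    by (rule Taylor_exp)
  also have "\<dots> \<le> exp (norm w) * norm w"
    using abs_Re_le_cmod[of w] by (simp add: mult_right_mono)
  finally show ?thesis by (simp add: mult.commute)
qed

lemma norm_exp_minus_1_minus_le: "norm (exp w - 1 - w) \<le> (norm w)\<^sup>2 * exp (norm w)" for w :: complex
proof -
  have "norm (exp w - (\<Sum>k\<le>1. w ^ k / fact k)) \<le> exp \<bar>Re w\<bar> * norm w ^ Suc 1 / fact 1"
    by (rule Taylor_exp)
  also have "\<dots> \<le> exp (norm w) * (norm w)\<^sup>2"
    using abs_Re_le_cmod[of w] by (simp add: mult_right_mono power2_eq_square)
  finally show ?thesis by (simp add: mult.commute diff_diff_eq)
qed

locale palette_deg = palette +
  fixes r :: nat
  assumes r_ge: "r \<ge> 1"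
begin

text \<open>Write \<open>M\<^sub>i\<close> and \<open>N\<^sub>i\<close> as sums of colour indicators, and let \<open>a\<close>, \<open>b\<close> be the coefficients of
  \<open>M\<close>, \<open>N\<close> in a linear combination. In the Hoeffding decomposition of that combination,
  \<open>gbar\<close> is the contribution of a vertex and \<open>kap\<close> that of an edge.\<close>

definition gam :: "(nat \<Rightarrow> 'a::real_normed_field) \<Rightarrow> (nat \<Rightarrow> 'a) \<Rightarrow> nat \<Rightarrow> 'a" where
  "gam a b i = b i + of_nat r * of_real (p i) * a i"

definition gmean :: "(nat \<Rightarrow> 'a::real_normed_field) \<Rightarrow> (nat \<Rightarrow> 'a) \<Rightarrow> 'a" where
  "gmean a b = (\<Sum>j<m. of_real (p j) * gam a b j)"

definition gbar :: "(nat \<Rightarrow> 'a::real_normed_field) \<Rightarrow> (nat \<Rightarrow> 'a) \<Rightarrow> nat \<Rightarrow> 'a" where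
  "gbar a b i = gam a b i - gmean a b"

definition cind :: "nat \<Rightarrow> nat \<Rightarrow> real" where
  "cind l i = (if i = l then 1 else 0) - p l"

definition kap :: "(nat \<Rightarrow> 'a::real_normed_field) \<Rightarrow> nat \<Rightarrow> nat \<Rightarrow> 'a" where
  "kap a i j = (\<Sum>l<m. a l * of_real (cind l i) * of_real (cind l j))"

text \<open>The variance per vertex: vertex and edge pieces are orthogonal, and there are
  \<open>r / 2\<close> edges per vertex. For complex coefficients the squares carry no conjugation,
  so this is the analytic extension of the variance that belongs in exp (- n qf / 2).\<close>

definition qf :: "(nat \<Rightarrow> 'a::real_normed_field) \<Rightarrow> (nat \<Rightarrow> 'a) \<Rightarrow> 'a" where
  "qf a b = (\<Sum>i<m. of_real (p i) * (gbar a b i)\<^sup>2)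
     + of_nat r / 2 * (\<Sum>i<m. \<Sum>j<m. of_real (p i) * of_real (p j) * (kap a i j)\<^sup>2)"

lemma kap_sym: "kap a i j = kap a j i"
  by (simp add: kap_def mult_ac)

lemma cind_mean: "l < m \<Longrightarrow> (\<Sum>i<m. p i * cind l i) = 0"
  by (simp add: cind_def right_diff_distrib sum_subtractf p_sum if_distrib[of "(*) _"] cong: if_cong
      flip: sum_distrib_right)

text \<open>Degeneracy of the edge kernel: its mean over one endpoint vanishes whatever the colour
  of the other. The orthogonality relations for edge terms follow from this.\<close>

lemma kap_mean: "(\<Sum>i<m. p i *\<^sub>R kap a i j) = 0"
proof -
  have "(\<Sum>i<m. p i *\<^sub>R kap a i j) = (\<Sum>l<m. \<Sum>i<m. of_real (p i * cind l i) * (a l * of_real (cind l j)))"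
    unfolding kap_def scaleR_sum_right
    by (subst sum.swap) (simp add: scaleR_conv_of_real mult_ac)
  also have "\<dots> = (\<Sum>l<m. of_real (\<Sum>i<m. p i * cind l i) * (a l * of_real (cind l j)))"
    by (simp only: sum_distrib_right of_real_sum)
  also have "\<dots> = 0" by (simp add: cind_mean)
  finally show ?thesis .
qed

lemma gbar_mean: "(\<Sum>i<m. p i *\<^sub>R gbar a b i) = 0"
proof -
  have "(\<Sum>i<m. p i *\<^sub>R gbar a b i) = gmean a b - (\<Sum>i<m. p i) *\<^sub>R gmean a b"
    unfolding gbar_def scaleR_diff_right sum_subtractf scaleR_sum_left
    by (simp add: gmean_def scaleR_conv_of_real)
  then show ?thesis by (simp add: p_sum)
qed

lemma abs_cind_le: "l < m \<Longrightarrow> \<bar>cind l i\<bar> \<le> 1"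
  using p_le_1[of l] p_pos[of l] by (auto simp: cind_def)

lemma sum_abs_cind_le: "(\<Sum>l<m. \<bar>cind l i\<bar>) \<le> 2"
proof -
  have "(\<Sum>l<m. \<bar>cind l i\<bar>) \<le> (\<Sum>l<m. (if l = i then 1 else 0) + p l)"
  proof (rule sum_mono)
    fix l assume "l \<in> {..<m}"
    then have "p l > 0" using p_pos by simp
    then show "\<bar>cind l i\<bar> \<le> (if l = i then 1 else 0) + p l" by (auto simp: cind_def)
  qed
  also have "\<dots> \<le> 2" by (simp add: sum.distrib p_sum)
  finally show ?thesis .
qed

lemma norm_kap_le:
  fixes a :: "nat \<Rightarrow> 'a::real_normed_field"
  assumes a_le: "\<And>i. norm (a i) \<le> \<tau>"
  shows "norm (kap a i j) \<le> 2 * \<tau>"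
proof -
  have \<tau>: "0 \<le> \<tau>" using a_le[of 0] norm_ge_zero order_trans by blast
  have "norm (kap a i j) \<le> (\<Sum>l<m. norm (a l) * \<bar>cind l i\<bar> * \<bar>cind l j\<bar>)"
    unfolding kap_def by (rule order_trans[OF norm_sum]) (simp add: norm_mult)
  also have "\<dots> \<le> (\<Sum>l<m. \<tau> * 1 * \<bar>cind l j\<bar>)"
    using a_le abs_cind_le \<tau> by (intro sum_mono mult_right_mono mult_mono) auto
  also have "\<dots> \<le> \<tau> * 2" using sum_abs_cind_le[of j] \<tau>
    by (simp add: mult_left_mono flip: sum_distrib_left)
  finally show ?thesis by simp
qed

context
  fixes a b :: "nat \<Rightarrow> 'a::real_normed_field" and \<tau> :: real
  assumes a_le: "\<And>i. norm (a i) \<le> \<tau>" and b_le: "\<And>i. norm (b i) \<le> \<tau>"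
begin

lemma norm_gam_le: "i < m \<Longrightarrow> norm (gam a b i) \<le> (1 + r) * \<tau>"
proof -
  assume i: "i < m"
  have \<tau>: "0 \<le> \<tau>" using a_le[of 0] norm_ge_zero order_trans by blast
  have "norm (gam a b i) \<le> norm (b i) + real r * p i * norm (a i)"
    unfolding gam_def by (rule order_trans[OF norm_triangle_ineq]) (simp add: norm_mult p_pos[OF i] less_imp_le)
  also have "real r * p i * norm (a i) \<le> real r * 1 * \<tau>"
    using a_le p_le_1[OF i] p_pos[OF i] by (intro mult_mono) (auto simp: less_imp_le)
  finally show ?thesis using b_le[of i] by (simp add: algebra_simps)
qed

lemma norm_gbar_le: "i < m \<Longrightarrow> norm (gbar a b i) \<le> 2 * (1 + r) * \<tau>"
proof -
  assume i: "i < m"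
  have "norm (gmean a b) \<le> (\<Sum>j<m. p j * ((1 + r) * \<tau>))"
    unfolding gmean_def using p_pos norm_gam_le
    by (intro sum_norm_le) (auto simp: norm_mult less_imp_le mult_left_mono)
  also have "\<dots> = (1 + r) * \<tau>" by (simp add: p_sum flip: sum_distrib_right)
  finally have "norm (gmean a b) \<le> (1 + r) * \<tau>" .
  then show ?thesis using norm_gam_le[OF i] norm_triangle_ineq4[of "gam a b i" "gmean a b"]
    by (simp add: gbar_def algebra_simps)
qed

end

end

section \<open>Dependency neighbourhoods and covariances of the local summands\<close>

locale colour_graph = palette_deg +
  fixes E :: "nat \<Rightarrow> nat \<Rightarrow> bool" and n :: nat
  assumes reg: "regular_graph E n r"
begin

definition nb :: "nat \<Rightarrow> nat set" where "nb v = {u. u < n \<and> E v u}"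
definition cl :: "nat \<Rightarrow> nat set" where "cl v = insert v (nb v)"
text \<open>A summand attached to \<open>w\<close> depends on the colours in \<open>cl w\<close>. So
  \<open>touch D\<close> lists the summands that can see a colour in \<open>D\<close>, and
  \<open>nbhd D\<close> the colours seen by the summands of \<open>D\<close>; alternating the two
  builds the layers needed for Stein's method.\<close>

definition touch :: "nat set \<Rightarrow> nat set" where "touch D = {w. w < n \<and> cl w \<inter> D \<noteq> {}}"
definition nbhd :: "nat set \<Rightarrow> nat set" where "nbhd D = (\<Union>w\<in>D. cl w)"

lemma finite_nb [simp]: "finite (nb v)" by (simp add: nb_def)
lemma finite_cl [simp]: "finite (cl v)" by (simp add: cl_def)
lemma nb_less: "u \<in> nb v \<Longrightarrow> u < n" by (simp add: nb_def)
lemma card_nb: "v < n \<Longrightarrow> card (nb v) = r"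
  using reg by (simp add: regular_graph_def nb_def)
lemma nb_sym: "v < n \<Longrightarrow> u \<in> nb v \<Longrightarrow> v \<in> nb u"
  using reg by (auto simp: regular_graph_def nb_def)
lemma nb_irrefl: "v < n \<Longrightarrow> v \<notin> nb v"
  using reg by (auto simp: regular_graph_def nb_def)
lemma cl_subset: "v < n \<Longrightarrow> cl v \<subseteq> {..<n}"
  by (auto simp: cl_def nb_def)
lemma card_cl: "v < n \<Longrightarrow> card (cl v) = r + 1"
  by (simp add: cl_def nb_irrefl card_nb)
lemma self_cl: "v \<in> cl v" by (simp add: cl_def)
lemma cl_sym: "v < n \<Longrightarrow> u \<in> cl v \<Longrightarrow> v \<in> cl u"
  using nb_sym by (auto simp: cl_def)

lemma finite_touch [simp]: "finite (touch D)" by (simp add: touch_def)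

lemma card_nbhd_le:
  assumes "D \<subseteq> {..<n}"
  shows "card (nbhd D) \<le> (r + 1) * card D"
proof -
  have "finite D" using assms finite_subset by auto
  then have "card (nbhd D) \<le> (\<Sum>w\<in>D. card (cl w))" unfolding nbhd_def by (rule card_UN_le)
  also have "\<dots> = (\<Sum>w\<in>D. r + 1)" using assms card_cl by (intro sum.cong) auto
  finally show ?thesis by (simp add: algebra_simps)
qed

lemma touch_subset_nbhd: "D \<subseteq> {..<n} \<Longrightarrow> touch D \<subseteq> nbhd D"
  using cl_sym by (fastforce simp: touch_def nbhd_def)

lemma nbhd_subset: "D \<subseteq> {..<n} \<Longrightarrow> nbhd D \<subseteq> {..<n}"
  using cl_subset by (fastforce simp: nbhd_def)

lemma finite_nbhd: "D \<subseteq> {..<n} \<Longrightarrow> finite (nbhd D)"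
  using nbhd_subset finite_subset by blast

lemma touch_subset: "touch D \<subseteq> {..<n}" by (auto simp: touch_def)

lemma card_touch_le: "D \<subseteq> {..<n} \<Longrightarrow> card (touch D) \<le> (r + 1) * card D"
  using card_mono[OF finite_nbhd touch_subset_nbhd] card_nbhd_le by (meson order_trans)

lemma EE_single:
  "x < n \<Longrightarrow> EE {..<n} (\<lambda>c. F (c x)) c0 = (\<Sum>i<m. p i *\<^sub>R F i)"
proof -
  assume x: "x < n"
  have "EE {x} (\<lambda>c. F (c x)) = (\<lambda>_. \<Sum>i<m. p i *\<^sub>R F i)" by (intro ext) (simp add: EE_singleton)
  then show ?thesis using EE_diff_eq[of "{..<n}" "{x}" "\<lambda>c. F (c x)" c0] x by (simp add: EE_const)
qed

lemma EE_pair: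
  assumes "x < n" "y < n" "x \<noteq> y"
  shows "EE {..<n} (\<lambda>c. F (c x) (c y)) c0 = (\<Sum>i<m. \<Sum>j<m. p i *\<^sub>R p j *\<^sub>R F i j)"
proof -
  have "EE {..<n} (\<lambda>c. F (c x) (c y)) c0 = EE ({..<n} - {x, y}) (EE {x, y} (\<lambda>c. F (c x) (c y))) c0"
    using assms by (intro EE_diff_eq) auto
  also have "EE {x, y} (\<lambda>c. F (c x) (c y)) = (\<lambda>_. \<Sum>i<m. \<Sum>j<m. p i *\<^sub>R p j *\<^sub>R F i j)"
    using assms by (intro ext) (simp add: EE_insert EE_singleton scaleR_sum_right)
  finally show ?thesis by (simp add: EE_const)
qed

text \<open>Averaging over the colour of \<open>x\<close> alone already annihilates the product. In
  the relations below, \<open>x\<close> is an endpoint that occurs in one factor only.\<close>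

lemma EE_kap_zero:
  assumes x: "x < n" "x \<noteq> y" and g: "depends_on (- {x}) g"
  shows "EE {..<n} (\<lambda>c. kap a (c x) (c y) * g c) c0 = 0"
proof -
  have "EE {x} (\<lambda>c. g c * kap a (c x) (c y)) c = 0" for c
    using EE_pull[OF g, of "{x}" "\<lambda>c. kap a (c x) (c y)" c] x by (simp add: EE_singleton kap_mean)
  then have "EE {x} (\<lambda>c. g c * kap a (c x) (c y)) = (\<lambda>_. 0)" by auto
  then show ?thesis
    using EE_diff_eq[of "{..<n}" "{x}" "\<lambda>c. g c * kap a (c x) (c y)" c0] x(1)
    by (simp add: mult.commute EE_const)
qed

lemma EE_gbar_zero:
  assumes x: "x < n" and g: "depends_on (- {x}) g"
  shows "EE {..<n} (\<lambda>c. gbar a b (c x) * g c) c0 = 0"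
proof -
  have "EE {x} (\<lambda>c. g c * gbar a b (c x)) c = 0" for c
    using EE_pull[OF g, of "{x}" "\<lambda>c. gbar a b (c x)" c] by (simp add: EE_singleton gbar_mean)
  then have "EE {x} (\<lambda>c. g c * gbar a b (c x)) = (\<lambda>_. 0)" by auto
  then show ?thesis
    using EE_diff_eq[of "{..<n}" "{x}" "\<lambda>c. g c * gbar a b (c x)" c0] x(1)
    by (simp add: mult.commute EE_const)
qed

text \<open>Each edge term is shared equally by its two endpoints.\<close>

definition yv :: "(nat \<Rightarrow> 'a::real_normed_field) \<Rightarrow> (nat \<Rightarrow> 'a) \<Rightarrow> nat \<Rightarrow> (nat \<Rightarrow> nat) \<Rightarrow> 'a" where
  "yv a b v c = gbar a b (c v) + (\<Sum>u\<in>nb v. kap a (c v) (c u)) / 2"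

definition Zt :: "(nat \<Rightarrow> 'a::real_normed_field) \<Rightarrow> (nat \<Rightarrow> 'a) \<Rightarrow> (nat \<Rightarrow> nat) \<Rightarrow> 'a" where
  "Zt a b c = (\<Sum>v<n. yv a b v c)"

lemma dep_at1: "x \<in> B \<Longrightarrow> depends_on B (\<lambda>c. F (c x))"
  unfolding depends_on_def by simp

lemma dep_at2: "x \<in> B \<Longrightarrow> y \<in> B \<Longrightarrow> depends_on B (\<lambda>c. F (c x) (c y))"
  unfolding depends_on_def by simp

lemma dep_yv: "depends_on (cl v) (yv a b v)"
  unfolding depends_on_def yv_def cl_def by (auto intro!: sum.cong)

lemma EE_gbar_kap:
  assumes "v < n" "w < n" "u < n" "w \<noteq> u"
  shows "EE {..<n} (\<lambda>c. kap a (c w) (c u) * gbar a' b' (c v)) c0 = 0"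
proof (cases "v = w")
  case False
  then show ?thesis using assms by (intro EE_kap_zero) (auto intro: dep_at1)
next
  case True
  then have "EE {..<n} (\<lambda>c. kap a (c u) (c w) * gbar a' b' (c v)) c0 = 0"
    using assms by (intro EE_kap_zero) (auto intro: dep_at1)
  then show ?thesis by (simp add: kap_sym)
qed

lemma EE_gbar_yv:
  assumes "v < n" "w < n"
  shows "EE {..<n} (\<lambda>c. gbar a b (c v) * yv a b w c) c0 =
    (if w = v then (\<Sum>i<m. of_real (p i) * (gbar a b i)\<^sup>2) else 0)"
proof -
  have eq: "gbar a b (c v) * yv a b w c = gbar a b (c v) * gbar a b (c w)
      + (\<Sum>u\<in>nb w. kap a (c w) (c u) * gbar a b (c v)) * (1 / 2)" for c
    by (simp add: yv_def distrib_left sum_distrib_left sum_divide_distrib mult.commute)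
  have "EE {..<n} (\<lambda>c. gbar a b (c v) * yv a b w c) c0 =
     EE {..<n} (\<lambda>c. gbar a b (c v) * gbar a b (c w)) c0 +
     (\<Sum>u\<in>nb w. EE {..<n} (\<lambda>c. kap a (c w) (c u) * gbar a b (c v)) c0) * (1 / 2)"
    by (simp only: eq EE_add EE_mult_right EE_sum)
  also have "(\<Sum>u\<in>nb w. EE {..<n} (\<lambda>c. kap a (c w) (c u) * gbar a b (c v)) c0) = 0"
    using assms nb_less nb_irrefl by (intro sum.neutral ballI EE_gbar_kap) auto
  also have "EE {..<n} (\<lambda>c. gbar a b (c v) * gbar a b (c w)) c0 =
      (if w = v then (\<Sum>i<m. of_real (p i) * (gbar a b i)\<^sup>2) else 0)"
  proof (cases "w = v")
    case True
    then show ?thesis using assms EE_single[of v "\<lambda>i. gbar a b i * gbar a b i" c0]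
      by (simp add: power2_eq_square scaleR_conv_of_real)
  next
    case False
    then show ?thesis using assms by (auto intro!: EE_gbar_zero dep_at1)
  qed
  finally show ?thesis by simp
qed

abbreviation "kap2 a \<equiv> (\<Sum>i<m. \<Sum>j<m. of_real (p i) * of_real (p j) * (kap a i j)\<^sup>2)"

text \<open>If the edges differ, some endpoint of the first is not on the second, and averaging over
  it gives zero; otherwise the two are orderings of the same edge.\<close>

lemma EE_kap_kap:
  assumes "v < n" "u < n" "w < n" "x < n" "u \<noteq> v" "w \<noteq> x"
  shows "EE {..<n} (\<lambda>c. kap a (c v) (c u) * kap a (c w) (c x)) c0 =
    (if {v, u} = {w, x} then kap2 a else 0)"
proof -
  have K: "EE {..<n} (\<lambda>c. kap a (c v) (c u) * kap a (c v) (c u)) c0 = kap2 a"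
    using EE_pair[of v u "\<lambda>i j. kap a i j * kap a i j" c0] assms
    by (simp add: power2_eq_square scaleR_conv_of_real mult.assoc)
  consider "w = v" "x = u" | "w = u" "x = v" | "v \<notin> {w, x}" | "u \<notin> {w, x}" using assms by auto
  then show ?thesis
  proof cases
    case 1 then show ?thesis using K by simp
  next
    case 2 then show ?thesis using K kap_sym[of a] by (simp add: insert_commute)
  next
    case 3
    then have "EE {..<n} (\<lambda>c. kap a (c v) (c u) * kap a (c w) (c x)) c0 = 0"
      using assms by (intro EE_kap_zero) (auto intro!: dep_at2)
    then show ?thesis using 3 by auto
  next
    case 4
    then have "EE {..<n} (\<lambda>c. kap a (c u) (c v) * kap a (c w) (c x)) c0 = 0"
      using assms by (intro EE_kap_zero) (auto intro!: dep_at2)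
    then show ?thesis using 4 by (auto simp: kap_sym[of a "_ u"])
  qed
qed

text \<open>The edge term occurs, with weight one half, in the summands of exactly its two
  endpoints.\<close>

lemma EE_kap_yv:
  assumes "v < n" "u \<in> nb v" "w < n"
  shows "EE {..<n} (\<lambda>c. kap a (c v) (c u) * yv a b w c) c0 =
    (if w = v \<or> w = u then kap2 a / 2 else 0)"
proof -
  have uv: "u < n" "u \<noteq> v" using assms nb_less nb_irrefl by auto
  have eq: "kap a (c v) (c u) * yv a b w c = kap a (c v) (c u) * gbar a b (c w)
      + (\<Sum>x\<in>nb w. kap a (c v) (c u) * kap a (c w) (c x)) * (1 / 2)" for c
    by (simp add: yv_def distrib_left sum_distrib_left sum_divide_distrib)
  have "EE {..<n} (\<lambda>c. kap a (c v) (c u) * yv a b w c) c0 =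
     EE {..<n} (\<lambda>c. kap a (c v) (c u) * gbar a b (c w)) c0 +
     (\<Sum>x\<in>nb w. EE {..<n} (\<lambda>c. kap a (c v) (c u) * kap a (c w) (c x)) c0) * (1 / 2)"
    by (simp only: eq EE_add EE_mult_right EE_sum)
  also have "EE {..<n} (\<lambda>c. kap a (c v) (c u) * gbar a b (c w)) c0 = 0"
    using assms uv by (intro EE_gbar_kap) auto
  also have "(\<Sum>x\<in>nb w. EE {..<n} (\<lambda>c. kap a (c v) (c u) * kap a (c w) (c x)) c0) =
      (\<Sum>x\<in>nb w. if {v, u} = {w, x} then kap2 a else 0)"
    using assms uv nb_less nb_irrefl by (intro sum.cong EE_kap_kap) auto
  also have "\<dots> = (if w = v \<or> w = u then kap2 a else 0)"
  proof (cases "w = v \<or> w = u")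
    case True
    define x0 where "x0 = (if w = v then u else v)"
    have x0: "x0 \<in> nb w" using True assms nb_sym by (auto simp: x0_def)
    have "(\<Sum>x\<in>nb w. if {v, u} = {w, x} then kap2 a else 0) = (\<Sum>x\<in>nb w. if x0 = x then kap2 a else 0)"
      using True uv by (intro sum.cong) (auto simp: x0_def doubleton_eq_iff)
    then show ?thesis using True x0 by simp
  next
    case False
    then show ?thesis by (auto simp: doubleton_eq_iff intro!: sum.neutral)
  qed
  finally show ?thesis by (cases "w = v \<or> w = u") auto
qed

text \<open>By orthogonality \<open>yv a b v\<close> correlates only with the summands in
  \<open>cl v\<close>, so every \<open>A\<close> in between gives the same value. That it does not
  depend on \<open>v\<close> is due to regularity.\<close>

lemma EE_yv_local:
  assumes v: "v < n" and A: "cl v \<subseteq> A" "A \<subseteq> {..<n}"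
  shows "EE {..<n} (\<lambda>c. yv a b v c * (\<Sum>w\<in>A. yv a b w c)) c0 = qf a b"
proof -
  have fin: "finite A" using A finite_subset by auto
  have A_less: "w < n" if "w \<in> A" for w using A that by auto
  have "EE {..<n} (\<lambda>c. yv a b v c * (\<Sum>w\<in>A. yv a b w c)) c0 =
     (\<Sum>w\<in>A. EE {..<n} (\<lambda>c. gbar a b (c v) * yv a b w c + (\<Sum>u\<in>nb v. kap a (c v) (c u) * yv a b w c) * (1 / 2)) c0)"
  proof -
    have "yv a b v c * yv a b w c = gbar a b (c v) * yv a b w c
        + (\<Sum>u\<in>nb v. kap a (c v) (c u) * yv a b w c) * (1 / 2)" for c w
      by (simp add: yv_def[of a b v] distrib_right sum_distrib_right sum_divide_distrib)
    then show ?thesis by (simp only: sum_distrib_left EE_sum)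
  qed
  also have "\<dots> = (\<Sum>w\<in>A. EE {..<n} (\<lambda>c. gbar a b (c v) * yv a b w c) c0) +
     (\<Sum>w\<in>A. \<Sum>u\<in>nb v. EE {..<n} (\<lambda>c. kap a (c v) (c u) * yv a b w c) c0) * (1 / 2)"
    by (simp only: EE_add EE_sum EE_mult_right sum.distrib sum_distrib_right)
  also have "(\<Sum>w\<in>A. EE {..<n} (\<lambda>c. gbar a b (c v) * yv a b w c) c0)
      = (\<Sum>w\<in>A. if w = v then (\<Sum>i<m. of_real (p i) * (gbar a b i)\<^sup>2) else 0)"
    using A_less v by (intro sum.cong EE_gbar_yv) auto
  also have "\<dots> = (\<Sum>i<m. of_real (p i) * (gbar a b i)\<^sup>2)"
    using fin A self_cl[of v] by auto
  also have "(\<Sum>w\<in>A. \<Sum>u\<in>nb v. EE {..<n} (\<lambda>c. kap a (c v) (c u) * yv a b w c) c0)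
      = (\<Sum>u\<in>nb v. \<Sum>w\<in>A. if w = v \<or> w = u then kap2 a / 2 else 0)"
    using A_less v by (subst sum.swap) (intro sum.cong EE_kap_yv; auto)
  also have "\<dots> = (\<Sum>u\<in>nb v. kap2 a)"
  proof (rule sum.cong[OF refl])
    fix u assume u: "u \<in> nb v"
    have "(\<Sum>w\<in>A. if w = v \<or> w = u then kap2 a / 2 else 0) = (\<Sum>w\<in>{v, u}. kap2 a / 2)"
      using u A fin by (intro sum.mono_neutral_cong_right) (auto simp: cl_def)
    also have "\<dots> = kap2 a"
    proof -
      have "v \<noteq> u" using u v nb_irrefl by auto
      then show ?thesis by simp
    qed
    finally show "(\<Sum>w\<in>A. if w = v \<or> w = u then kap2 a / 2 else 0) = kap2 a" .
  qed
  also have "\<dots> = of_nat r * kap2 a" using v by (simp add: card_nb)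
  finally show ?thesis by (simp add: qf_def)
qed

lemma EE_yv_zero:
  assumes "v < n"
  shows "EE {..<n} (yv a b v) c0 = 0"
proof -
  have 1: "EE {..<n} (\<lambda>c. gbar a b (c v)) c0 = 0"
    using EE_gbar_zero[where g="\<lambda>_. 1", OF assms depends_on_const] by simp
  have 2: "EE {..<n} (\<lambda>c. kap a (c v) (c u)) c0 = 0" if "u \<in> nb v" for u
  proof -
    have "v \<noteq> u" using that nb_irrefl assms by auto
    then show ?thesis using EE_kap_zero[where g="\<lambda>_. 1", OF assms _ depends_on_const] by simp
  qed
  have "EE {..<n} (yv a b v) c0 = EE {..<n} (\<lambda>c. gbar a b (c v) + (\<Sum>u\<in>nb v. kap a (c v) (c u)) * (1 / 2)) c0"
    by (rule arg_cong[where f="\<lambda>f. EE {..<n} f c0"]) (simp add: yv_def fun_eq_iff)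
  also have "\<dots> = 0" using 1 2 by (simp only: EE_add EE_mult_right EE_sum) simp
  finally show ?thesis .
qed

text \<open>Decay enters as an assumption with an arbitrary bound \<Delta> and is supplied later by
  \<open>char_decay\<close>; (r + 1)^5 bounds the number of colours that the error terms of
  \<open>stein_local\<close> involve.\<close>

context
  fixes a b :: "nat \<Rightarrow> complex" and \<tau> s \<Delta> :: real and c0 :: "nat \<Rightarrow> nat"
  assumes a_le: "\<And>i. norm (a i) \<le> \<tau>" and b_le: "\<And>i. norm (b i) \<le> \<tau>"
    and a_out: "\<And>i. i \<ge> m \<Longrightarrow> a i = 0" and b_out: "\<And>i. i \<ge> m \<Longrightarrow> b i = 0"
    and s: "0 \<le> s" "s \<le> 1"
    and decay: "\<And>B L M. B \<subseteq> {..<n} \<Longrightarrow> card B \<le> (r + 1) ^ 5 \<Longrightarrow> depends_on B L \<Longrightarrow>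
      (\<And>c. norm (L c) \<le> M) \<Longrightarrow>
      norm (EE {..<n} (\<lambda>c. L c * exp (\<i> * of_real s * Zt a b c)) c0) \<le> M * \<Delta>"
begin

lemma tau_nonneg: "0 \<le> \<tau>"
  using a_le[of 0] norm_ge_zero order_trans by blast

text \<open>Colourings are arbitrary functions on the naturals here, so colours >= m occur as well;
  there the coefficients vanish and only the mean is left.\<close>

lemma norm_gbar_le': "norm (gbar a b i) \<le> 2 * (1 + r) * \<tau>"
proof (cases "i < m")
  case True
  then show ?thesis by (rule norm_gbar_le[OF a_le b_le])
next
  case False
  have "norm (gmean a b) \<le> (\<Sum>j<m. p j * ((1 + r) * \<tau>))"
    unfolding gmean_def using p_pos norm_gam_le[OF a_le b_le]
    by (intro sum_norm_le) (auto simp: norm_mult less_imp_le mult_left_mono)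
  also have "\<dots> = (1 + r) * \<tau>" by (simp add: p_sum flip: sum_distrib_right)
  also have "\<dots> \<le> 2 * (1 + r) * \<tau>" using tau_nonneg by (simp add: mult_right_mono)
  finally show ?thesis using False by (simp add: gbar_def gam_def a_out b_out)
qed

lemma norm_yv_le:
  assumes "v < n"
  shows "norm (yv a b v c) \<le> (3 * r + 2) * \<tau>"
proof -
  have "norm (\<Sum>u\<in>nb v. kap a (c v) (c u)) \<le> (\<Sum>u\<in>nb v. 2 * \<tau>)"
    by (intro sum_norm_le norm_kap_le[OF a_le])
  also have "\<dots> = r * (2 * \<tau>)" using assms by (simp add: card_nb)
  finally have "norm ((\<Sum>u\<in>nb v. kap a (c v) (c u)) / 2) \<le> r * \<tau>" by (simp add: norm_divide)
  then show ?thesis unfolding yv_def using norm_gbar_le'[of "c v"]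
    by (intro order_trans[OF norm_triangle_ineq]) (simp add: algebra_simps)
qed

text \<open>At most (r + 1)^4 summands are split off, each of norm at most (3 r + 2) \<tau>.\<close>

abbreviation "stein_const \<equiv> real ((r + 1) ^ 4 * (3 * r + 2))"

text \<open>Split off from \<open>Zt\<close> the summands near \<open>v\<close>: the rest is independent of \<open>yv a b v\<close>, and the
  second-order term of the expansion in the near summands produces \<open>qf\<close>.\<close>

lemma stein_local:
  assumes v: "v < n"
  shows "norm (EE {..<n} (\<lambda>c. yv a b v c * exp (\<i> * of_real s * Zt a b c)) c0
      - \<i> * of_real s * qf a b * EE {..<n} (\<lambda>c. exp (\<i> * of_real s * Zt a b c)) c0)
    \<le> 4 * (stein_const * \<tau>) ^ 3 * exp (2 * (stein_const * \<tau>)) * \<Delta>"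
proof -
  \<comment> \<open>Four layers: \<open>S\<close> are the summands that see \<open>cl v\<close>,
    \<open>D\<close> the colours they see, \<open>R\<close> the summands that see \<open>D\<close>,
    \<open>B\<close> the colours these see. Hence the sum outside \<open>S\<close> is independent of
    \<open>yv a b v\<close>, the sum outside \<open>R\<close> is independent of
    \<open>yv a b v\<close> times the sum over \<open>S\<close>, and the error terms depend on
    \<open>B\<close> only.\<close>
  define S where "S = touch (cl v)"
  define D where "D = nbhd S"
  define R where "R = touch D"
  define B where "B = nbhd R"
  have sub: "cl v \<subseteq> {..<n}" "S \<subseteq> {..<n}" "D \<subseteq> {..<n}" "R \<subseteq> {..<n}" "B \<subseteq> {..<n}"
    using cl_subset[OF v] touch_subset nbhd_subset by (auto simp: S_def D_def R_def B_def)
  have fin: "finite S" "finite R" by (auto simp: S_def R_def)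
  have "card S \<le> (r + 1) * (r + 1)" using card_touch_le[OF sub(1)] card_cl[OF v] by (simp add: S_def)
  moreover have "card D \<le> (r + 1) * card S" using card_nbhd_le[OF sub(2)] by (simp add: D_def)
  moreover have "card R \<le> (r + 1) * card D" using card_touch_le[OF sub(3)] by (simp add: R_def)
  moreover have "card B \<le> (r + 1) * card R" using card_nbhd_le[OF sub(4)] by (simp add: B_def)
  ultimately have cards: "card S \<le> (r + 1) ^ 2" "card R \<le> (r + 1) ^ 4" "card B \<le> (r + 1) ^ 5"
  proof -
    assume a: "card S \<le> (r + 1) * (r + 1)" "card D \<le> (r + 1) * card S" "card R \<le> (r + 1) * card D"
       "card B \<le> (r + 1) * card R"
    have pw: "(r + 1) * (r + 1) ^ 2 = (r + 1) ^ 3" "(r + 1) * (r + 1) ^ 3 = (r + 1) ^ 4"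
      "(r + 1) * (r + 1) ^ 4 = (r + 1) ^ 5"
      by (simp_all only: numeral_eq_Suc power_Suc pred_numeral_simps arith_simps)
    show 1: "card S \<le> (r + 1) ^ 2" using a(1) by (simp add: power2_eq_square)
    have "card D \<le> (r + 1) * (r + 1) ^ 2" using a(2) 1 by (meson mult_le_mono2 order_trans)
    then have 2: "card D \<le> (r + 1) ^ 3" by (simp only: pw)
    then have "card R \<le> (r + 1) * (r + 1) ^ 3" using a(3) by (meson mult_le_mono2 order_trans)
    then show 3: "card R \<le> (r + 1) ^ 4" by (simp only: pw)
    then have "card B \<le> (r + 1) * (r + 1) ^ 4" using a(4) by (meson mult_le_mono2 order_trans)
    then show "card B \<le> (r + 1) ^ 5" by (simp only: pw)
  qed
  have vS: "v \<in> S" using v self_cl by (auto simp: S_def touch_def)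
  have SD: "cl w \<subseteq> D" if "w \<in> S" for w using that by (auto simp: D_def nbhd_def)
  have SR: "S \<subseteq> R"
  proof
    fix w assume w: "w \<in> S"
    then have "w \<in> cl w \<inter> D" using SD self_cl by auto
    then show "w \<in> R" using w sub by (auto simp: R_def touch_def)
  qed
  have RB: "cl w \<subseteq> B" if "w \<in> R" for w using that by (auto simp: B_def nbhd_def)
  have clvS: "cl v \<subseteq> S"
  proof
    fix u assume u: "u \<in> cl v"
    then have "u < n" using sub by auto
    then show "u \<in> S" using u self_cl[of u] by (auto simp: S_def touch_def)
  qed
  let ?E = "\<lambda>f. EE {..<n} f c0"
  let ?\<kappa> = "stein_const * \<tau>"
  define X where "X c = \<i> * of_real s * Zt a b c" for c
  define XS where "XS c = \<i> * of_real s * (\<Sum>w\<in>S. yv a b w c)" for c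
  define XR where "XR c = \<i> * of_real s * (\<Sum>w\<in>R. yv a b w c)" for c
  have XXS: "X c - XS c = \<i> * of_real s * (\<Sum>w\<in>{..<n} - S. yv a b w c)" for c
    using sum_diff[of "{..<n}" S "\<lambda>w. yv a b w c"] sub
    by (simp add: X_def XS_def Zt_def right_diff_distrib)
  have XXR: "X c - XR c = \<i> * of_real s * (\<Sum>w\<in>{..<n} - R. yv a b w c)" for c
    using sum_diff[of "{..<n}" R "\<lambda>w. yv a b w c"] sub
    by (simp add: X_def XR_def Zt_def right_diff_distrib)
  have y\<kappa>: "norm (yv a b v c) \<le> ?\<kappa>" for c
  proof -
    have "real (3 * r + 2) * \<tau> \<le> stein_const * \<tau>"
      using tau_nonneg mult_le_mono1[of 1 "(r + 1) ^ 4" "3 * r + 2"]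
      by (intro mult_right_mono of_nat_mono) auto
    then show ?thesis using norm_yv_le[OF v, of c] by linarith
  qed
  have sum\<kappa>: "norm (\<i> * of_real s * (\<Sum>w\<in>A. yv a b w c)) \<le> ?\<kappa>" if "A \<subseteq> R" for A c
  proof -
    have "norm (\<Sum>w\<in>A. yv a b w c) \<le> (\<Sum>w\<in>A. (3 * r + 2) * \<tau>)"
      using that sub by (intro sum_norm_le norm_yv_le) auto
    also have "\<dots> = card A * ((3 * r + 2) * \<tau>)" by simp
    also have "\<dots> \<le> real ((r + 1) ^ 4) * ((3 * r + 2) * \<tau>)"
      using card_mono[OF fin(2) that] cards(2) tau_nonneg by (intro mult_right_mono of_nat_mono) auto
    finally have 1: "norm (\<Sum>w\<in>A. yv a b w c) \<le> ?\<kappa>"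
      by (simp only: of_nat_mult mult.assoc)
    have "norm (\<i> * of_real s * (\<Sum>w\<in>A. yv a b w c)) = s * norm (\<Sum>w\<in>A. yv a b w c)"
      using s by (simp add: norm_mult)
    also have "\<dots> \<le> 1 * norm (\<Sum>w\<in>A. yv a b w c)" using s by (intro mult_right_mono) auto
    finally show ?thesis using 1 by simp
  qed
  have XS\<kappa>: "norm (XS c) \<le> ?\<kappa>" and XR\<kappa>: "norm (XR c) \<le> ?\<kappa>" for c
    using sum\<kappa>[OF SR] sum\<kappa>[OF subset_refl] by (auto simp: XS_def XR_def)
  have \<kappa>0: "0 \<le> ?\<kappa>" using tau_nonneg by simp
  have e1: "norm (exp (- w) - 1) \<le> ?\<kappa> * exp ?\<kappa>" if "norm w \<le> ?\<kappa>" for w :: complex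
    using norm_exp_minus_1_le[of "- w"] that \<kappa>0
    by (smt (verit, best) exp_gt_zero exp_le_cancel_iff mult_mono norm_ge_zero norm_minus_cancel)
  \<comment> \<open>\<open>L1\<close> is the second-order Taylor remainder in \<open>XS\<close>,
    \<open>L2\<close> exchanges exp (- XS) for exp (- XR) to gain independence, and
    \<open>L3\<close> undoes this exchange in the independent factor. All are kept as local factors
    of the full exponential so that \<open>decay\<close> applies; each contributes order \<kappa>^3,
    \<open>L3\<close> after multiplication by the variance.\<close>
  define L1 where "L1 c = yv a b v c * (exp (XS c) - 1 - XS c) * exp (- XS c)" for c
  define L2 where "L2 c = yv a b v c * XS c * (exp (- XS c) - exp (- XR c))" for c
  define L3 where "L3 c = exp (- XR c) - 1" for c
  have dyv: "depends_on B (yv a b w)" if "w \<in> R" for w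
    using dep_yv RB[OF that] by (rule depends_on_mono)
  have dy: "depends_on B (yv a b v)" using dyv vS SR by auto
  have dXS: "depends_on B XS" unfolding XS_def
    by (rule depends_on_comp[where g="\<lambda>x. \<i> * of_real s * x"], rule depends_on_sum) (use dyv SR in auto)
  have dXR: "depends_on B XR" unfolding XR_def
    by (rule depends_on_comp[where g="\<lambda>x. \<i> * of_real s * x"], rule depends_on_sum) (use dyv in auto)
  have dL1: "depends_on B L1" unfolding L1_def mult.assoc
    by (rule depends_on_comp2[OF dy dXS, of "\<lambda>y x. y * ((exp x - 1 - x) * exp (- x))"])
  have dL2: "depends_on B L2" unfolding L2_def
    using depends_on_comp2[OF depends_on_comp2[OF dy dXS, of "Pair"] dXR,
       of "\<lambda>(y, x) x'. y * x * (exp (- x) - exp (- x'))"] by simp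
  have dL3: "depends_on B L3" unfolding L3_def
    by (rule depends_on_comp[OF dXR, of "\<lambda>x. exp (- x) - 1"])
  have nL1: "norm (L1 c) \<le> ?\<kappa> * (?\<kappa>\<^sup>2 * exp ?\<kappa>) * exp ?\<kappa>" for c
  proof -
    have "norm (exp (XS c) - 1 - XS c) \<le> (norm (XS c))\<^sup>2 * exp (norm (XS c))"
      by (rule norm_exp_minus_1_minus_le)
    also have "\<dots> \<le> ?\<kappa>\<^sup>2 * exp ?\<kappa>" using XS\<kappa>[of c] by (intro mult_mono power_mono) auto
    finally have 1: "norm (exp (XS c) - 1 - XS c) \<le> ?\<kappa>\<^sup>2 * exp ?\<kappa>" .
    have 2: "norm (exp (- XS c)) \<le> exp ?\<kappa>"
      using norm_exp[of "- XS c"] XS\<kappa>[of c] by (simp add: order_trans)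
    show ?thesis unfolding L1_def norm_mult using y\<kappa> 1 2 \<kappa>0
      by (intro mult_mono) (auto intro!: mult_nonneg_nonneg)
  qed
  have nL2: "norm (L2 c) \<le> ?\<kappa> * ?\<kappa> * (2 * ?\<kappa> * exp ?\<kappa>)" for c
  proof -
    have "norm (exp (- XS c) - exp (- XR c)) \<le> norm (exp (- XS c) - 1) + norm (exp (- XR c) - 1)"
      using norm_triangle_ineq4[of "exp (- XS c) - 1" "exp (- XR c) - 1"] by simp
    also have "\<dots> \<le> 2 * ?\<kappa> * exp ?\<kappa>" using e1[OF XS\<kappa>, of c] e1[OF XR\<kappa>, of c] by simp
    finally show ?thesis unfolding L2_def norm_mult using y\<kappa>[of c] XS\<kappa>[of c] \<kappa>0
      by (intro mult_mono) (auto intro!: mult_nonneg_nonneg)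
  qed
  have nL3: "norm (L3 c) \<le> ?\<kappa> * exp ?\<kappa>" for c
    unfolding L3_def by (rule e1[OF XR\<kappa>])
  have d1: "norm (?E (\<lambda>c. L1 c * exp (X c))) \<le> ?\<kappa> * (?\<kappa>\<^sup>2 * exp ?\<kappa>) * exp ?\<kappa> * \<Delta>"
    unfolding X_def by (rule decay[OF sub(5) cards(3) dL1 nL1])
  have d2: "norm (?E (\<lambda>c. L2 c * exp (X c))) \<le> ?\<kappa> * ?\<kappa> * (2 * ?\<kappa> * exp ?\<kappa>) * \<Delta>"
    unfolding X_def by (rule decay[OF sub(5) cards(3) dL2 nL2])
  have d3: "norm (?E (\<lambda>c. L3 c * exp (X c))) \<le> ?\<kappa> * exp ?\<kappa> * \<Delta>"
    unfolding X_def by (rule decay[OF sub(5) cards(3) dL3 nL3])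
  have \<Delta>0: "0 \<le> \<Delta>"
  proof -
    have "norm (EE {..<n} (\<lambda>c. 1 * exp (\<i> * of_real s * Zt a b c)) c0) \<le> 1 * \<Delta>"
      by (rule decay[of "{}"]) (simp_all add: depends_on_const)
    from order_trans[OF norm_ge_zero this] show ?thesis by simp
  qed
  have split: "yv a b v c * exp (X c) = yv a b v c * exp (X c - XS c) + L1 c * exp (X c) + L2 c * exp (X c)
      + yv a b v c * XS c * exp (X c - XR c)" for c
  proof -
    have e: "exp (X c - XS c) = exp (X c) * exp (- XS c)" "exp (X c - XR c) = exp (X c) * exp (- XR c)"
      by (simp_all flip: exp_add)
    have "(exp (XS c) - 1 - XS c) * exp (- XS c) = 1 - exp (- XS c) - XS c * exp (- XS c)"
      by (simp add: left_diff_distrib flip: exp_add)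
    then have L1: "L1 c = yv a b v c * (1 - exp (- XS c) - XS c * exp (- XS c))"
      unfolding L1_def mult.assoc by simp
    show ?thesis unfolding L1 L2_def e by (simp only: algebra_simps mult_1_left)
  qed
  have indep1: "?E (\<lambda>c. yv a b v c * exp (X c - XS c)) = 0"
  proof -
    have "depends_on ({..<n} - cl v) (\<lambda>c. exp (X c - XS c))"
      unfolding XXS
    proof (rule depends_on_comp[where g="\<lambda>x. exp (\<i> * of_real s * x)"], rule depends_on_sum, rule depends_on_mono[OF dep_yv])
      fix w assume "w \<in> {..<n} - S"
      then show "cl w \<subseteq> {..<n} - cl v" using cl_subset[of w] by (auto simp: S_def touch_def)
    qed
    then have "?E (\<lambda>c. yv a b v c * exp (X c - XS c)) = ?E (yv a b v) * ?E (\<lambda>c. exp (X c - XS c))"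
      by (intro EE_indep[OF _ dep_yv]) auto
    then show ?thesis by (simp add: EE_yv_zero[OF v])
  qed
  have EyX: "?E (\<lambda>c. yv a b v c * XS c) = \<i> * of_real s * qf a b"
  proof -
    have "?E (\<lambda>c. yv a b v c * XS c) = ?E (\<lambda>c. (\<i> * of_real s) * (yv a b v c * (\<Sum>w\<in>S. yv a b w c)))"
      by (rule arg_cong[where f="?E"]) (simp add: XS_def mult_ac fun_eq_iff)
    then show ?thesis by (simp only: EE_mult_left EE_yv_local[OF v clvS sub(2)])
  qed
  have indep2: "?E (\<lambda>c. yv a b v c * XS c * exp (X c - XR c)) =
     \<i> * of_real s * qf a b * (?E (\<lambda>c. exp (X c)) + ?E (\<lambda>c. L3 c * exp (X c)))"
  proof -
    have "depends_on ({..<n} - D) (\<lambda>c. exp (X c - XR c))"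
      unfolding XXR
    proof (rule depends_on_comp[where g="\<lambda>x. exp (\<i> * of_real s * x)"], rule depends_on_sum, rule depends_on_mono[OF dep_yv])
      fix w assume "w \<in> {..<n} - R"
      then show "cl w \<subseteq> {..<n} - D" using cl_subset[of w] by (auto simp: R_def touch_def)
    qed
    moreover have "depends_on D (\<lambda>c. yv a b v c * XS c)"
      unfolding XS_def
      by (rule depends_on_comp2[where h="\<lambda>y x. y * (\<i> * of_real s * x)", OF depends_on_mono[OF dep_yv SD[OF vS]]],
          rule depends_on_sum, rule depends_on_mono[OF dep_yv SD])
    ultimately have "?E (\<lambda>c. yv a b v c * XS c * exp (X c - XR c)) =
        ?E (\<lambda>c. yv a b v c * XS c) * ?E (\<lambda>c. exp (X c - XR c))"
      by (intro EE_indep) auto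
    also have "?E (\<lambda>c. exp (X c - XR c)) = ?E (\<lambda>c. exp (X c) + L3 c * exp (X c))"
      by (rule arg_cong[where f="?E"]) (simp add: L3_def left_diff_distrib fun_eq_iff flip: exp_add)
    finally show ?thesis by (simp only: EyX EE_add)
  qed
  \<comment> \<open>The bound is read off from the representation of \<open>qf\<close> as a
    covariance in \<open>EyX\<close>, not from its definition.\<close>
  have nq: "norm (\<i> * of_real s * qf a b) \<le> ?\<kappa> * ?\<kappa>"
    unfolding EyX[symmetric]
  proof (rule norm_EE_le)
    show "norm (yv a b v c * XS c) \<le> ?\<kappa> * ?\<kappa>" for c
      unfolding norm_mult by (rule mult_mono[OF y\<kappa> XS\<kappa> \<kappa>0 norm_ge_zero])
  qed simp
  have alg1: "y = 0 + l1 + l2 + q * (x + l3) \<Longrightarrow> y - q * x = l1 + l2 + q * l3"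
    for y l1 l2 q x l3 :: complex
    by (simp add: algebra_simps)
  have alg2: "k * (k\<^sup>2 * e) * e * d + k * k * (2 * k * e) * d + (k * k) * (k * e * d) = k ^ 3 * d * (e * e + 3 * e)"
    for k e d :: real
    by (simp add: power3_eq_cube power2_eq_square algebra_simps)
  have alg3: "k ^ 3 * d * (4 * (exp k * exp k)) = 4 * k ^ 3 * exp (2 * k) * d" for k d :: real
    by (simp add: mult_exp_exp)
  have norm3: "norm (x + y + q * z) \<le> norm x + norm y + norm q * norm z" for x y z q :: complex
    using norm_triangle_ineq[of "x + y" "q * z"] norm_triangle_ineq[of x y] by (simp add: norm_mult)
  have "?E (\<lambda>c. yv a b v c * exp (X c)) = 0 + ?E (\<lambda>c. L1 c * exp (X c)) + ?E (\<lambda>c. L2 c * exp (X c))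
      + \<i> * of_real s * qf a b * (?E (\<lambda>c. exp (X c)) + ?E (\<lambda>c. L3 c * exp (X c)))"
    by (simp only: split EE_add indep1 indep2)
  then have dec: "?E (\<lambda>c. yv a b v c * exp (X c)) - \<i> * of_real s * qf a b * ?E (\<lambda>c. exp (X c)) =
      ?E (\<lambda>c. L1 c * exp (X c)) + ?E (\<lambda>c. L2 c * exp (X c))
      + \<i> * of_real s * qf a b * ?E (\<lambda>c. L3 c * exp (X c))" (is "?lhs = _")
    by (rule alg1)
  have "norm ?lhs \<le> norm (?E (\<lambda>c. L1 c * exp (X c))) + norm (?E (\<lambda>c. L2 c * exp (X c)))
      + norm (\<i> * of_real s * qf a b) * norm (?E (\<lambda>c. L3 c * exp (X c)))"
    unfolding dec by (rule norm3)
  also have "\<dots> \<le> ?\<kappa> * (?\<kappa>\<^sup>2 * exp ?\<kappa>) * exp ?\<kappa> * \<Delta> + ?\<kappa> * ?\<kappa> * (2 * ?\<kappa> * exp ?\<kappa>) * \<Delta>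
      + (?\<kappa> * ?\<kappa>) * (?\<kappa> * exp ?\<kappa> * \<Delta>)"
    by (intro add_mono d1 d2 mult_mono[OF nq d3] mult_nonneg_nonneg \<kappa>0 norm_ge_zero)
  also have "\<dots> = ?\<kappa> ^ 3 * \<Delta> * (exp ?\<kappa> * exp ?\<kappa> + 3 * exp ?\<kappa>)"
    by (rule alg2)
  also have "\<dots> \<le> ?\<kappa> ^ 3 * \<Delta> * (4 * (exp ?\<kappa> * exp ?\<kappa>))"
  proof (intro mult_left_mono)
    have "exp ?\<kappa> * 1 \<le> exp ?\<kappa> * exp ?\<kappa>" using \<kappa>0 by (intro mult_left_mono) auto
    then show "exp ?\<kappa> * exp ?\<kappa> + 3 * exp ?\<kappa> \<le> 4 * (exp ?\<kappa> * exp ?\<kappa>)" by linarith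
    show "0 \<le> ?\<kappa> ^ 3 * \<Delta>" by (rule mult_nonneg_nonneg[OF zero_le_power[OF \<kappa>0] \<Delta>0])
  qed
  also have "\<dots> = 4 * ?\<kappa> ^ 3 * exp (2 * ?\<kappa>) * \<Delta>" by (rule alg3)
  finally show ?thesis unfolding X_def .
qed

end

text \<open>By \<open>stein_local\<close>, \<open>G(s) = E exp(i s Z)\<close> nearly solves \<open>G' = - n s q G\<close>; integrate
  \<open>(G exp(n s\<^sup>2 q/2))'\<close> over \<open>[0, 1]\<close>.\<close>

lemma gauss_compare:
  fixes a b :: "nat \<Rightarrow> complex" and \<tau> A c1 \<omega> la T :: real
  assumes a_le: "\<And>i. norm (a i) \<le> \<tau>" and b_le: "\<And>i. norm (b i) \<le> \<tau>"
    and a_out: "\<And>i. i \<ge> m \<Longrightarrow> a i = 0" and b_out: "\<And>i. i \<ge> m \<Longrightarrow> b i = 0"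
    and decay: "\<And>s B L M. 0 \<le> s \<Longrightarrow> s \<le> 1 \<Longrightarrow> B \<subseteq> {..<n} \<Longrightarrow> card B \<le> (r + 1) ^ 5 \<Longrightarrow> depends_on B L \<Longrightarrow>
      (\<And>c. norm (L c) \<le> M) \<Longrightarrow>
      norm (EE {..<n} (\<lambda>c. L c * exp (\<i> * of_real s * Zt a b c)) c0) \<le> M * (A * exp (- c1 * n * s\<^sup>2 * T))"
    and q: "la * T - \<omega> \<le> Re (qf a b)" and c1: "c1 \<le> la / 2" and T: "0 \<le> T" and \<omega>: "0 \<le> \<omega>" and A: "0 \<le> A"
  shows "norm (EE {..<n} (\<lambda>c. exp (\<i> * Zt a b c)) c0 - exp (- (of_nat n * qf a b / 2)))
    \<le> n * (4 * (stein_const * \<tau>) ^ 3 * exp (2 * (stein_const * \<tau>)) * A) * exp (n * \<omega> / 2) * exp (- c1 * n * T)"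
proof -
  define q where "q = qf a b"
  define G where "G s = EE {..<n} (\<lambda>c. exp (\<i> * of_real s * Zt a b c)) c0" for s :: real
  define G' where "G' s = EE {..<n} (\<lambda>c. exp (\<i> * of_real s * Zt a b c) * (\<i> * Zt a b c)) c0" for s :: real
  define P where "P s = exp ((of_real s)\<^sup>2 * (of_nat n * q / 2))" for s :: real
  define P' where "P' s = P s * (of_real s * (of_nat n * q))" for s :: real
  define K where "K = 4 * (stein_const * \<tau>) ^ 3 * exp (2 * (stein_const * \<tau>))"
  have \<tau>0: "0 \<le> \<tau>" using a_le[of 0] norm_ge_zero order_trans by blast
  have K0: "0 \<le> K" unfolding K_def using \<tau>0 by simp
  have dG: "(G has_vector_derivative G' s) (at s)" for s
  proof -
    have eq: "exp (\<i> * of_real s * z) = exp (s *\<^sub>R (\<i> * z))" for s and z :: complex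
      by (simp add: scaleR_conv_of_real mult_ac)
    show ?thesis
      unfolding G_def[abs_def] G'_def EE_def eq
      by (intro has_vector_derivative_sum has_vector_derivative_scaleR[OF DERIV_const, simplified]
           exp_scaleR_has_vector_derivative_right)
  qed
  have dP: "(P has_vector_derivative P' s) (at s)" for s
    unfolding P_def[abs_def] P'_def
    by (rule has_vector_derivative_real_field) (auto intro!: derivative_eq_intros simp: field_simps)
  have dH: "((\<lambda>s. P s * G s) has_vector_derivative (P s * G' s + P' s * G s)) (at s)" for s
    by (rule has_vector_derivative_mult[OF dP dG])
  have "continuous_on {0..1} (\<lambda>s. P s * G s)"
    by (intro continuous_at_imp_continuous_on ballI has_vector_derivative_continuous[OF dH])
  \<comment> \<open>Mean value inequality: the change over [0, 1] is controlled by the derivative at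
    a single \<open>s\<close>, so no integral has to be formed.\<close>
  then obtain s where s: "s \<in> {0<..<1}"
    and mv: "norm (P 1 * G 1 - P 0 * G 0) \<le> norm ((1 - 0) *\<^sub>R (P s * G' s + P' s * G s))"
    using mvt_general[of 0 1 "\<lambda>s. P s * G s" "\<lambda>s x. x *\<^sub>R (P s * G' s + P' s * G s)"] dH
    by (auto simp: has_vector_derivative_def)
  have s01: "0 \<le> s" "s \<le> 1" using s by auto
  let ?\<Delta> = "A * exp (- c1 * n * s\<^sup>2 * T)"
  have err: "norm (G' s + of_real s * (of_nat n * q) * G s) \<le> n * (K * ?\<Delta>)"
  proof -
    define e where "e v = EE {..<n} (\<lambda>c. yv a b v c * exp (\<i> * of_real s * Zt a b c)) c0" for v
    have "G' s = EE {..<n} (\<lambda>c. \<i> * (\<Sum>v<n. yv a b v c * exp (\<i> * of_real s * Zt a b c))) c0"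
      unfolding G'_def by (rule arg_cong[where f="\<lambda>f. EE {..<n} f c0"])
        (auto simp: Zt_def fun_eq_iff sum_distrib_right mult_ac)
    also have "\<dots> = \<i> * (\<Sum>v<n. EE {..<n} (\<lambda>c. yv a b v c * exp (\<i> * of_real s * Zt a b c)) c0)"
      by (simp only: EE_mult_left EE_sum)
    finally have G': "G' s = \<i> * (\<Sum>v<n. e v)" unfolding e_def .
    have alg: "\<i> * S + x * (N * q') * g = \<i> * (S - N * (\<i> * x * q' * g))" for S x N q' g :: complex
      by (simp add: algebra_simps)
    have "G' s + of_real s * (of_nat n * q) * G s = \<i> * (\<Sum>v<n. e v - \<i> * of_real s * q * G s)"
      unfolding G' alg sum_subtractf by simp
    then have "norm (G' s + of_real s * (of_nat n * q) * G s) = norm (\<Sum>v<n. e v - \<i> * of_real s * q * G s)"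
      by (simp only: norm_mult norm_ii mult_1_left)
    also have "\<dots> \<le> (\<Sum>v<n. K * ?\<Delta>)"
    proof (rule sum_norm_le)
      fix v assume "v \<in> {..<n}"
      then have v: "v < n" by simp
      show "norm (e v - \<i> * of_real s * q * G s) \<le> K * ?\<Delta>"
        unfolding e_def q_def G_def K_def
        by (rule stein_local[OF a_le b_le a_out b_out s01 decay[OF s01] v])
    qed
    finally show ?thesis by simp
  qed
  have nP: "norm (P t) = exp (t\<^sup>2 * (n * Re q / 2))" for t
  proof -
    have "(of_real t)\<^sup>2 * (of_nat n * q / 2) = of_real (t\<^sup>2 * n / 2) * q" by simp
    then show ?thesis by (simp add: P_def norm_exp_eq_Re)
  qed
  have "norm (P 1 * G 1 - 1) \<le> norm (P s * (G' s + of_real s * (of_nat n * q) * G s))"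
    using mv by (simp add: P_def P'_def G_def EE_const algebra_simps)
  also have "\<dots> \<le> exp (s\<^sup>2 * (n * Re q / 2)) * (n * (K * ?\<Delta>))"
    unfolding norm_mult nP by (intro mult_left_mono err) auto
  finally have 1: "norm (P 1 * G 1 - 1) \<le> exp (s\<^sup>2 * (n * Re q / 2)) * (n * (K * ?\<Delta>))" .
  have P1: "P 1 * exp (- (of_nat n * q / 2)) = 1" by (simp add: P_def flip: exp_add)
  have "norm (G 1 - exp (- (of_nat n * q / 2))) = norm ((P 1 * G 1 - 1) * exp (- (of_nat n * q / 2)))"
    using P1 by (simp add: algebra_simps)
  also have "\<dots> = norm (P 1 * G 1 - 1) * exp (- (n * Re q / 2))"
    by (simp add: norm_mult norm_exp_eq_Re)
  also have "\<dots> \<le> exp (s\<^sup>2 * (n * Re q / 2)) * (n * (K * ?\<Delta>)) * exp (- (n * Re q / 2))"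
    by (intro mult_right_mono 1) auto
  also have "\<dots> = n * (K * A) * exp (- ((1 - s\<^sup>2) * (n * Re q / 2)) - c1 * n * s\<^sup>2 * T)"
  proof -
    have e: "exp x * (N * (K * (A * exp y))) * exp z = N * (K * A) * exp (x + y + z)" for x y z N :: real
      by (simp add: exp_add)
    have x: "s\<^sup>2 * (n * Re q / 2) + - c1 * n * s\<^sup>2 * T + - (n * Re q / 2)
        = - ((1 - s\<^sup>2) * (n * Re q / 2)) - c1 * n * s\<^sup>2 * T"
      by (simp add: field_simps)
    show ?thesis unfolding e x ..
  qed
  \<comment> \<open>The Gaussian factor supplies rate la / 2 with weight 1 - s^2, the decay
    assumption rate c1 with weight s^2. As c1 <= la / 2, together they give rate c1, up to the loss
    \<omega> caused by imaginary parts.\<close>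
  also have "\<dots> \<le> n * (K * A) * exp (n * \<omega> / 2 - c1 * n * T)"
  proof (intro mult_left_mono)
    have s2: "s\<^sup>2 \<le> 1" "0 \<le> s\<^sup>2" using s01 by (auto simp: power_le_one)
    have "2 * c1 * T \<le> la * T" using c1 T by (intro mult_right_mono) auto
    then have "2 * c1 * T - \<omega> \<le> Re q" using q by (simp add: q_def)
    then have "(1 - s\<^sup>2) * (n * (2 * c1 * T - \<omega>) / 2) \<le> (1 - s\<^sup>2) * (n * Re q / 2)"
      using s2 by (intro mult_left_mono divide_right_mono) auto
    moreover have "(1 - s\<^sup>2) * (n * (2 * c1 * T - \<omega>) / 2) = (1 - s\<^sup>2) * (c1 * n * T) - (1 - s\<^sup>2) * (n * \<omega> / 2)"
      by (simp add: field_simps)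
    moreover have "(1 - s\<^sup>2) * (n * \<omega> / 2) \<le> 1 * (n * \<omega> / 2)" using s2 \<omega> by (intro mult_right_mono) auto
    ultimately have "- ((1 - s\<^sup>2) * (n * Re q / 2)) - c1 * n * s\<^sup>2 * T \<le> n * \<omega> / 2 - c1 * n * T"
    proof -
      have arith: "X1 \<le> Y \<Longrightarrow> X1 = Z - X2 \<Longrightarrow> X2 \<le> 1 * V \<Longrightarrow> Z = U1 - U2 \<Longrightarrow> - Y - U2 \<le> V - U1"
        for X1 X2 Y Z V U1 U2 :: real by linarith
      assume "(1 - s\<^sup>2) * (n * (2 * c1 * T - \<omega>) / 2) \<le> (1 - s\<^sup>2) * (n * Re q / 2)"
        "(1 - s\<^sup>2) * (n * (2 * c1 * T - \<omega>) / 2) = (1 - s\<^sup>2) * (c1 * n * T) - (1 - s\<^sup>2) * (n * \<omega> / 2)"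
        "(1 - s\<^sup>2) * (n * \<omega> / 2) \<le> 1 * (n * \<omega> / 2)"
      then show ?thesis by (rule arith) (simp add: algebra_simps)
    qed
    then show "exp (- ((1 - s\<^sup>2) * (n * Re q / 2)) - c1 * n * s\<^sup>2 * T) \<le> exp (n * \<omega> / 2 - c1 * n * T)" by simp
    show "0 \<le> n * (K * A)" using K0 A by simp
  qed
  also have "\<dots> = n * (K * A) * (exp (n * \<omega> / 2) * exp (- c1 * n * T))"
    by (simp flip: exp_add)
  also have "\<dots> = n * (K * A) * exp (n * \<omega> / 2) * exp (- c1 * n * T)" by (simp only: mult.assoc)
  finally show ?thesis by (simp only: G_def q_def K_def of_real_1 mult_1_right)
qed

end

section \<open>Decay of the characteristic function\<close>

text \<open>With y = |x| / 2 this is 1 - cos x = 2 (sin y)^2 together with sin y >= y / 2 on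
  [0, pi / 2].\<close>

lemma one_minus_cos_ge:
  fixes x :: real
  assumes "\<bar>x\<bar> \<le> pi"
  shows "x\<^sup>2 / 8 \<le> 1 - cos x"
proof -
  define y where "y = \<bar>x\<bar> / 2"
  have y: "0 \<le> y" "y \<le> pi / 2" using assms by (auto simp: y_def)
  have "\<bar>sin y - (\<Sum>k<3. sin_coeff k * y ^ k)\<bar> \<le> inverse (fact 3) * \<bar>y\<bar> ^ 3"
    by (rule Maclaurin_sin_bound)
  then have "\<bar>sin y - y\<bar> \<le> y ^ 3 / 6"
    using y by (simp add: sin_coeff_def eval_nat_numeral)
  then have "y - y ^ 3 / 6 \<le> sin y" by linarith
  moreover have "y\<^sup>2 \<le> 3"
  proof -
    have "y \<le> 17 / 10" using y pi_approx by simp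
    then have "y\<^sup>2 \<le> (17 / 10)\<^sup>2" using y by (intro power_mono) auto
    then show ?thesis by (simp add: power2_eq_square)
  qed
  then have "y / 2 \<le> y - y ^ 3 / 6"
    using mult_left_mono[of "y\<^sup>2" 3 y] y by (simp add: power2_eq_square power3_eq_cube)
  ultimately have "y / 2 \<le> sin y" by linarith
  then have "(y / 2)\<^sup>2 \<le> (sin y)\<^sup>2" using y by (intro power_mono) auto
  moreover have "1 - cos x = 2 * (sin y)\<^sup>2"
    using cos_double_sin[of y] by (simp add: y_def)
  ultimately show ?thesis by (simp add: y_def power2_eq_square)
qed

text \<open>Parallelogram law for e^(iu) - 1 and e^(iw) - 1, whose squared lengths are 2 (1 - cos u)
  and 2 (1 - cos w). It serves to remove a controlled phase from a sum of two.\<close>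

lemma one_minus_cos_diff_le: "1 - cos (u - w) \<le> 2 * (1 - cos u) + 2 * (1 - cos w)" for u w :: real
proof -
  have alg: "(C + D - 2)\<^sup>2 + (S + T)\<^sup>2 = (C\<^sup>2 + S\<^sup>2) + (D\<^sup>2 + T\<^sup>2) + 2 * (C * D + S * T) - 4 * C - 4 * D + 4"
    for C D S T :: real
    by (simp add: power2_eq_square algebra_simps)
  have "0 \<le> (cos u + cos w - 2)\<^sup>2 + (sin u + sin w)\<^sup>2" by simp
  also have "\<dots> = ((cos u)\<^sup>2 + (sin u)\<^sup>2) + ((cos w)\<^sup>2 + (sin w)\<^sup>2) + 2 * (cos u * cos w + sin u * sin w)
      - 4 * cos u - 4 * cos w + 4"
    by (rule alg)
  finally show ?thesis by (simp add: cos_diff)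
qed

text \<open>The squared norm is (x + y)^2 - 2 x y d with d = 1 - cos (\<alpha> - \<beta>), and (x +
  y) min x y <= 2 x y. A loss linear in \<open>min x y\<close> survives when the contributions of
  further colours are added.\<close>

lemma norm_add_cis_le:
  fixes x y :: real
  assumes "0 \<le> x" "0 \<le> y"
  shows "norm (of_real x * cis \<alpha> + of_real y * cis \<beta>) \<le> x + y - min x y * (1 - cos (\<alpha> - \<beta>)) / 2"
proof (rule power2_le_imp_le)
  have alg: "(x * C + y * D)\<^sup>2 + (x * S + y * T)\<^sup>2
      = x\<^sup>2 * (C\<^sup>2 + S\<^sup>2) + y\<^sup>2 * (D\<^sup>2 + T\<^sup>2) + 2 * x * y * (C * D + S * T)" for C D S T :: real
    by (simp add: power2_eq_square algebra_simps)
  define d where "d = 1 - cos (\<alpha> - \<beta>)"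
  have d: "0 \<le> d" "d \<le> 2" using cos_ge_minus_one[of "\<alpha> - \<beta>"] by (auto simp: d_def)
  have "(norm (of_real x * cis \<alpha> + of_real y * cis \<beta>))\<^sup>2 = (x * cos \<alpha> + y * cos \<beta>)\<^sup>2 + (x * sin \<alpha> + y * sin \<beta>)\<^sup>2"
    by (simp add: cmod_power2)
  also have "\<dots> = x\<^sup>2 * ((cos \<alpha>)\<^sup>2 + (sin \<alpha>)\<^sup>2) + y\<^sup>2 * ((cos \<beta>)\<^sup>2 + (sin \<beta>)\<^sup>2) + 2 * x * y * (cos \<alpha> * cos \<beta> + sin \<alpha> * sin \<beta>)"
    by (rule alg)
  also have "\<dots> = (x + y)\<^sup>2 - 2 * x * y * d"
    unfolding d_def cos_diff by (simp add: power2_eq_square algebra_simps)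
  finally have 1: "(norm (of_real x * cis \<alpha> + of_real y * cis \<beta>))\<^sup>2 = (x + y)\<^sup>2 - 2 * x * y * d" .
  have "(x + y) * min x y \<le> 2 * x * y"
  proof (cases "x \<le> y")
    case True
    then show ?thesis using mult_left_mono[of x y x] assms by (simp add: min_def algebra_simps)
  next
    case False
    then show ?thesis using mult_left_mono[of y x y] assms by (simp add: min_def algebra_simps)
  qed
  then have "(x + y) * min x y * d \<le> 2 * x * y * d" using d by (intro mult_right_mono) auto
  moreover have "(x + y - min x y * d / 2)\<^sup>2 = (x + y)\<^sup>2 - (x + y) * min x y * d + (min x y * d / 2)\<^sup>2"
    by (simp add: power2_eq_square field_simps)
  ultimately show "(norm (of_real x * cis \<alpha> + of_real y * cis \<beta>))\<^sup>2 \<le> (x + y - min x y * (1 - cos (\<alpha> - \<beta>)) / 2)\<^sup>2"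
    unfolding 1 d_def[symmetric] using zero_le_power2[of "min x y * d / 2"] by linarith
  have "min x y * d \<le> (x + y) * 2" using assms d by (intro mult_mono) auto
  then show "0 \<le> x + y - min x y * (1 - cos (\<alpha> - \<beta>)) / 2" unfolding d_def by simp
qed

context palette
begin

definition pm :: real where "pm = Min (p ` {..<m})"

lemma pm_le: "i < m \<Longrightarrow> pm \<le> p i" unfolding pm_def by simp
lemma pm_pos: "pm > 0" unfolding pm_def using p_pos m_ge by (subst Min_gr_iff) (auto simp: lessThan_empty_iff)
text \<open>Here m >= 3 takes effect: a colour avoiding two given ones isolates coefficients both in
  the decay estimate and in the lower bound for \<open>qf\<close>.\<close>

lemma third_colour: "\<exists>k<m. k \<noteq> j \<and> k \<noteq> l"
proof -
  have "\<not> {..<m} \<subseteq> {j, l}"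
  proof
    assume "{..<m} \<subseteq> {j, l}"
    then have "card {..<m} \<le> card {j, l}" by (intro card_mono) auto
    also have "\<dots> \<le> 2" by (simp add: card_insert_if)
    finally show False using m_ge by simp
  qed
  then show ?thesis by auto
qed

lemma pm_le_1: "pm \<le> 1" using pm_le[of 0] p_le_1[of 0] m_ge by auto

end

section \<open>Cancellation produced by the colour of a single vertex\<close>

context colour_graph
begin

text \<open>The part of \<open>Zt\<close> that changes with the colour of \<open>v\<close>; edges count in full here.\<close>

definition xv :: "(nat \<Rightarrow> 'a::real_normed_field) \<Rightarrow> (nat \<Rightarrow> 'a) \<Rightarrow> nat \<Rightarrow> (nat \<Rightarrow> nat) \<Rightarrow> 'a" where
  "xv a b v c = gbar a b (c v) + (\<Sum>u\<in>nb v. kap a (c v) (c u))"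

lemma dep_xv: "depends_on (cl v) (xv a b v)"
  unfolding depends_on_def xv_def cl_def by (auto intro!: sum.cong)

text \<open>The summand of \<open>v\<close> holds one half of every incident edge and the summands
  of its neighbours the other halves, which is why \<open>xv\<close> has no factor 1 / 2.\<close>

lemma Zt_upd:
  assumes v: "v < n"
  shows "Zt a b (c(v := i)) - Zt a b c = xv a b v (c(v := i)) - xv a b v c"
proof -
  let ?c = "c(v := i)"
  have nbv: "v \<notin> nb v" using v nb_irrefl by auto
  have "Zt a b ?c - Zt a b c = (\<Sum>w<n. yv a b w ?c - yv a b w c)"
    by (simp add: Zt_def sum_subtractf)
  also have "\<dots> = (\<Sum>w\<in>cl v. yv a b w ?c - yv a b w c)"
  proof (rule sum.mono_neutral_right)
    show "\<forall>w\<in>{..<n} - cl v. yv a b w ?c - yv a b w c = 0"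
    proof
      fix w assume w: "w \<in> {..<n} - cl v"
      then have "v \<notin> cl w" using cl_sym[of w v] by auto
      then have "yv a b w ?c = yv a b w c" by (intro depends_onD[OF dep_yv]) auto
      then show "yv a b w ?c - yv a b w c = 0" by simp
    qed
  qed (use cl_subset v in auto)
  also have "\<dots> = (yv a b v ?c - yv a b v c) + (\<Sum>w\<in>nb v. yv a b w ?c - yv a b w c)"
    using nbv by (simp add: cl_def)
  also have "(\<Sum>w\<in>nb v. yv a b w ?c - yv a b w c) = (\<Sum>w\<in>nb v. (kap a i (c w) - kap a (c v) (c w)) / 2)"
  proof (rule sum.cong[OF refl])
    fix w assume w: "w \<in> nb v"
    then have wv: "w \<noteq> v" "v \<in> nb w" using nbv v nb_sym by auto
    have "(\<Sum>u\<in>nb w. kap a (c w) (?c u)) = kap a (c w) i + (\<Sum>u\<in>nb w - {v}. kap a (c w) (c u))"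
      using wv by (subst sum.remove[of _ v]) auto
    moreover have "(\<Sum>u\<in>nb w. kap a (c w) (c u)) = kap a (c w) (c v) + (\<Sum>u\<in>nb w - {v}. kap a (c w) (c u))"
      using wv by (subst sum.remove[of _ v]) auto
    ultimately show "yv a b w ?c - yv a b w c = (kap a i (c w) - kap a (c v) (c w)) / 2"
      using wv by (simp add: yv_def kap_sym[of a "c w"] flip: diff_divide_distrib)
  qed
  also have "yv a b v ?c - yv a b v c = (gbar a b i - gbar a b (c v)) + (\<Sum>w\<in>nb v. (kap a i (c w) - kap a (c v) (c w)) / 2)"
  proof -
    have "(\<Sum>u\<in>nb v. kap a i (?c u)) = (\<Sum>u\<in>nb v. kap a i (c u))"
      using nbv by (intro sum.cong) auto
    then show ?thesis by (simp add: yv_def sum_subtractf diff_divide_distrib sum_divide_distrib)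
  qed
  also have "\<dots> + (\<Sum>w\<in>nb v. (kap a i (c w) - kap a (c v) (c w)) / 2)
     = (gbar a b i - gbar a b (c v)) + (\<Sum>w\<in>nb v. kap a i (c w) - kap a (c v) (c w))"
    by (simp add: add.assoc flip: sum.distrib)
  also have "\<dots> = xv a b v ?c - xv a b v c"
  proof -
    have "(\<Sum>u\<in>nb v. kap a i (?c u)) = (\<Sum>u\<in>nb v. kap a i (c u))"
      using nbv by (intro sum.cong) auto
    then show ?thesis by (simp add: xv_def sum_subtractf)
  qed
  finally show ?thesis .
qed

lemma kap_diff:
  assumes "j < m" "l < m"
  shows "kap a j x - kap a l x = a j * of_real (cind j x) - a l * of_real (cind l x)"
proof -
  have "kap a j x - kap a l x = (\<Sum>t<m. (if t = j then a t * of_real (cind t x) else 0) - (if t = l then a t * of_real (cind t x) else 0))"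
    unfolding kap_def sum_subtractf[symmetric] by (intro sum.cong refl) (auto simp: cind_def algebra_simps)
  also have "\<dots> = a j * of_real (cind j x) - a l * of_real (cind l x)"
    using assms by (simp add: sum_subtractf)
  finally show ?thesis .
qed

abbreviation "cnt v c j \<equiv> card {u \<in> nb v. c u = j}"

lemma sum_cind:
  assumes "v < n"
  shows "(\<Sum>u\<in>nb v. cind j (c u)) = real (cnt v c j) - r * p j"
proof -
  have "(\<Sum>u\<in>nb v. (if c u = j then 1 else 0 :: real)) = real (cnt v c j)"
    by (simp add: sum.If_cases Int_def)
  then show ?thesis using assms by (simp add: cind_def sum_subtractf card_nb)
qed

text \<open>All centring cancels, leaving the effect on the counts themselves: recolouring
  \<open>v\<close> from \<open>l\<close> to \<open>j\<close> moves N_j and N_l by one, and M_j and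
  M_l by the numbers of neighbours of those colours.\<close>

lemma xv_diff:
  assumes v: "v < n" and jl: "j < m" "l < m"
  shows "xv a b v (c(v := j)) - xv a b v (c(v := l)) =
    b j - b l + a j * of_nat (cnt v c j) - a l * of_nat (cnt v c l)"
proof -
  have nbv: "v \<notin> nb v" using v nb_irrefl by auto
  have eq: "(\<Sum>u\<in>nb v. kap a i ((c(v := i)) u)) = (\<Sum>u\<in>nb v. kap a i (c u))" for i
    using nbv by (intro sum.cong) auto
  have "(\<Sum>u\<in>nb v. kap a j (c u)) - (\<Sum>u\<in>nb v. kap a l (c u)) =
     (\<Sum>u\<in>nb v. a j * of_real (cind j (c u)) - a l * of_real (cind l (c u)))"
    by (simp only: sum_subtractf[symmetric] kap_diff[OF jl])
  also have "\<dots> = a j * of_real (\<Sum>u\<in>nb v. cind j (c u)) - a l * of_real (\<Sum>u\<in>nb v. cind l (c u))"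
    by (simp add: sum_subtractf sum_distrib_left)
  finally show ?thesis
    unfolding sum_cind[OF v] using eq[of j] eq[of l] by (simp add: xv_def gbar_def gam_def algebra_simps)
qed

text \<open>For a maximal \<open>I\<close> every vertex lies in \<open>B\<close> or has a closed
  neighbourhood meeting one of \<open>I\<close>, and each element of \<open>I\<close> accounts for
  at most (r + 1)^2 such vertices.\<close>

lemma separated_set:
  assumes B: "B \<subseteq> {..<n}"
  obtains I where "I \<subseteq> {..<n}" "I \<inter> B = {}" "\<And>v w. v \<in> I \<Longrightarrow> w \<in> I \<Longrightarrow> v \<noteq> w \<Longrightarrow> cl v \<inter> cl w = {}"
    "n \<le> card B + (r + 1) ^ 2 * card I"
proof -
  define P where "P = {I. I \<subseteq> {..<n} \<and> I \<inter> B = {} \<and> (\<forall>v\<in>I. \<forall>w\<in>I. v \<noteq> w \<longrightarrow> cl v \<inter> cl w = {})}"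
  have "finite P" by (rule finite_subset[of _ "Pow {..<n}"]) (auto simp: P_def)
  moreover have "P \<noteq> {}" by (auto simp: P_def)
  ultimately obtain I where IP: "I \<in> P" and max: "\<And>J. J \<in> P \<Longrightarrow> I \<subseteq> J \<Longrightarrow> I = J"
    using finite_has_maximal[of P] by blast
  have I: "I \<subseteq> {..<n}" "I \<inter> B = {}" "\<And>v w. v \<in> I \<Longrightarrow> w \<in> I \<Longrightarrow> v \<noteq> w \<Longrightarrow> cl v \<inter> cl w = {}"
    using IP unfolding P_def by simp_all
  have "{..<n} \<subseteq> B \<union> touch (nbhd I)"
  proof (rule ccontr)
    assume "\<not> ?thesis"
    then obtain v where v: "v < n" "v \<notin> B" "v \<notin> touch (nbhd I)" by auto
    then have disj: "cl v \<inter> cl w = {}" if "w \<in> I" for w using that by (auto simp: touch_def nbhd_def)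
    have "cl u \<inter> cl w = {}" if "u \<in> insert v I" "w \<in> insert v I" "u \<noteq> w" for u w
      using that I(3)[of u w] disj[of u] disj[of w] by blast
    then have "insert v I \<in> P" using I(1,2) v unfolding P_def by simp
    then have "v \<in> I" using max[of "insert v I"] by blast
    then show False using disj[of v] self_cl by auto
  qed
  then have "n \<le> card (B \<union> touch (nbhd I))"
    using card_mono[of "B \<union> touch (nbhd I)" "{..<n}"] B finite_subset by auto
  also have "\<dots> \<le> card B + card (touch (nbhd I))" by (rule card_Un_le)
  also have "card (touch (nbhd I)) \<le> (r + 1) * ((r + 1) * card I)"
    by (rule order_trans[OF card_touch_le[OF nbhd_subset[OF I(1)]] mult_le_mono2[OF card_nbhd_le[OF I(1)]]])
  finally have "n \<le> card B + (r + 1) ^ 2 * card I" by (simp only: power2_eq_square mult.assoc)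
  from that[OF I this] show ?thesis .
qed

text \<open>The loss per vertex in \<open>EE_rho_le\<close> carries 1 / 384. It is halved by the
  square root taken in \<open>char_decay\<close>, and the separated vertices are about a fraction 1
  / (r + 1)^2 of all.\<close>

definition decay_rate :: real where "decay_rate = pm ^ (r + 1) / (768 * m * (r + 1)\<^sup>2)"
text \<open>The first factor pays for the vertices of the excluded set \<open>B\<close>, the second
  for the exponential moment in \<open>EE_norm_exp_sq_le\<close>.\<close>

definition decay_const :: real where "decay_const = exp (real ((r + 1) ^ 5)) * exp 3"

context
  fixes a b :: "nat \<Rightarrow> complex" and s tilt :: real and c0 :: "nat \<Rightarrow> nat"
  assumes s: "0 \<le> s" "s \<le> 1"
    and aI: "\<And>i. \<bar>Im (a i)\<bar> \<le> tilt" and bI: "\<And>i. \<bar>Im (b i)\<bar> \<le> tilt"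
    and tilt1: "4 * (1 + r) * tilt \<le> 1" and tilt2: "n * (4 * (1 + r) * tilt)\<^sup>2 \<le> 1"
begin

lemma tilt_nonneg: "0 \<le> tilt" using aI[of 0] by linarith

lemma abs_Im_xv_diff_le:
  assumes "v < n" "j < m" "l < m"
  shows "\<bar>Im (xv a b v (c(v := j))) - Im (xv a b v (c(v := l)))\<bar> \<le> 2 * (1 + r) * tilt"
proof -
  have cr: "real (cnt v c i) \<le> r" for i
    using card_mono[of "nb v" "{u \<in> nb v. c u = i}"] card_nb[OF assms(1)] by simp
  have *: "\<bar>Im (a i) * real (cnt v c i)\<bar> \<le> tilt * r" for i
    unfolding abs_mult using aI[of i] cr[of i] tilt_nonneg by (intro mult_mono) auto
  have "Im (xv a b v (c(v := j))) - Im (xv a b v (c(v := l))) =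
    Im (b j) - Im (b l) + Im (a j) * cnt v c j - Im (a l) * cnt v c l"
    using arg_cong[OF xv_diff[OF assms, of a b c], of Im] by simp
  moreover have "2 * (1 + r) * tilt = tilt + tilt + (tilt * r) + (tilt * r)" by (simp add: algebra_simps)
  ultimately show ?thesis using bI[of j] bI[of l] *[of j] *[of l] by linarith
qed

text \<open>The squared modulus is exp (- 2 s Im Z). As Im Z has mean zero and changes by at most 2
  (1 + r) \<open>tilt\<close> under one recolouring, the bounded differences estimate applies with D
  = 4 (1 + r) \<open>tilt\<close>, and \<open>tilt2\<close> bounds the exponent by 3.\<close>

lemma EE_norm_exp_sq_le:
  "EE {..<n} (\<lambda>c. (norm (exp (\<i> * of_real s * Zt a b c)))\<^sup>2) c0 \<le> exp 3"
proof -
  define f where "f c = - 2 * s * Im (Zt a b c)" for c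
  have "EE {..<n} (\<lambda>c. exp (f c)) c0 \<le> exp (3 * real (card {..<n}) * (4 * (1 + r) * tilt)\<^sup>2 + EE {..<n} f c0)"
  proof (rule EE_exp_bounded_differences)
    fix v c i j assume v: "v \<in> {..<n}" and ij: "i < m" "j < m"
    have "Zt a b (c(v := i)) - Zt a b (c(v := j)) = xv a b v (c(v := i)) - xv a b v (c(v := j))"
    proof -
      have "Zt a b (c(v := i)) - Zt a b (c(v := j)) = (Zt a b (c(v := i)) - Zt a b c) - (Zt a b (c(v := j)) - Zt a b c)"
        by simp
      moreover have "v < n" using v by simp
      ultimately show ?thesis by (simp only: Zt_upd) simp
    qed
    then have "Im (Zt a b (c(v := i))) - Im (Zt a b (c(v := j))) = Im (xv a b v (c(v := i))) - Im (xv a b v (c(v := j)))"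
      by (metis minus_complex.simps(2))
    then have 1: "\<bar>Im (Zt a b (c(v := i))) - Im (Zt a b (c(v := j)))\<bar> \<le> 2 * (1 + r) * tilt"
      using abs_Im_xv_diff_le[of v i j c] v ij by simp
    have "\<bar>f (c(v := i)) - f (c(v := j))\<bar> = 2 * s * \<bar>Im (Zt a b (c(v := i))) - Im (Zt a b (c(v := j)))\<bar>"
      using s by (simp add: f_def abs_mult abs_minus_commute flip: right_diff_distrib)
    also have "\<dots> \<le> 2 * 1 * (2 * (1 + r) * tilt)" using 1 s by (intro mult_mono) auto
    finally show "\<bar>f (c(v := i)) - f (c(v := j))\<bar> \<le> 4 * (1 + r) * tilt" by (simp add: algebra_simps)
  qed (use tilt1 in auto)
  also have "EE {..<n} f c0 = 0"
  proof -
    have "EE {..<n} (Zt a b) c0 = 0"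
      unfolding Zt_def[abs_def] EE_sum by (intro sum.neutral ballI EE_yv_zero) simp
    then have "Im (EE {..<n} (Zt a b) c0) = 0" by simp
    then have "EE {..<n} (\<lambda>c. Im (Zt a b c)) c0 = 0" by (simp add: EE_def)
    then show ?thesis unfolding f_def EE_mult_left by simp
  qed
  also have "exp (3 * real (card {..<n}) * (4 * (1 + r) * tilt)\<^sup>2 + 0) \<le> exp 3" using tilt2 by (simp add: mult.assoc)
  finally have "EE {..<n} (\<lambda>c. exp (f c)) c0 \<le> exp 3" .
  moreover have "(norm (exp (\<i> * of_real s * Zt a b c)))\<^sup>2 = exp (f c)" for c
    by (simp add: f_def norm_exp_eq_Re power2_eq_square flip: exp_add)
  ultimately show ?thesis by simp
qed

definition gv :: "nat \<Rightarrow> (nat \<Rightarrow> nat) \<Rightarrow> complex" where "gv v c = exp (\<i> * of_real s * xv a b v c)"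
text \<open>The cancellation caused by the colour of \<open>v\<close>, given its neighbours,
  measured relative to the tilted weights so that it stays in [0, 1].\<close>

definition rho :: "nat \<Rightarrow> (nat \<Rightarrow> nat) \<Rightarrow> real" where
  "rho v c = norm (EE {v} (gv v) c) / EE {v} (\<lambda>c. norm (gv v c)) c"

lemma EE_norm_gv_pos: "0 < EE {v} (\<lambda>c. norm (gv v c)) c"
  unfolding EE_singleton using p_pos m_ge by (intro sum_pos) (auto simp: gv_def lessThan_empty_iff)

lemma rho_bounds: "0 \<le> rho v c" "rho v c \<le> 1"
  using EE_norm_gv_pos[of v c] norm_EE[of "{v}" "gv v" c] by (auto simp: rho_def)

lemma dep_gv: "depends_on (cl v) (gv v)"
  unfolding gv_def[abs_def] by (rule depends_on_comp[OF dep_xv])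

lemma dep_rho: "depends_on (cl v - {v}) (rho v)"
  unfolding rho_def[abs_def]
  by (rule depends_on_comp2[where h="\<lambda>x y. norm x / y", OF depends_on_EE[OF dep_gv] depends_on_EE[OF depends_on_comp[OF dep_gv]]])

text \<open>Two colours suffice for cancellation. The tilt changes ratios of weights by at most e <
  3, so each of the two keeps a share of at least pm / 3 of the mean modulus;
  \<open>norm_add_cis_le\<close> halves this to pm / 6.\<close>

lemma rho_le:
  assumes v: "v < n" and jl: "j < m" "l < m" "j \<noteq> l"
  shows "rho v c \<le> 1 - pm / 6 * (1 - cos (s * Re (b j - b l + a j * of_nat (cnt v c j) - a l * of_nat (cnt v c l))))"
proof -
  define X where "X i = xv a b v (c(v := i))" for i
  define z where "z i = p i *\<^sub>R gv v (c(v := i))" for i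
  define \<psi> where "\<psi> = EE {v} (\<lambda>c. norm (gv v c)) c"
  define d where "d = 1 - cos (s * Re (b j - b l + a j * of_nat (cnt v c j) - a l * of_nat (cnt v c l)))"
  have d: "0 \<le> d" by (simp add: d_def)
  have nz: "norm (z i) = p i * exp (- s * Im (X i))" if "i < m" for i
    using p_pos[OF that] by (simp add: z_def gv_def X_def norm_exp_eq_Re)
  have z: "z i = of_real (norm (z i)) * cis (s * Re (X i))" if "i < m" for i
  proof -
    have "z i = of_real (p i) * (of_real (exp (Re (\<i> * of_real s * X i))) * cis (Im (\<i> * of_real s * X i)))"
      unfolding z_def gv_def X_def scaleR_conv_of_real exp_eq_polar[of "\<i> * of_real s * xv a b v (c(v := i))"] ..
    then show ?thesis unfolding nz[OF that] by simp
  qed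
  have \<psi>: "\<psi> = (\<Sum>i<m. norm (z i))"
    unfolding \<psi>_def EE_singleton z_def using p_pos by (intro sum.cong) (auto simp: less_imp_le)
  have small: "pm / 3 * \<psi> \<le> norm (z i)" if i: "i < m" for i
  proof -
    have "\<psi> \<le> (\<Sum>k<m. p k * (3 * exp (- s * Im (X i))))"
      unfolding \<psi>
    proof (rule sum_mono)
      fix k assume "k \<in> {..<m}"
      then have k: "k < m" by simp
      have "s * (Im (X i) - Im (X k)) \<le> 1 * (2 * (1 + r) * tilt)"
      proof -
        have "s * (Im (X i) - Im (X k)) \<le> s * \<bar>Im (X i) - Im (X k)\<bar>" using s by (intro mult_left_mono) auto
        also have "\<dots> \<le> 1 * (2 * (1 + r) * tilt)"
          using abs_Im_xv_diff_le[OF v i k, of c] s by (intro mult_mono) (auto simp: X_def)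
        finally show ?thesis .
      qed
      also have "1 * (2 * (1 + r) * tilt) \<le> 4 * (1 + r) * tilt" using tilt_nonneg by (simp add: mult_right_mono)
      also note tilt1
      finally have "- s * Im (X k) \<le> 1 + (- s * Im (X i))" by (simp add: algebra_simps)
      then have "exp (- s * Im (X k)) \<le> exp (1 + (- s * Im (X i)))" by simp
      also have "\<dots> = exp 1 * exp (- s * Im (X i))" by (rule exp_add)
      also have "\<dots> \<le> 3 * exp (- s * Im (X i))" using exp_le by (intro mult_right_mono) auto
      finally show "norm (z k) \<le> p k * (3 * exp (- s * Im (X i)))"
        unfolding nz[OF k] using p_pos[OF k] by (intro mult_left_mono) auto
    qed
    also have "\<dots> = 3 * exp (- s * Im (X i))" by (simp add: p_sum flip: sum_distrib_right)
    finally have "pm / 3 * \<psi> \<le> pm / 3 * (3 * exp (- s * Im (X i)))" using pm_pos by (intro mult_left_mono) auto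
    also have "\<dots> = pm * exp (- s * Im (X i))" by simp
    also have "\<dots> \<le> norm (z i)" unfolding nz[OF i] using pm_le[OF i] by (intro mult_right_mono) auto
    finally show ?thesis .
  qed
  have X: "s * Re (X j) - s * Re (X l) = s * Re (b j - b l + a j * of_nat (cnt v c j) - a l * of_nat (cnt v c l))"
    using arg_cong[OF xv_diff[OF v jl(1,2), of a b c], of Re] unfolding X_def
    by (simp flip: right_diff_distrib)
  have "norm (z j + z l) \<le> norm (z j) + norm (z l) - min (norm (z j)) (norm (z l)) * d / 2"
  proof -
    have "norm (of_real (norm (z j)) * cis (s * Re (X j)) + of_real (norm (z l)) * cis (s * Re (X l)))
        \<le> norm (z j) + norm (z l) - min (norm (z j)) (norm (z l)) * (1 - cos (s * Re (X j) - s * Re (X l))) / 2"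
      by (rule norm_add_cis_le) auto
    then show ?thesis unfolding X d_def z[OF jl(1), symmetric] z[OF jl(2), symmetric] .
  qed
  moreover have "pm / 3 * \<psi> * d \<le> min (norm (z j)) (norm (z l)) * d"
    using small[OF jl(1)] small[OF jl(2)] d by (intro mult_right_mono) auto
  ultimately have two: "norm (z j + z l) \<le> norm (z j) + norm (z l) - pm / 6 * \<psi> * d" by simp
  have split: "sum f {..<m} = f j + f l + sum f ({..<m} - {j, l})" for f :: "nat \<Rightarrow> 'b::comm_monoid_add"
  proof -
    have "sum f {..<m} = sum f ({..<m} - {j, l}) + sum f {j, l}"
      using jl by (intro sum.subset_diff) auto
    then show ?thesis using jl by (simp add: add_ac)
  qed
  have "norm (EE {v} (gv v) c) = norm (z j + z l + (\<Sum>i\<in>{..<m} - {j, l}. z i))"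
    unfolding EE_singleton z_def[symmetric] split[of z] ..
  also have "\<dots> \<le> norm (z j + z l) + (\<Sum>i\<in>{..<m} - {j, l}. norm (z i))"
    by (intro order_trans[OF norm_triangle_ineq] add_left_mono norm_sum)
  also have "\<dots> \<le> \<psi> - pm / 6 * \<psi> * d"
    using two unfolding \<psi> split[of "\<lambda>i. norm (z i)"] by linarith
  finally have "norm (EE {v} (gv v) c) \<le> \<psi> * (1 - pm / 6 * d)" by (simp add: algebra_simps)
  then show ?thesis using EE_norm_gv_pos[of v c]
    unfolding rho_def d_def[symmetric] \<psi>_def[symmetric] by (simp add: pos_divide_le_eq mult.commute)
qed

text \<open>With probability at least pm^r the neighbours of \<open>v\<close> show the pattern
  \<open>pat\<close>, and then \<open>rho_le\<close> has the prescribed phase; otherwise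
  \<open>rho\<close> is at most 1.\<close>

lemma EE_rho_pattern_le:
  assumes v: "v < n" and jl: "j < m" "l < m" "j \<noteq> l" and pat: "\<And>u. pat u < m"
  shows "EE {..<n} (rho v) c0 \<le> 1 - pm ^ (r + 1) / 6 *
     (1 - cos (s * Re (b j - b l + a j * of_nat (cnt v pat j) - a l * of_nat (cnt v pat l))))"
proof -
  define d where "d = 1 - cos (s * Re (b j - b l + a j * of_nat (cnt v pat j) - a l * of_nat (cnt v pat l)))"
  have d: "0 \<le> d" by (simp add: d_def)
  define ch where "ch c = (\<Prod>u\<in>nb v. if c u = pat u then 1 else 0 :: real)" for c :: "nat \<Rightarrow> nat"
  have "EE {..<n} ch c0 = (\<Prod>u\<in>nb v. EE {..<n} (\<lambda>c. if c u = pat u then 1 else 0 :: real) c0)"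
    unfolding ch_def[abs_def] using nb_less
    by (intro EE_indep_prod[where N="\<lambda>u. {u}"]) (auto intro: dep_at1)
  also have "\<dots> = (\<Prod>u\<in>nb v. p (pat u))"
  proof (rule prod.cong[OF refl])
    fix u assume "u \<in> nb v"
    then have "EE {..<n} (\<lambda>c. if c u = pat u then 1 else 0 :: real) c0 = (\<Sum>i<m. p i *\<^sub>R (if i = pat u then 1 else 0))"
      using nb_less by (intro EE_single) auto
    also have "\<dots> = (\<Sum>i<m. if i = pat u then p i else 0)" by (intro sum.cong) auto
    also have "\<dots> = p (pat u)" using pat[of u] by simp
    finally show "EE {..<n} (\<lambda>c. if c u = pat u then 1 else 0 :: real) c0 = p (pat u)" .
  qed
  also have "\<dots> \<ge> (\<Prod>u\<in>nb v. pm)" using pm_pos pm_le pat by (intro prod_mono) (auto simp: less_imp_le)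
  finally have Ech: "pm ^ r \<le> EE {..<n} ch c0" using card_nb[OF v] by simp
  have "rho v c \<le> 1 - pm / 6 * d * ch c" for c
  proof (cases "\<forall>u\<in>nb v. c u = pat u")
    case True
    then have "cnt v c i = cnt v pat i" for i by (intro arg_cong[where f=card]) auto
    then have "rho v c \<le> 1 - pm / 6 * d" using rho_le[OF v jl, of c] by (simp add: d_def)
    moreover have "ch c = 1" using True by (simp add: ch_def)
    ultimately show ?thesis by simp
  next
    case False
    then have "ch c = 0" by (auto simp: ch_def)
    then show ?thesis using rho_bounds by simp
  qed
  then have "EE {..<n} (rho v) c0 \<le> EE {..<n} (\<lambda>c. 1 - pm / 6 * d * ch c) c0" by (rule EE_mono)
  also have "\<dots> = 1 - pm / 6 * d * EE {..<n} ch c0" by (simp only: EE_diff EE_mult_left EE_const finite_lessThan)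
  also have "\<dots> \<le> 1 - pm / 6 * d * pm ^ r"
    using Ech pm_pos d by (intro diff_left_mono mult_left_mono) auto
  finally show ?thesis unfolding d_def by (simp add: mult_ac)
qed

lemma EE_rho_le:
  assumes v: "v < n" and aR: "\<And>i. \<bar>Re (a i)\<bar> \<le> pi" and bR: "\<And>i. \<bar>Re (b i)\<bar> \<le> pi"
    and bm: "b (m - 1) = 0"
  shows "EE {..<n} (rho v) c0 \<le> 1 - pm ^ (r + 1) / (384 * real m) * (s\<^sup>2 * ((\<Sum>i<m. (Re (a i))\<^sup>2) + (\<Sum>i<m-1. (Re (b i))\<^sup>2)))"
proof -
  define g where "g = 1 - EE {..<n} (rho v) c0"
  define K where "K = 6 / pm ^ (r + 1)"
  have K: "0 < K" using pm_pos by (simp add: K_def)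
  have scale: "d \<le> K * g" if "EE {..<n} (rho v) c0 \<le> 1 - pm ^ (r + 1) / 6 * d" for d
  proof -
    have "K * (pm ^ (r + 1) / 6 * d) \<le> K * g" using that K by (intro mult_left_mono) (auto simp: g_def)
    moreover have "K * (pm ^ (r + 1) / 6 * d) = d" using pm_pos by (simp add: K_def)
    ultimately show ?thesis by (simp only:)
  qed
  have "nb v \<noteq> {}" using card_nb[OF v] r_ge by auto
  then obtain u0 where u0: "u0 \<in> nb v" by auto
  \<comment> \<open>All neighbours get a third colour, so the phase is \<open>b j - b l\<close>
    alone.\<close>
  have A1: "1 - cos (s * (Re (b j) - Re (b l))) \<le> K * g" if jl: "j < m" "l < m" "j \<noteq> l" for j l
  proof -
    obtain k where k: "k < m" "k \<noteq> j" "k \<noteq> l" using third_colour by blast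
    have "EE {..<n} (rho v) c0 \<le> 1 - pm ^ (r + 1) / 6 *
     (1 - cos (s * Re (b j - b l + a j * of_nat (cnt v (\<lambda>_. k) j) - a l * of_nat (cnt v (\<lambda>_. k) l))))"
      by (rule EE_rho_pattern_le[OF v jl]) (use k in auto)
    then show ?thesis using k by (intro scale) simp
  qed
  \<comment> \<open>One neighbour, present since r >= 1, gets colour \<open>j\<close> and the others
    a third colour: the phase gains exactly one \<open>a j\<close>.\<close>
  have A2: "1 - cos (s * (Re (b j) - Re (b l) + Re (a j))) \<le> K * g" if jl: "j < m" "l < m" "j \<noteq> l" for j l
  proof -
    obtain k where k: "k < m" "k \<noteq> j" "k \<noteq> l" using third_colour by blast
    define pat where "pat u = (if u = u0 then j else k)" for u
    have "{u \<in> nb v. pat u = j} = {u0}" "{u \<in> nb v. pat u = l} = {}"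
      using u0 k jl by (auto simp: pat_def)
    then have c: "cnt v pat j = 1" "cnt v pat l = 0" by simp_all
    have "EE {..<n} (rho v) c0 \<le> 1 - pm ^ (r + 1) / 6 *
     (1 - cos (s * Re (b j - b l + a j * of_nat (cnt v pat j) - a l * of_nat (cnt v pat l))))"
      by (rule EE_rho_pattern_le[OF v jl]) (use k jl in \<open>auto simp: pat_def\<close>)
    then show ?thesis unfolding c by (intro scale) simp
  qed
  have small: "(s * x)\<^sup>2 / 8 \<le> 1 - cos (s * x)" if "\<bar>x\<bar> \<le> pi" for x
  proof (rule one_minus_cos_ge)
    have "s * \<bar>x\<bar> \<le> 1 * pi" using that s by (intro mult_mono) auto
    then show "\<bar>s * x\<bar> \<le> pi" using s by (simp add: abs_mult)
  qed
  have g0: "0 \<le> K * g" using A1[of 0 1] m_ge by (intro order_trans[OF _ A1[of 0 1]]) auto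
  \<comment> \<open>N_m is not a component of W, so the coefficient at colour \<open>m - 1\<close>
    is zero and \<open>l = m - 1\<close> isolates \<open>b j\<close>.\<close>
  have B: "(s * Re (b j))\<^sup>2 \<le> 32 * (K * g)" if "j < m - 1" for j
    using small[OF bR[of j]] A1[of j "m - 1"] that bm g0 by simp
  have A: "(s * Re (a j))\<^sup>2 \<le> 32 * (K * g)" if j: "j < m" for j
  proof -
    obtain l where l: "l < m" "l \<noteq> j" using third_colour by blast
    have "1 - cos (s * (Re (b j) - Re (b l) + Re (a j)) - s * (Re (b j) - Re (b l)))
       \<le> 2 * (1 - cos (s * (Re (b j) - Re (b l) + Re (a j)))) + 2 * (1 - cos (s * (Re (b j) - Re (b l))))"
      by (rule one_minus_cos_diff_le)
    also have "\<dots> \<le> 2 * (K * g) + 2 * (K * g)" using A1[OF j l(1)] A2[OF j l(1)] l by auto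
    also have "s * (Re (b j) - Re (b l) + Re (a j)) - s * (Re (b j) - Re (b l)) = s * Re (a j)"
      by (simp add: algebra_simps)
    finally show ?thesis using small[OF aR[of j]] by simp
  qed
  have "s\<^sup>2 * ((\<Sum>i<m. (Re (a i))\<^sup>2) + (\<Sum>i<m-1. (Re (b i))\<^sup>2))
     = (\<Sum>i<m. (s * Re (a i))\<^sup>2) + (\<Sum>i<m-1. (s * Re (b i))\<^sup>2)"
    by (simp add: distrib_left sum_distrib_left power_mult_distrib)
  also have "\<dots> \<le> (\<Sum>i<m. 32 * (K * g)) + (\<Sum>i<m-1. 32 * (K * g))"
    by (intro add_mono sum_mono A B) auto
  \<comment> \<open>There are 2 m - 1 <= 2 m coefficients at 32 each; with the 6 in \<open>K\<close>
    this makes 384.\<close>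
  also have "\<dots> \<le> 64 * m * (K * g)"
    using mult_right_mono[OF _ g0, of "real (m - 1)" "real m"] by (simp add: algebra_simps)
  finally have "pm ^ (r + 1) / (384 * real m) * (s\<^sup>2 * ((\<Sum>i<m. (Re (a i))\<^sup>2) + (\<Sum>i<m-1. (Re (b i))\<^sup>2)))
     \<le> pm ^ (r + 1) / (384 * real m) * (64 * m * (K * g))"
    using pm_pos by (intro mult_left_mono) auto
  also have "\<dots> = g" using pm_pos m_ge by (simp add: K_def)
  finally show ?thesis by (simp add: g_def)
qed

text \<open>Given the colours outside \<open>I\<close>, the vertices of \<open>I\<close> contribute independent factors. The tilt makes
  \<open>|f|\<close> non-constant, so AM-GM separates it from the product of the \<open>rho v\<close>.\<close>

lemma char_decay:
  assumes aR: "\<And>i. \<bar>Re (a i)\<bar> \<le> pi" and bR: "\<And>i. \<bar>Re (b i)\<bar> \<le> pi"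
    and bm: "b (m - 1) = 0"
    and B: "B \<subseteq> {..<n}" "card B \<le> (r + 1) ^ 5" and dL: "depends_on B L" and L: "\<And>c. norm (L c) \<le> M"
  shows "norm (EE {..<n} (\<lambda>c. L c * exp (\<i> * of_real s * Zt a b c)) c0)
    \<le> M * (decay_const * exp (- decay_rate * n * s\<^sup>2 * ((\<Sum>i<m. (Re (a i))\<^sup>2) + (\<Sum>i<m-1. (Re (b i))\<^sup>2))))"
proof -
  define T where "T = (\<Sum>i<m. (Re (a i))\<^sup>2) + (\<Sum>i<m-1. (Re (b i))\<^sup>2)"
  have T0: "0 \<le> T" by (simp add: T_def sum_nonneg)
  have M0: "0 \<le> M" using order_trans[OF norm_ge_zero L] by blast
  obtain I where I: "I \<subseteq> {..<n}" "I \<inter> B = {}"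
    and sep: "\<And>v w. v \<in> I \<Longrightarrow> w \<in> I \<Longrightarrow> v \<noteq> w \<Longrightarrow> cl v \<inter> cl w = {}"
    and cardI: "n \<le> card B + (r + 1) ^ 2 * card I"
    using separated_set[OF B(1)] by blast
  have fI: "finite I" using I finite_subset by auto
  have I_less: "v < n" if "v \<in> I" for v using I that by auto
  have notin: "v \<notin> cl w" if "v \<in> I" "w \<in> I" "v \<noteq> w" for v w
    using sep[OF that] self_cl[of v] by auto
  have cl_sub: "cl v \<subseteq> insert v (- I)" if "v \<in> I" for v
    using notin[OF _ that] by auto
  define f where "f c = exp (\<i> * of_real s * Zt a b c)" for c
  \<comment> \<open>The exponential without the contributions of \<open>I\<close>. As no vertex of
    \<open>I\<close> lies in the closed neighbourhood of another, \<open>Zt_upd\<close> shows that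
    \<open>h\<close> does not depend on the colours in \<open>I\<close>.\<close>
  define h where "h c = exp (\<i> * of_real s * (Zt a b c - (\<Sum>v\<in>I. xv a b v c)))" for c
  define R where "R c = (\<Prod>v\<in>I. rho v c)" for c
  have dh: "depends_on (- I) h"
  proof (rule depends_on_compl[OF fI])
    fix v c i assume v: "v \<in> I"
    have "(\<Sum>w\<in>I. xv a b w (c(v := i))) - (\<Sum>w\<in>I. xv a b w c) = (\<Sum>w\<in>I. xv a b w (c(v := i)) - xv a b w c)"
      by (simp add: sum_subtractf)
    also have "\<dots> = (\<Sum>w\<in>{v}. xv a b w (c(v := i)) - xv a b w c)"
    proof (rule sum.mono_neutral_right[OF fI])
      show "\<forall>w\<in>I - {v}. xv a b w (c(v := i)) - xv a b w c = 0"
      proof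
        fix w assume w: "w \<in> I - {v}"
        then have "v \<notin> cl w" using notin[OF v, of w] by auto
        then have "xv a b w (c(v := i)) = xv a b w c" by (intro depends_onD[OF dep_xv]) auto
        then show "xv a b w (c(v := i)) - xv a b w c = 0" by simp
      qed
    qed (use v in auto)
    also have "\<dots> = Zt a b (c(v := i)) - Zt a b c" using Zt_upd[OF I_less[OF v], of a b c i] by simp
    finally have "Zt a b (c(v := i)) - (\<Sum>w\<in>I. xv a b w (c(v := i))) = Zt a b c - (\<Sum>w\<in>I. xv a b w c)"
      by (simp add: algebra_simps)
    then show "h (c(v := i)) = h c" by (simp only: h_def)
  qed
  have fh: "f c = h c * (\<Prod>v\<in>I. gv v c)" for c
    by (simp add: f_def h_def gv_def right_diff_distrib sum_distrib_left exp_diff exp_sum fI)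
  have dLh: "depends_on (- I) (\<lambda>c. L c * h c)"
    by (rule depends_on_comp2[OF depends_on_mono[OF dL] dh]) (use I in auto)
  have dg: "depends_on (insert v (- I)) (gv v)" if "v \<in> I" for v
    by (rule depends_on_mono[OF dep_gv cl_sub[OF that]])
  have dR: "depends_on (- I) R"
    unfolding R_def[abs_def]
    by (intro depends_on_prod depends_on_mono[OF dep_rho]) (use cl_sub in auto)
  have norm_f: "norm (f c) = norm (h c) * (\<Prod>v\<in>I. norm (gv v c))" for c
    unfolding fh norm_mult by (simp add: prod_norm)
  have EELf: "norm (EE I (\<lambda>c. L c * f c) c) \<le> M * EE I (\<lambda>c. R c * norm (f c)) c" for c
  proof -
    have "EE I (\<lambda>c. L c * f c) c = EE I (\<lambda>c. (L c * h c) * (\<Prod>v\<in>I. gv v c)) c"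
      by (simp only: fh mult.assoc)
    also have "\<dots> = L c * h c * EE I (\<lambda>c. \<Prod>v\<in>I. gv v c) c"
      by (rule EE_pull[OF dLh]) auto
    also have "EE I (\<lambda>c. \<Prod>v\<in>I. gv v c) c = (\<Prod>v\<in>I. EE {v} (gv v) c)"
      by (rule EE_local_prod[OF fI subset_refl dg])
    finally have "norm (EE I (\<lambda>c. L c * f c) c) = norm (L c) * (norm (h c) * (\<Prod>v\<in>I. norm (EE {v} (gv v) c)))"
      by (simp add: norm_mult prod_norm mult.assoc)
    also have "(\<Prod>v\<in>I. norm (EE {v} (gv v) c)) = R c * (\<Prod>v\<in>I. EE {v} (\<lambda>c. norm (gv v c)) c)"
      unfolding R_def prod.distrib[symmetric] rho_def
      using EE_norm_gv_pos by (intro prod.cong refl) (simp add: less_imp_neq[symmetric])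
    also have "(\<Prod>v\<in>I. EE {v} (\<lambda>c. norm (gv v c)) c) = EE I (\<lambda>c. \<Prod>v\<in>I. norm (gv v c)) c"
      by (rule EE_local_prod[OF fI subset_refl depends_on_comp[OF dg], symmetric])
    also have "norm (h c) * (R c * EE I (\<lambda>c. \<Prod>v\<in>I. norm (gv v c)) c)
        = R c * (norm (h c) * EE I (\<lambda>c. \<Prod>v\<in>I. norm (gv v c)) c)" by simp
    also have "norm (h c) * EE I (\<lambda>c. \<Prod>v\<in>I. norm (gv v c)) c = EE I (\<lambda>c. norm (f c)) c"
      unfolding norm_f by (rule EE_pull[OF depends_on_comp[OF dh], symmetric]) auto
    also have "R c * EE I (\<lambda>c. norm (f c)) c = EE I (\<lambda>c. R c * norm (f c)) c"
      by (rule EE_pull[OF dR, symmetric]) auto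
    also have "norm (L c) * EE I (\<lambda>c. R c * norm (f c)) c \<le> M * EE I (\<lambda>c. R c * norm (f c)) c"
    proof (rule mult_right_mono[OF L])
      have "EE I (\<lambda>_. 0) c \<le> EE I (\<lambda>c. R c * norm (f c)) c"
        by (rule EE_mono) (simp add: R_def prod_nonneg rho_bounds)
      then show "0 \<le> EE I (\<lambda>c. R c * norm (f c)) c" by (simp add: EE_const fI)
    qed
    finally show ?thesis .
  qed
  have "norm (EE {..<n} (\<lambda>c. L c * f c) c0) = norm (EE ({..<n} - I) (EE I (\<lambda>c. L c * f c)) c0)"
    by (simp only: EE_diff_eq[OF finite_lessThan I(1), of "\<lambda>c. L c * f c" c0])
  also have "\<dots> \<le> EE ({..<n} - I) (\<lambda>c. norm (EE I (\<lambda>c. L c * f c) c)) c0" by (rule norm_EE)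
  also have "\<dots> \<le> EE ({..<n} - I) (\<lambda>c. M * EE I (\<lambda>c. R c * norm (f c)) c) c0" by (rule EE_mono[OF EELf])
  also have "\<dots> = M * EE {..<n} (\<lambda>c. R c * norm (f c)) c0"
    using EE_diff_eq[OF _ I(1), of "\<lambda>c. R c * norm (f c)" c0] by (simp add: EE_mult_left)
  finally have 1: "norm (EE {..<n} (\<lambda>c. L c * f c) c0) \<le> M * EE {..<n} (\<lambda>c. R c * norm (f c)) c0" .
  define x where "x = pm ^ (r + 1) / (384 * real m) * (s\<^sup>2 * T)"
  have x0: "0 \<le> x" using pm_pos T0 by (simp add: x_def)
  \<comment> \<open>Now the colours outside \<open>I\<close> are averaged as well; disjoint closed
    neighbourhoods make the \<open>rho v\<close> independent.\<close>
  have "EE {..<n} R c0 = (\<Prod>v\<in>I. EE {..<n} (rho v) c0)"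
    unfolding R_def[abs_def]
  proof (rule EE_indep_prod[where N=cl])
    show "depends_on (cl v) (rho v)" for v by (rule depends_on_mono[OF dep_rho]) auto
  qed (use I_less cl_subset fI sep in auto)
  also have "\<dots> \<le> (\<Prod>v\<in>I. exp (- x))"
  proof (rule prod_mono, rule conjI)
    fix v assume v: "v \<in> I"
    have "EE {..<n} (\<lambda>_. 0) c0 \<le> EE {..<n} (rho v) c0" by (rule EE_mono) (simp add: rho_bounds)
    then show "0 \<le> EE {..<n} (rho v) c0" by (simp add: EE_const)
    have "EE {..<n} (rho v) c0 \<le> 1 - x" unfolding x_def T_def by (rule EE_rho_le[OF I_less[OF v] aR bR bm])
    also have "\<dots> \<le> exp (- x)" using exp_ge_add_one_self[of "- x"] by simp
    finally show "EE {..<n} (rho v) c0 \<le> exp (- x)" .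
  qed
  also have "\<dots> = exp (- (card I * x))" by (simp add: exp_of_nat_mult[symmetric])
  also have "\<dots> \<le> exp (2 * real (card B) - 2 * (decay_rate * n * s\<^sup>2 * T))"
  proof -
    define R2 where "R2 = real ((r + 1)\<^sup>2)"
    have R2: "1 \<le> R2" unfolding R2_def by simp
    have "real n \<le> real (card B + (r + 1) ^ 2 * card I)" using cardI by (rule of_nat_mono)
    also have "\<dots> = card B + R2 * card I" by (simp add: R2_def)
    finally have n_le: "real n \<le> card B + R2 * card I" .
    have "2 * (decay_rate * n * s\<^sup>2 * T) = x / R2 * n" by (simp add: decay_rate_def x_def R2_def mult_ac)
    also have "\<dots> \<le> x / R2 * (card B + R2 * card I)"
      using n_le x0 R2 by (intro mult_left_mono) auto
    also have "\<dots> = x / R2 * card B + card I * x" using R2 by (simp add: field_simps)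
    \<comment> \<open>The excluded set costs only a bounded factor, because \<open>x\<close> is at
      most 1 on the box where the real parts are at most pi.\<close>
    also have "x / R2 * card B \<le> 2 * real (card B)"
    proof (rule mult_right_mono)
      have "(Re (a i))\<^sup>2 \<le> 16" "(Re (b i))\<^sup>2 \<le> 16" for i
        using power_mono[OF order_trans[OF aR pi_less_4[THEN less_imp_le]], of i 2]
          power_mono[OF order_trans[OF bR pi_less_4[THEN less_imp_le]], of i 2] by simp_all
      then have "T \<le> (\<Sum>i<m. 16) + (\<Sum>i<m-1. 16)" unfolding T_def by (intro add_mono sum_mono)
      also have "\<dots> \<le> 32 * real m" by simp
      finally have T: "T \<le> 32 * real m" .
      have "s\<^sup>2 * T \<le> 1 * (32 * real m)" using T T0 s by (intro mult_mono) (auto simp: power_le_one)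
      moreover have "pm ^ (r + 1) / (384 * real m) \<le> 1 / (384 * real m)"
        using pm_pos pm_le_1 by (intro divide_right_mono power_le_one) (auto simp: less_imp_le)
      ultimately have "x \<le> 1 / (384 * real m) * (1 * (32 * real m))"
        unfolding x_def by (intro mult_mono[of "pm ^ (r + 1) / (384 * real m)"]) (auto simp: T0)
      also have "\<dots> \<le> 1" using m_ge by simp
      finally have "x \<le> 1" .
      then show "x / R2 \<le> 2" using R2 by (simp add: divide_le_eq)
    qed simp
    finally show ?thesis by simp
  qed
  finally have ER: "EE {..<n} R c0 \<le> exp (2 * real (card B) - 2 * (decay_rate * n * s\<^sup>2 * T))" .
  \<comment> \<open>The square root of the bound on the mean of \<open>R\<close>; with it both terms
    of the AM-GM inequality are of order \<delta>.\<close>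
  define \<delta> where "\<delta> = exp (card B - decay_rate * n * s\<^sup>2 * T)"
  have \<delta>: "0 < \<delta>" "\<delta> * \<delta> = exp (2 * real (card B) - 2 * (decay_rate * n * s\<^sup>2 * T))"
    by (simp_all add: \<delta>_def flip: exp_add)
  have "R c * norm (f c) \<le> \<delta> / 2 * (norm (f c))\<^sup>2 + 1 / (2 * \<delta>) * R c" for c
  proof -
    have R: "0 \<le> R c" "R c \<le> 1" unfolding R_def by (auto intro!: prod_nonneg prod_le_1 simp: rho_bounds)
    have "0 \<le> (\<delta> * norm (f c) - R c)\<^sup>2" by simp
    then have "2 * \<delta> * (R c * norm (f c)) \<le> \<delta>\<^sup>2 * (norm (f c))\<^sup>2 + (R c)\<^sup>2"
      by (simp add: power2_eq_square algebra_simps)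
    also have "(R c)\<^sup>2 \<le> R c" using R by (simp add: power2_eq_square mult_left_le)
    finally show ?thesis using \<delta>(1) by (simp add: field_simps power2_eq_square)
  qed
  then have "EE {..<n} (\<lambda>c. R c * norm (f c)) c0 \<le> EE {..<n} (\<lambda>c. \<delta> / 2 * (norm (f c))\<^sup>2 + 1 / (2 * \<delta>) * R c) c0"
    by (rule EE_mono)
  also have "\<dots> = \<delta> / 2 * EE {..<n} (\<lambda>c. (norm (f c))\<^sup>2) c0 + 1 / (2 * \<delta>) * EE {..<n} R c0"
    by (simp only: EE_add EE_mult_left)
  also have "\<dots> \<le> \<delta> / 2 * exp 3 + 1 / (2 * \<delta>) * (\<delta> * \<delta>)"
    using EE_norm_exp_sq_le ER \<delta> unfolding f_def by (intro add_mono mult_left_mono) auto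
  also have "\<dots> \<le> \<delta> * exp 3" using \<delta>(1) exp_ge_add_one_self[of "3::real"] by (simp add: field_simps)
  also have "\<delta> \<le> exp (real ((r + 1) ^ 5)) * exp (- decay_rate * n * s\<^sup>2 * T)"
  proof -
    have "real (card B) \<le> real ((r + 1) ^ 5)" using B(2) by (rule of_nat_mono)
    then show ?thesis unfolding \<delta>_def by (simp flip: exp_add)
  qed
  finally have "EE {..<n} (\<lambda>c. R c * norm (f c)) c0 \<le> decay_const * exp (- decay_rate * n * s\<^sup>2 * T)"
    by (simp add: decay_const_def mult_ac)
  then have "M * EE {..<n} (\<lambda>c. R c * norm (f c)) c0 \<le> M * (decay_const * exp (- decay_rate * n * s\<^sup>2 * T))"
    by (rule mult_left_mono[OF _ M0])
  then show ?thesis using 1 unfolding f_def T_def by linarith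
qed

end

end

section \<open>The covariance matrix\<close>

lemma sum_lessThan_add: "sum g {..<a + b} = sum g {..<a} + (\<Sum>i<b. g (a + i))" for g :: "nat \<Rightarrow> 'a::comm_monoid_add"
  by (induction b) (simp_all add: add_ac)

text \<open>Elimination of the last coordinate: the Schur complement \<open>V'\<close> is positive
  definite again. This provides the witness for the choice in \<open>sqrt_factor\<close>.\<close>

lemma cholesky:
  fixes V :: "nat \<Rightarrow> nat \<Rightarrow> real"
  assumes "\<And>i l. i < k \<Longrightarrow> l < k \<Longrightarrow> V i l = V l i"
    and "\<And>x. \<exists>i<k. x i \<noteq> 0 \<Longrightarrow> (\<Sum>i<k. \<Sum>l<k. x i * x l * V i l) > 0"
  shows "\<exists>A. \<forall>i<k. \<forall>l<k. (\<Sum>j<k. A i j * A l j) = V i l"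
  using assms
proof (induction k arbitrary: V)
  case 0
  then show ?case by simp
next
  case (Suc k)
  define d where "d = V k k"
  have d: "0 < d"
  proof -
    define x where "x i = (if i = k then 1 else 0 :: real)" for i :: nat
    have "(\<Sum>i<Suc k. \<Sum>l<Suc k. x i * x l * V i l) > 0" by (rule Suc.prems(2)) (auto simp: x_def)
    then show ?thesis by (simp add: x_def d_def)
  qed
  define V' where "V' i l = V i l - V i k * V l k / d" for i l
  have "\<exists>A. \<forall>i<k. \<forall>l<k. (\<Sum>j<k. A i j * A l j) = V' i l"
  proof (rule Suc.IH)
    show "V' i l = V' l i" if "i < k" "l < k" for i l
      using Suc.prems(1)[of i l] that by (simp add: V'_def)
    fix x :: "nat \<Rightarrow> real" assume x: "\<exists>i<k. x i \<noteq> 0"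
    define t where "t = (\<Sum>i<k. x i * V i k)"
    \<comment> \<open>The last coordinate minimises the quadratic form for given \<open>x\<close>,
      and the minimum is the form of \<open>V'\<close> at \<open>x\<close>.\<close>
    define y where "y i = (if i = k then - t / d else x i)" for i
    have yx: "y i = x i" if "i < k" for i using that by (simp add: y_def)
    have "(\<Sum>i<Suc k. \<Sum>l<Suc k. y i * y l * V i l) > 0"
      using x by (intro Suc.prems(2)) (auto simp: y_def intro: less_SucI)
    also have "(\<Sum>i<Suc k. \<Sum>l<Suc k. y i * y l * V i l) =
       (\<Sum>i<k. (\<Sum>l<k. x i * x l * V i l) + x i * y k * V i k) + ((\<Sum>l<k. y k * x l * V k l) + y k * y k * V k k)"
      by (simp add: yx)
    also have "(\<Sum>i<k. (\<Sum>l<k. x i * x l * V i l) + x i * y k * V i k) = (\<Sum>i<k. \<Sum>l<k. x i * x l * V i l) + y k * t"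
      by (simp add: sum.distrib t_def sum_distrib_left mult_ac)
    also have "(\<Sum>l<k. y k * x l * V k l) = y k * t"
      unfolding t_def sum_distrib_left using Suc.prems(1)[of k] by (intro sum.cong) (auto simp: mult_ac)
    also have "(\<Sum>i<k. \<Sum>l<k. x i * x l * V i l) + y k * t + (y k * t + y k * y k * V k k)
        = (\<Sum>i<k. \<Sum>l<k. x i * x l * V i l) - t * t / d"
      using d by (simp add: y_def d_def field_simps)
    also have "t * t / d = (\<Sum>i<k. \<Sum>l<k. x i * x l * (V i k * V l k / d))"
      unfolding t_def sum_product sum_divide_distrib by (intro sum.cong refl) (simp add: mult_ac)
    also have "(\<Sum>i<k. \<Sum>l<k. x i * x l * V i l) - \<dots> = (\<Sum>i<k. \<Sum>l<k. x i * x l * V' i l)"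
      by (simp add: V'_def right_diff_distrib sum_subtractf)
    finally show "(\<Sum>i<k. \<Sum>l<k. x i * x l * V' i l) > 0" .
  qed
  then obtain A where A: "\<And>i l. i < k \<Longrightarrow> l < k \<Longrightarrow> (\<Sum>j<k. A i j * A l j) = V' i l" by blast
  define A' where "A' i j = (if j < k then (if i < k then A i j else 0) else V i k / sqrt d)" for i j
  have "(\<Sum>j<Suc k. A' i j * A' l j) = V i l" if "i < Suc k" "l < Suc k" for i l
  proof -
    have "(\<Sum>j<k. A' i j * A' l j) = (if i < k \<and> l < k then V' i l else 0)"
      by (auto simp: A'_def A[symmetric] intro!: sum.neutral)
    moreover have "A' i k * A' l k = V i k * V l k / d"
      using d by (simp add: A'_def)
    moreover have "V i k * V k k / d = V i k" "V k k * V l k / d = V l k" using d by (simp_all add: d_def)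
    moreover have "V l k = V k l" using Suc.prems(1)[of l k] that by simp
    ultimately show ?thesis using that by (auto simp: V'_def less_Suc_eq)
  qed
  then show ?case by blast
qed

context palette_deg
begin

definition aof :: "(nat \<Rightarrow> 'a::zero) \<Rightarrow> nat \<Rightarrow> 'a" where "aof z i = (if i < m then z i else 0)"
text \<open>Together with \<open>aof\<close> this splits a linear form on Z^(2m-1) into coefficients
  of the M_i and of the N_i. Colour \<open>m - 1\<close> gets 0, since the last count is determined
  by the others and left out of W.\<close>

definition bof :: "(nat \<Rightarrow> 'a::zero) \<Rightarrow> nat \<Rightarrow> 'a" where "bof z i = (if i < m - 1 then z (m + i) else 0)"

text \<open>Covariance matrix of the colour indicators at one vertex.\<close>

definition Cov :: "nat \<Rightarrow> nat \<Rightarrow> real" where "Cov i l = (if i = l then p i else 0) - p i * p l"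

lemma sum_split: "(\<Sum>t<2 * m - 1. g t) = (\<Sum>i<m. g i) + (\<Sum>i<m-1. g (m + i))" for g :: "nat \<Rightarrow> 'a::comm_monoid_add"
proof -
  have "2 * m - 1 = m + (m - 1)" using m_ge by simp
  then show ?thesis by (simp only: sum_lessThan_add)
qed

text \<open>The summands are the Hoeffding pieces: M_i acts on each vertex like r p_i times a colour
  indicator, and each of the n r / 2 edges adds the square of \<open>Cov\<close>.\<close>

lemma Sigma_MM: "i < m \<Longrightarrow> l < m \<Longrightarrow> Sigma_cov r m p i l = r * p i * (r * p l) * Cov i l + r / 2 * (Cov i l)\<^sup>2"
  by (simp add: Sigma_cov_def Cov_def power2_eq_square algebra_simps) (simp add: field_simps)

lemma Sigma_MN: "i < m \<Longrightarrow> l < m - 1 \<Longrightarrow> Sigma_cov r m p i (m + l) = r * p i * Cov i l"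
  by (simp add: Sigma_cov_def Cov_def power2_eq_square algebra_simps)

lemma Sigma_NM: "i < m - 1 \<Longrightarrow> l < m \<Longrightarrow> Sigma_cov r m p (m + i) l = r * p l * Cov i l"
  by (auto simp: Sigma_cov_def Cov_def power2_eq_square algebra_simps)

lemma Sigma_NN: "i < m - 1 \<Longrightarrow> l < m - 1 \<Longrightarrow> Sigma_cov r m p (m + i) (m + l) = Cov i l"
  by (auto simp: Sigma_cov_def Cov_def power2_eq_square algebra_simps)

lemma Sigma_sym: "Sigma_cov r m p s t = Sigma_cov r m p t s"
proof (cases "s = t")
  case False
  then have "t \<noteq> s" by simp
  with False show ?thesis
    by (cases "s < m"; cases "t < m"; simp add: Sigma_cov_def mult_ac)
qed simp

lemma sum_bof: "(\<Sum>i<m-1. z (m + i) * g i) = (\<Sum>i<m. bof z i * g i)" for z :: "nat \<Rightarrow> 'a::comm_ring_1"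
proof -
  have "(\<Sum>i<m. bof z i * g i) = (\<Sum>i<m-1. bof z i * g i)"
    by (rule sum.mono_neutral_right) (auto simp: bof_def)
  then show ?thesis by (simp add: bof_def)
qed

lemma sum_aof: "(\<Sum>i<m. z i * g i) = (\<Sum>i<m. aof z i * g i)" for z :: "nat \<Rightarrow> 'a::comm_ring_1"
  by (simp add: aof_def)

lemma sum_cind_cind:
  assumes "l < m" "l' < m"
  shows "(\<Sum>i<m. p i * (cind l i * cind l' i)) = Cov l l'"
proof -
  have "(\<Sum>i<m. p i * (cind l i * cind l' i)) =
    (\<Sum>i<m. (if i = l then (if l = l' then p l else 0) else 0) - p l' * (if i = l then p i else 0)
      - p l * (if i = l' then p i else 0) + p l * p l' * p i)"
    by (intro sum.cong refl) (auto simp: cind_def algebra_simps)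
  also have "\<dots> = (if l = l' then p l else 0) - p l' * p l - p l * p l' + p l * p l'"
    using assms by (simp add: sum.distrib sum_subtractf p_sum flip: sum_distrib_left)
  finally show ?thesis by (simp add: Cov_def mult.commute)
qed

text \<open>The kernel is a sum of products over its two endpoints, so each cross term averages to a
  product of two equal covariances.\<close>

lemma kap2_eq: "(\<Sum>i<m. \<Sum>j<m. of_real (p i) * of_real (p j) * (kap a i j)\<^sup>2)
    = (\<Sum>l<m. \<Sum>l'<m. a l * a l' * of_real ((Cov l l')\<^sup>2))"
proof -
  have "(\<Sum>i<m. \<Sum>j<m. of_real (p i) * of_real (p j) * (kap a i j)\<^sup>2) =
    (\<Sum>i<m. \<Sum>j<m. \<Sum>l<m. \<Sum>l'<m. a l * a l' * of_real ((p i * (cind l i * cind l' i)) * (p j * (cind l j * cind l' j))))"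
    by (simp add: kap_def power2_eq_square sum_product sum_distrib_left mult_ac)
  also have "\<dots> = (\<Sum>i<m. \<Sum>l<m. \<Sum>j<m. \<Sum>l'<m. a l * a l' * of_real ((p i * (cind l i * cind l' i)) * (p j * (cind l j * cind l' j))))"
    by (intro sum.cong refl sum.swap)
  also have "\<dots> = (\<Sum>l<m. \<Sum>i<m. \<Sum>l'<m. \<Sum>j<m. a l * a l' * of_real ((p i * (cind l i * cind l' i)) * (p j * (cind l j * cind l' j))))"
    by (subst sum.swap) (intro sum.cong refl sum.swap)
  also have "\<dots> = (\<Sum>l<m. \<Sum>l'<m. \<Sum>i<m. \<Sum>j<m. a l * a l' * of_real ((p i * (cind l i * cind l' i)) * (p j * (cind l j * cind l' j))))"
    by (intro sum.cong refl sum.swap)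
  also have "\<dots> = (\<Sum>l<m. \<Sum>l'<m. a l * a l' * of_real ((\<Sum>i<m. p i * (cind l i * cind l' i)) * (\<Sum>j<m. p j * (cind l j * cind l' j))))"
    by (intro sum.cong refl, subst sum_product, simp only: of_real_sum sum_distrib_left)
  also have "\<dots> = (\<Sum>l<m. \<Sum>l'<m. a l * a l' * of_real ((Cov l l')\<^sup>2))"
    by (simp add: sum_cind_cind power2_eq_square)
  finally show ?thesis .
qed

lemma gbar2_eq: "(\<Sum>i<m. of_real (p i) * (gbar a b i)\<^sup>2)
    = (\<Sum>l<m. \<Sum>l'<m. gam a b l * gam a b l' * of_real (Cov l l'))"
proof -
  have "(\<Sum>i<m. of_real (p i) * (gbar a b i)\<^sup>2) = (\<Sum>i<m. of_real (p i) * (gam a b i)\<^sup>2)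
      - 2 * gmean a b * (\<Sum>i<m. of_real (p i) * gam a b i) + (gmean a b)\<^sup>2 * of_real (\<Sum>i<m. p i)"
    unfolding sum_distrib_left of_real_sum sum_subtractf[symmetric] sum.distrib[symmetric]
    by (intro sum.cong refl) (simp add: gbar_def power2_eq_square algebra_simps)
  also have "\<dots> = (\<Sum>i<m. of_real (p i) * (gam a b i)\<^sup>2) - gmean a b * gmean a b"
    by (simp add: p_sum gmean_def power2_eq_square)
  also have "(\<Sum>i<m. of_real (p i) * (gam a b i)\<^sup>2) = (\<Sum>l<m. \<Sum>l'<m. if l = l' then of_real (p l) * (gam a b l)\<^sup>2 else 0)"
    by simp
  also have "gmean a b * gmean a b = (\<Sum>l<m. \<Sum>l'<m. of_real (p l) * gam a b l * (of_real (p l') * gam a b l'))"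
    by (simp add: gmean_def sum_product)
  also have "(\<Sum>l<m. \<Sum>l'<m. if l = l' then of_real (p l) * (gam a b l)\<^sup>2 else 0) - \<dots> =
     (\<Sum>l<m. \<Sum>l'<m. gam a b l * gam a b l' * of_real (Cov l l'))"
    unfolding sum_subtractf[symmetric]
    by (intro sum.cong refl) (auto simp: Cov_def power2_eq_square algebra_simps)
  finally show ?thesis .
qed

text \<open>Stated over any real normed field because it is applied at complex frequencies, where it
  puts Sigma into the exponent of the Gaussian.\<close>

lemma Sigma_quadratic_form:
  fixes z :: "nat \<Rightarrow> 'a::real_normed_field"
  shows "(\<Sum>s<2*m-1. \<Sum>t<2*m-1. z s * z t * of_real (Sigma_cov r m p s t)) = qf (aof z) (bof z)"
proof -
  let ?a = "aof z" and ?b = "bof z"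
  have "(\<Sum>s<2*m-1. \<Sum>t<2*m-1. z s * z t * of_real (Sigma_cov r m p s t)) =
      (\<Sum>i<m. z i * ((\<Sum>l<m. z l * of_real (r * p i * (r * p l) * Cov i l + r / 2 * (Cov i l)\<^sup>2))
              + (\<Sum>l<m-1. z (m + l) * of_real (r * p i * Cov i l))))
    + (\<Sum>i<m-1. z (m + i) * ((\<Sum>l<m. z l * of_real (r * p l * Cov i l)) + (\<Sum>l<m-1. z (m + l) * of_real (Cov i l))))"
    unfolding sum_split distrib_left sum_distrib_left
    by (intro arg_cong2[where f="(+)"] sum.cong refl)
       (auto simp: Sigma_MM Sigma_MN Sigma_NM Sigma_NN mult.assoc)
  also have "\<dots> = (\<Sum>i<m. ?a i * ((\<Sum>l<m. ?a l * of_real (r * p i * (r * p l) * Cov i l + r / 2 * (Cov i l)\<^sup>2))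
              + (\<Sum>l<m. ?b l * of_real (r * p i * Cov i l))))
    + (\<Sum>i<m. ?b i * ((\<Sum>l<m. ?a l * of_real (r * p l * Cov i l)) + (\<Sum>l<m. ?b l * of_real (Cov i l))))"
    by (simp only: sum_bof[of z] sum_aof[of z])
  also have "\<dots> = (\<Sum>i<m. \<Sum>l<m. gam ?a ?b i * gam ?a ?b l * of_real (Cov i l) + of_nat r / 2 * (?a i * ?a l * of_real ((Cov i l)\<^sup>2)))"
    unfolding sum_distrib_left sum.distrib[symmetric]
    by (intro sum.cong refl) (simp add: gam_def algebra_simps)
  also have "\<dots> = qf ?a ?b"
    unfolding qf_def gbar2_eq kap2_eq by (simp add: sum.distrib sum_distrib_left)
  finally show ?thesis .
qed

lemma kap_distinct:
  fixes a :: "nat \<Rightarrow> real"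
  assumes "j < m" "k < m" "j \<noteq> k"
  shows "kap a j k = (\<Sum>l<m. a l * (p l)\<^sup>2) - a j * p j - a k * p k"
proof -
  have "kap a j k = (\<Sum>l<m. a l * (p l)\<^sup>2 - (if l = j then a l * p l else 0) - (if l = k then a l * p l else 0))"
    unfolding kap_def using assms(3)
    by (intro sum.cong refl) (auto simp: cind_def power2_eq_square algebra_simps)
  then show ?thesis using assms by (simp add: sum_subtractf)
qed

text \<open>The proof of \<open>qf_lower\<close> yields 610 in place of 1000.\<close>

definition qf_gap :: real where "qf_gap = pm ^ 4 / (1000 * m * r\<^sup>2)"

lemma qf_gap_pos: "0 < qf_gap"
  using pm_pos m_ge r_ge by (simp add: qf_gap_def)

text \<open>Non-degeneracy of \<open>\<Sigma>\<close>; for two colours it fails, since then \<open>r N\<^sub>1 - 2 M\<^sub>1 = r N\<^sub>2 - 2 M\<^sub>2\<close>.\<close>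
lemma qf_lower:
  fixes a b :: "nat \<Rightarrow> real"
  assumes bm: "b (m - 1) = 0"
  shows "qf_gap * ((\<Sum>i<m. (a i)\<^sup>2) + (\<Sum>i<m-1. (b i)\<^sup>2)) \<le> qf a b"
proof -
  define V where "V = (\<Sum>i<m. p i * (gbar a b i)\<^sup>2)"
  define K2 where "K2 = (\<Sum>i<m. \<Sum>j<m. p i * p j * (kap a i j)\<^sup>2)"
  define Q where "Q = qf a b"
  have Q: "Q = V + r / 2 * K2" by (simp add: Q_def qf_def V_def K2_def)
  have p0: "0 \<le> p i" if "i < m" for i using p_pos[OF that] by simp
  have V0: "0 \<le> V" unfolding V_def using p0 by (intro sum_nonneg mult_nonneg_nonneg) auto
  have K20: "0 \<le> K2" unfolding K2_def using p0 by (intro sum_nonneg mult_nonneg_nonneg) auto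
  have r1: "1 \<le> real r" using r_ge by simp
  have "1 / 2 * K2 \<le> r / 2 * K2" using K20 r1 by (intro mult_right_mono) auto
  then have VQ: "V \<le> Q" and KQ: "K2 \<le> 2 * Q" using V0 K20 unfolding Q by auto
  have Q0: "0 \<le> Q" using VQ V0 by linarith
  \<comment> \<open>A common bound for all |kap| and |gbar|: the square of each, times pm^2, is at
    most 2 Q.\<close>
  define \<epsilon> where "\<epsilon> = sqrt (2 * Q) / pm"
  have \<epsilon>0: "0 \<le> \<epsilon>" using Q0 pm_pos by (simp add: \<epsilon>_def)
  have \<epsilon>2: "\<epsilon>\<^sup>2 = 2 * Q / pm\<^sup>2" using Q0 by (simp add: \<epsilon>_def power_divide)
  have pm0: "0 \<le> pm" using pm_pos by simp
  have kap_le: "\<bar>kap a j k\<bar> \<le> \<epsilon>" if jk: "j < m" "k < m" for j k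
  proof -
    have "pm * pm * (kap a j k)\<^sup>2 \<le> p j * p k * (kap a j k)\<^sup>2"
      using pm_le[OF jk(1)] pm_le[OF jk(2)] pm0 p0[OF jk(1)] by (intro mult_right_mono mult_mono) auto
    also have "\<dots> \<le> (\<Sum>k<m. p j * p k * (kap a j k)\<^sup>2)"
      using jk p0 by (intro member_le_sum[of k "{..<m}" "\<lambda>k. p j * p k * (kap a j k)\<^sup>2"]) auto
    also have "\<dots> \<le> K2" unfolding K2_def
      using jk p0 by (intro member_le_sum[of j "{..<m}" "\<lambda>j. \<Sum>k<m. p j * p k * (kap a j k)\<^sup>2"])
        (auto intro!: sum_nonneg mult_nonneg_nonneg)
    finally have "(pm * kap a j k)\<^sup>2 \<le> 2 * Q" using KQ by (simp add: power2_eq_square mult_ac)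
    then have "\<bar>pm * kap a j k\<bar> \<le> sqrt (2 * Q)" using real_le_rsqrt[of "\<bar>pm * kap a j k\<bar>"] by simp
    then show ?thesis using pm_pos by (simp add: \<epsilon>_def abs_mult le_divide_eq mult.commute)
  qed
  \<comment> \<open>At distinct colours the kernel is \<sigma> - x_j - x_k. A third colour shows
    that all x_j nearly agree; \<sigma> is their weighted mean, so the kernel is nearly - \<sigma>,
    which forces \<sigma> and all x_j to be small. Collecting errors gives 5 \<epsilon> for \<sigma>
    and 7 \<epsilon> for x_j.\<close>
  define x where "x j = a j * p j" for j
  define \<sigma> where "\<sigma> = (\<Sum>l<m. a l * (p l)\<^sup>2)"
  have kx: "kap a j k = \<sigma> - x j - x k" if "j < m" "k < m" "j \<noteq> k" for j k
    using kap_distinct[OF that, of a] by (simp add: \<sigma>_def x_def)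
  have xx: "\<bar>x l - x k\<bar> \<le> 2 * \<epsilon>" if lk: "l < m" "k < m" for l k
  proof (cases "l = k")
    case False
    obtain j where j: "j < m" "j \<noteq> l" "j \<noteq> k" using third_colour by blast
    show ?thesis using kx[OF j(1) lk(1) j(2)] kx[OF j(1) lk(2) j(3)] kap_le[OF j(1) lk(1)] kap_le[OF j(1) lk(2)]
      by linarith
  qed (use \<epsilon>0 in simp)
  have \<sigma>x: "\<bar>\<sigma> - x k\<bar> \<le> 2 * \<epsilon>" if k: "k < m" for k
  proof -
    have "(\<Sum>l<m. p l * x k) = x k" by (simp add: p_sum flip: sum_distrib_right)
    moreover have "(\<Sum>l<m. p l * x l) = \<sigma>" by (simp add: \<sigma>_def x_def power2_eq_square mult_ac)
    ultimately have "\<sigma> - x k = (\<Sum>l<m. p l * (x l - x k))"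
      by (simp add: right_diff_distrib sum_subtractf)
    also have "\<bar>\<dots>\<bar> \<le> (\<Sum>l<m. p l * (2 * \<epsilon>))"
      by (rule order_trans[OF sum_abs]) (auto intro!: sum_mono mult_left_mono xx k simp: abs_mult p0)
    also have "\<dots> = 2 * \<epsilon>" by (simp add: p_sum flip: sum_distrib_right)
    finally show ?thesis .
  qed
  have xle: "\<bar>x k\<bar> \<le> 7 * \<epsilon>" if k: "k < m" for k
  proof -
    have "0 < m" "1 < m" using m_ge by auto
    then show ?thesis using kap_le[of 0 1] kx[of 0 1] \<sigma>x[of 0] \<sigma>x[of 1] \<sigma>x[OF k] by linarith
  qed
  have a2: "(a i)\<^sup>2 \<le> 49 * \<epsilon>\<^sup>2 / pm\<^sup>2" if i: "i < m" for i
  proof -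
    have "pm * \<bar>a i\<bar> \<le> p i * \<bar>a i\<bar>" using pm_le[OF i] by (intro mult_right_mono) auto
    also have "\<dots> \<le> 7 * \<epsilon>" using xle[OF i] p0[OF i] by (simp add: x_def abs_mult mult.commute)
    finally have "(pm * \<bar>a i\<bar>)\<^sup>2 \<le> (7 * \<epsilon>)\<^sup>2" using pm0 by (intro power_mono) auto
    then show ?thesis using pm_pos by (simp add: le_divide_eq power_mult_distrib mult.commute)
  qed
  have gb: "\<bar>gbar a b i\<bar> \<le> \<epsilon>" if i: "i < m" for i
  proof -
    have "pm\<^sup>2 * (gbar a b i)\<^sup>2 \<le> p i * (gbar a b i)\<^sup>2"
      using pm_le[OF i] pm_le_1 pm0 by (intro mult_right_mono) (auto simp: power2_eq_square intro: order_trans[OF mult_left_le])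
    also have "\<dots> \<le> V" unfolding V_def
      using i p0 by (intro member_le_sum[of i "{..<m}" "\<lambda>i. p i * (gbar a b i)\<^sup>2"]) auto
    finally have "(pm * gbar a b i)\<^sup>2 \<le> 2 * Q" using VQ Q0 by (simp add: power_mult_distrib)
    then have "\<bar>pm * gbar a b i\<bar> \<le> sqrt (2 * Q)" using real_le_rsqrt[of "\<bar>pm * gbar a b i\<bar>"] by simp
    then show ?thesis using pm_pos by (simp add: \<epsilon>_def abs_mult le_divide_eq mult.commute)
  qed
  have b2: "(b i)\<^sup>2 \<le> 256 * r\<^sup>2 * \<epsilon>\<^sup>2" if i: "i < m" for i
  proof -
    have m1: "m - 1 < m" using m_ge by simp
    have "b i = gbar a b i - gbar a b (m - 1) + r * x (m - 1) - r * x i"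
      using bm by (simp add: gbar_def gam_def x_def)
    moreover have "\<bar>r * x k\<bar> \<le> 7 * (r * \<epsilon>)" if "k < m" for k
      using mult_left_mono[OF xle[OF that], of r] by (simp add: abs_mult mult_ac)
    moreover have "\<epsilon> \<le> r * \<epsilon>" using mult_right_mono[OF r1 \<epsilon>0] by simp
    ultimately have "\<bar>b i\<bar> \<le> 16 * (r * \<epsilon>)"
      using gb[OF i] gb[OF m1] i m1 by (smt (verit))
    then have "\<bar>b i\<bar>\<^sup>2 \<le> (16 * (r * \<epsilon>))\<^sup>2" by (intro power_mono) auto
    then show ?thesis by (simp add: power_mult_distrib)
  qed
  have pm2: "pm\<^sup>2 \<le> 1" using pm0 pm_le_1 by (simp add: power_le_one)
  have r2: "1 \<le> (real r)\<^sup>2" using r1 by simp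
  have "(\<Sum>i<m. (a i)\<^sup>2) + (\<Sum>i<m-1. (b i)\<^sup>2) \<le> (\<Sum>i<m. 49 * \<epsilon>\<^sup>2 / pm\<^sup>2) + (\<Sum>i<m-1. 256 * r\<^sup>2 * \<epsilon>\<^sup>2)"
    by (intro add_mono sum_mono a2 b2) auto
  also have "\<dots> \<le> m * (49 * \<epsilon>\<^sup>2 / pm\<^sup>2) + m * (256 * r\<^sup>2 * \<epsilon>\<^sup>2)"
    by (simp add: mult_right_mono)
  also have "\<dots> \<le> m * (49 * r\<^sup>2 * (\<epsilon>\<^sup>2 / pm\<^sup>2)) + m * (256 * r\<^sup>2 * (\<epsilon>\<^sup>2 / pm\<^sup>2))"
  proof (intro add_mono mult_left_mono)
    have "1 * (\<epsilon>\<^sup>2 / pm\<^sup>2) \<le> r\<^sup>2 * (\<epsilon>\<^sup>2 / pm\<^sup>2)" using r2 by (intro mult_right_mono) auto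
    then show "49 * \<epsilon>\<^sup>2 / pm\<^sup>2 \<le> 49 * r\<^sup>2 * (\<epsilon>\<^sup>2 / pm\<^sup>2)" by simp
    show "\<epsilon>\<^sup>2 \<le> \<epsilon>\<^sup>2 / pm\<^sup>2" using pm2 pm_pos by (simp add: le_divide_eq mult_left_le)
  qed auto
  also have "\<dots> = 610 * m * r\<^sup>2 / pm ^ 4 * Q"
  proof -
    have "\<epsilon>\<^sup>2 / pm\<^sup>2 = 2 * Q / pm ^ 4" unfolding \<epsilon>2 by (simp add: power2_eq_square power4_eq_xxxx)
    then show ?thesis by simp
  qed
  finally have "qf_gap * ((\<Sum>i<m. (a i)\<^sup>2) + (\<Sum>i<m-1. (b i)\<^sup>2)) \<le> qf_gap * (610 * m * r\<^sup>2 / pm ^ 4 * Q)"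
    using qf_gap_pos by (intro mult_left_mono) auto
  also have "\<dots> = 610 / 1000 * Q" using pm_pos m_ge r_ge by (simp add: qf_gap_def)
  also have "\<dots> \<le> Q" using Q0 by simp
  finally show ?thesis by (simp add: Q_def)
qed

text \<open>Meant for the imaginary parts: with t = \<open>tilt\<close> it is O(1 / n), so that the
  tilt costs a bounded factor exp (n qf / 2).\<close>

lemma qf_upper:
  fixes a b :: "nat \<Rightarrow> real" and t :: real
  assumes "\<And>i. \<bar>a i\<bar> \<le> t" "\<And>i. \<bar>b i\<bar> \<le> t"
  shows "qf a b \<le> 6 * ((1 + r) * t)\<^sup>2"
proof -
  have t0: "0 \<le> t" using assms(1)[of 0] by linarith
  have p0: "0 \<le> p i" if "i < m" for i using p_pos[OF that] by simp
  have "(\<Sum>i<m. p i * (gbar a b i)\<^sup>2) \<le> (\<Sum>i<m. p i * (2 * (1 + r) * t)\<^sup>2)"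
    using norm_gbar_le[of a t b] assms t0 p0
    by (intro sum_mono mult_left_mono) (auto simp: abs_le_square_iff[symmetric])
  also have "\<dots> = 4 * ((1 + r) * t)\<^sup>2"
    by (simp add: p_sum power_mult_distrib flip: sum_distrib_right) (simp add: power2_eq_square algebra_simps)
  finally have 1: "(\<Sum>i<m. p i * (gbar a b i)\<^sup>2) \<le> 4 * ((1 + r) * t)\<^sup>2" .
  have "(\<Sum>i<m. \<Sum>j<m. p i * p j * (kap a i j)\<^sup>2) \<le> (\<Sum>i<m. \<Sum>j<m. p i * p j * (2 * t)\<^sup>2)"
  proof (intro sum_mono mult_left_mono)
    show "(kap a i j)\<^sup>2 \<le> (2 * t)\<^sup>2" for i j
      using power_mono[of "\<bar>kap a i j\<bar>" "2 * t" 2] norm_kap_le[of a t i j] assms by simp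
  qed (use p0 in auto)
  also have "\<dots> = 4 * t\<^sup>2"
    by (simp add: p_sum power_mult_distrib flip: sum_distrib_right sum_distrib_left)
  finally have "r / 2 * (\<Sum>i<m. \<Sum>j<m. p i * p j * (kap a i j)\<^sup>2) \<le> r / 2 * (4 * t\<^sup>2)"
    by (intro mult_left_mono) auto
  also have "\<dots> \<le> 2 * ((1 + r) * t)\<^sup>2"
  proof -
    have "real r \<le> (1 + real r)\<^sup>2" by (simp add: power2_eq_square algebra_simps)
    then have "r * t\<^sup>2 \<le> (1 + r)\<^sup>2 * t\<^sup>2" by (intro mult_right_mono) auto
    then show ?thesis by (simp add: power_mult_distrib)
  qed
  finally show ?thesis using 1 by (simp add: qf_def)
qed

lemma Re_qf:
  fixes a b :: "nat \<Rightarrow> complex"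
  shows "Re (qf a b) = qf (\<lambda>i. Re (a i)) (\<lambda>i. Re (b i)) - qf (\<lambda>i. Im (a i)) (\<lambda>i. Im (b i))"
proof -
  have gb: "Re (gbar a b i) = gbar (\<lambda>i. Re (a i)) (\<lambda>i. Re (b i)) i" "Im (gbar a b i) = gbar (\<lambda>i. Im (a i)) (\<lambda>i. Im (b i)) i" for i
    by (simp_all add: gbar_def gam_def gmean_def)
  have kp: "Re (kap a i j) = kap (\<lambda>i. Re (a i)) i j" "Im (kap a i j) = kap (\<lambda>i. Im (a i)) i j" for i j
    by (simp_all add: kap_def)
  have h: "Re (of_nat r / 2 * z) = real r / 2 * Re z" for z :: complex
    by (simp add: Re_divide_numeral)
  have w: "Re (of_real x * of_real y * (z :: complex)\<^sup>2) = x * y * ((Re z)\<^sup>2 - (Im z)\<^sup>2)"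
      "Re (of_real x * (z :: complex)\<^sup>2) = x * ((Re z)\<^sup>2 - (Im z)\<^sup>2)" for x y z
    by (simp_all add: power2_eq_square algebra_simps)
  show ?thesis
    unfolding qf_def plus_complex.sel h Re_sum w gb kp
    by (simp add: right_diff_distrib sum_subtractf)
qed

lemma aof_bof_norm: "(\<Sum>i<m. (aof z i)\<^sup>2) + (\<Sum>i<m-1. (bof z i)\<^sup>2) = (\<Sum>t<2*m-1. (z t)\<^sup>2)" for z :: "nat \<Rightarrow> real"
  unfolding sum_split by (simp add: aof_def bof_def)

lemma Sigma_pos:
  fixes z :: "nat \<Rightarrow> real"
  shows "qf_gap * (\<Sum>t<2*m-1. (z t)\<^sup>2) \<le> (\<Sum>s<2*m-1. \<Sum>t<2*m-1. z s * z t * Sigma_cov r m p s t)"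
  using qf_lower[of "bof z" "aof z"] Sigma_quadratic_form[of z]
  unfolding aof_bof_norm by (simp add: bof_def)

end

section \<open>The statistic W in terms of the local summands\<close>

context colour_graph
begin

lemma sum_nb_swap: "(\<Sum>v<n. \<Sum>u\<in>nb v. g v u) = (\<Sum>v<n. \<Sum>u\<in>nb v. g u v)"
proof -
  have eq: "(\<Sum>u\<in>nb v. h u) = (\<Sum>u<n. if u \<in> nb v then h u else 0)" for v and h :: "nat \<Rightarrow> 'a"
  proof -
    have "{..<n} \<inter> nb v = nb v" by (auto simp: nb_def)
    then show ?thesis using sum.inter_restrict[of "{..<n}" h "nb v"] by simp
  qed
  have "(\<Sum>v<n. \<Sum>u\<in>nb v. g v u) = (\<Sum>u<n. \<Sum>v<n. if u \<in> nb v then g v u else 0)"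
    unfolding eq by (rule sum.swap)
  also have "\<dots> = (\<Sum>u<n. \<Sum>v<n. if v \<in> nb u then g v u else 0)"
    using nb_sym by (intro sum.cong refl) auto
  finally show ?thesis unfolding eq .
qed

abbreviation "ind l i \<equiv> (if i = l then 1 else 0 :: real)"

lemma W_edges:
  assumes "t < m"
  shows "2 * real_of_int (W_stat E n m c t) = (\<Sum>v<n. \<Sum>u\<in>nb v. ind t (c v) * ind t (c u))"
proof -
  define P where "P = {(u, v). u < v \<and> v < n \<and> E u v \<and> c u = t \<and> c v = t}"
  define P' where "P' = {(u, v). v < u \<and> u < n \<and> E u v \<and> c u = t \<and> c v = t}"
  define S where "S = Sigma {..<n} (\<lambda>v. {u \<in> nb v. c v = t \<and> c u = t})"
  have Esym: "E u v \<longleftrightarrow> E v u" if "u < n" "v < n" for u v using reg that by (auto simp: regular_graph_def)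
  have Eirr: "\<not> E u u" if "u < n" for u using reg that by (auto simp: regular_graph_def)
  have S: "S = P \<union> P'" "P \<inter> P' = {}"
    using Eirr by (auto simp: S_def P_def P'_def nb_def) (metis linorder_neqE_nat)
  have fin: "finite P" "finite P'"
    by (rule finite_subset[of _ "{..<n} \<times> {..<n}"]; force simp: P_def P'_def)+
  have "P' = prod.swap ` P"
  proof (intro set_eqI iffI)
    fix x assume "x \<in> P'"
    then obtain u v where x: "x = (u, v)" "v < u" "u < n" "E u v" "c u = t" "c v = t" by (auto simp: P'_def)
    then have "(v, u) \<in> P" using Esym[of u v] by (auto simp: P_def)
    then show "x \<in> prod.swap ` P" using x by force
  next
    fix x assume "x \<in> prod.swap ` P"
    then show "x \<in> P'" using Esym by (auto simp: P_def P'_def)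
  qed
  then have "card P' = card P" by (simp add: card_image)
  then have "card S = 2 * card P" unfolding S(1) using fin S(2) by (simp add: card_Un_disjoint)
  then have "2 * real (card P) = real (card S)" by simp
  also have "card S = (\<Sum>v<n. card {u \<in> nb v. c v = t \<and> c u = t})"
    unfolding S_def by (rule card_SigmaI) auto
  also have "real (\<Sum>v<n. card {u \<in> nb v. c v = t \<and> c u = t}) = (\<Sum>v<n. \<Sum>u\<in>nb v. ind t (c v) * ind t (c u))"
    unfolding of_nat_sum
  proof (rule sum.cong[OF refl])
    fix v
    show "real (card {u \<in> nb v. c v = t \<and> c u = t}) = (\<Sum>u\<in>nb v. ind t (c v) * ind t (c u))"
  proof -
    have "(\<Sum>u\<in>nb v. ind t (c v) * ind t (c u)) = (\<Sum>u\<in>nb v. if c v = t \<and> c u = t then 1 else 0)"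
      by (intro sum.cong) auto
    then show ?thesis by (simp add: sum.If_cases Int_def)
  qed
  qed
  finally show ?thesis using assms by (simp add: W_stat_def P_def)
qed

lemma W_vertices:
  assumes "i < m - 1"
  shows "real_of_int (W_stat E n m c (m + i)) = (\<Sum>v<n. ind i (c v))"
proof -
  have "(\<Sum>v<n. ind i (c v)) = card {v. v < n \<and> c v = i}"
    by (simp add: sum.If_cases Int_def)
  then show ?thesis using assms by (simp add: W_stat_def)
qed

text \<open>Expanding the centred edge products leaves a term - r p_l N_l for each colour, which the
  share r p_l a_l in \<open>gam\<close> compensates; what remains is W centred exactly at n
  nu.\<close>

lemma Zt_W:
  fixes z :: "nat \<Rightarrow> 'a::real_normed_field"
  assumes c: "\<And>v. v < n \<Longrightarrow> c v < m"
  shows "Zt (aof z) (bof z) c =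
    (\<Sum>t<2*m-1. z t * of_real (real_of_int (W_stat E n m c t) - n * nu r m p t))"
proof -
  let ?a = "aof z" and ?b = "bof z"
  define N where "N l = (\<Sum>v<n. ind l (c v))" for l
  \<comment> \<open>Twice the number of edges of colour \<open>l\<close>, since each edge is met
    from both ends.\<close>
  define M where "M l = (\<Sum>v<n. \<Sum>u\<in>nb v. ind l (c v) * ind l (c u))" for l
  have Nu: "(\<Sum>v<n. \<Sum>u\<in>nb v. ind l (c v)) = r * N l" for l
    by (simp add: N_def sum_distrib_left card_nb)
  have Nu': "(\<Sum>v<n. \<Sum>u\<in>nb v. ind l (c u)) = r * N l" for l
    using sum_nb_swap[of "\<lambda>v u. ind l (c u)"] Nu[of l] by simp
  have edge: "(\<Sum>v<n. \<Sum>u\<in>nb v. cind l (c v) * cind l (c u)) = M l - 2 * (p l * (r * N l)) + n * r * (p l)\<^sup>2" for l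
  proof -
    have "(\<Sum>v<n. \<Sum>u\<in>nb v. cind l (c v) * cind l (c u)) =
      (\<Sum>v<n. \<Sum>u\<in>nb v. ind l (c v) * ind l (c u) - p l * ind l (c v) - p l * ind l (c u) + (p l)\<^sup>2)"
      by (intro sum.cong refl) (simp add: cind_def power2_eq_square algebra_simps)
    also have "\<dots> = M l - p l * (\<Sum>v<n. \<Sum>u\<in>nb v. ind l (c v)) - p l * (\<Sum>v<n. \<Sum>u\<in>nb v. ind l (c u))
        + (\<Sum>v<n. \<Sum>u\<in>nb v. (p l)\<^sup>2)"
      by (simp only: sum.distrib sum_subtractf M_def sum_distrib_left)
    also have "(\<Sum>v<n. \<Sum>u\<in>nb v. (p l)\<^sup>2) = n * r * (p l)\<^sup>2" by (simp add: card_nb)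
    finally show ?thesis unfolding Nu Nu' by simp
  qed
  have "(\<Sum>v<n. (\<Sum>u\<in>nb v. kap ?a (c v) (c u)) / 2) =
     (\<Sum>v<n. \<Sum>u\<in>nb v. \<Sum>l<m. ?a l * of_real (cind l (c v) * cind l (c u) / 2))"
    by (simp add: kap_def sum_divide_distrib mult.assoc)
  also have "\<dots> = (\<Sum>v<n. \<Sum>l<m. \<Sum>u\<in>nb v. ?a l * of_real (cind l (c v) * cind l (c u) / 2))"
    by (intro sum.cong refl sum.swap)
  also have "\<dots> = (\<Sum>l<m. \<Sum>v<n. \<Sum>u\<in>nb v. ?a l * of_real (cind l (c v) * cind l (c u) / 2))"
    by (rule sum.swap)
  also have "\<dots> = (\<Sum>l<m. ?a l * of_real ((\<Sum>v<n. \<Sum>u\<in>nb v. cind l (c v) * cind l (c u)) / 2))"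
    by (simp only: sum_divide_distrib of_real_sum sum_distrib_left)
  finally have 1: "(\<Sum>v<n. (\<Sum>u\<in>nb v. kap ?a (c v) (c u)) / 2) =
      (\<Sum>l<m. ?a l * of_real ((M l - 2 * (p l * (r * N l)) + n * r * (p l)\<^sup>2) / 2))"
    unfolding edge .
  have gb: "gbar ?a ?b i = (\<Sum>l<m. gam ?a ?b l * of_real (cind l i))" if "i < m" for i
  proof -
    have "(\<Sum>l<m. gam ?a ?b l * of_real (cind l i)) = (\<Sum>l<m. (if l = i then gam ?a ?b l else 0) - of_real (p l) * gam ?a ?b l)"
      by (intro sum.cong refl) (auto simp: cind_def algebra_simps)
    then show ?thesis using that by (simp add: sum_subtractf gbar_def gmean_def)
  qed
  have "(\<Sum>v<n. gbar ?a ?b (c v)) = (\<Sum>v<n. \<Sum>l<m. gam ?a ?b l * of_real (cind l (c v)))"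
    using c by (intro sum.cong gb) auto
  also have "\<dots> = (\<Sum>l<m. \<Sum>v<n. gam ?a ?b l * of_real (cind l (c v)))"
    by (rule sum.swap)
  also have "\<dots> = (\<Sum>l<m. gam ?a ?b l * of_real (\<Sum>v<n. cind l (c v)))"
    by (simp only: of_real_sum sum_distrib_left)
  also have "\<dots> = (\<Sum>l<m. gam ?a ?b l * of_real (N l - n * p l))"
    by (simp add: cind_def sum_subtractf N_def)
  finally have 2: "(\<Sum>v<n. gbar ?a ?b (c v)) = (\<Sum>l<m. gam ?a ?b l * of_real (N l - n * p l))" .
  have "Zt ?a ?b c = (\<Sum>l<m. ?a l * of_real (M l / 2 - n * (r * (p l)\<^sup>2 / 2)) + ?b l * of_real (N l - n * p l))"
    unfolding Zt_def yv_def sum.distrib 1 2 unfolding sum.distrib[symmetric]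
    by (intro sum.cong refl) (simp add: gam_def power2_eq_square field_simps)
  also have "\<dots> = (\<Sum>l<m. z l * of_real (M l / 2 - n * (r * (p l)\<^sup>2 / 2))) + (\<Sum>i<m-1. z (m + i) * of_real (N i - n * p i))"
    by (simp only: sum.distrib sum_aof[of z] sum_bof[of z])
  also have "\<dots> = (\<Sum>t<2*m-1. z t * of_real (real_of_int (W_stat E n m c t) - n * nu r m p t))"
    unfolding sum_split
  proof (intro arg_cong2[where f="(+)"] sum.cong refl)
    fix l assume "l \<in> {..<m}"
    then show "z l * of_real (M l / 2 - n * (r * (p l)\<^sup>2 / 2)) = z l * of_real (real_of_int (W_stat E n m c l) - n * nu r m p l)"
    proof -
      assume l: "l \<in> {..<m}"
      then have "M l = 2 * real_of_int (W_stat E n m c l)" using W_edges[of l c] by (simp add: M_def)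
      then show ?thesis using l by (simp add: nu_def)
    qed
  next
    fix i assume "i \<in> {..<m-1}"
    then show "z (m + i) * of_real (N i - n * p i) = z (m + i) * of_real (real_of_int (W_stat E n m c (m + i)) - n * nu r m p (m + i))"
      using W_vertices[of i c] by (simp add: N_def nu_def)
  qed
  finally show ?thesis .
qed

end

section \<open>Fourier inversion on the lattice\<close>

lemma has_bochner_integral_iexp_int:
  "has_bochner_integral lborel (\<lambda>\<theta>. indicator {-pi..pi} \<theta> *\<^sub>R exp (\<i> * of_real (\<theta> * of_int d)))
     (if d = 0 then of_real (2 * pi) else 0)"
proof (cases "d = 0")
  case True
  have "has_bochner_integral lborel (\<lambda>\<theta>. indicator {-pi..pi} \<theta> *\<^sub>R (1::complex)) (of_real pi - of_real (- pi))"
    by (rule has_bochner_integral_FTC_Icc) (auto intro!: derivative_eq_intros)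
  then show ?thesis using True by simp
next
  case False
  define F where "F \<theta> = exp (\<i> * of_real (\<theta> * of_int d)) / (\<i> * of_int d)" for \<theta> :: real
  have "has_bochner_integral lborel (\<lambda>\<theta>. indicator {-pi..pi} \<theta> *\<^sub>R exp (\<i> * of_real (\<theta> * of_int d))) (F pi - F (- pi))"
  proof (rule has_bochner_integral_FTC_Icc)
    fix x :: real
    show "(F has_vector_derivative exp (\<i> * of_real (x * of_int d))) (at x within {-pi..pi})"
    proof -
      have eq: "exp (\<i> * of_real (y * of_int d)) = exp (y *\<^sub>R (\<i> * of_int d))" for y :: real
        by (simp add: scaleR_conv_of_real mult_ac)
      have "(F has_vector_derivative exp (x *\<^sub>R (\<i> * of_int d)) * (\<i> * of_int d) / (\<i> * of_int d)) (at x within {-pi..pi})"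
        unfolding F_def eq by (intro has_vector_derivative_divide exp_scaleR_has_vector_derivative_right)
      then show ?thesis unfolding eq using False by simp
    qed
  qed (auto intro!: continuous_intros)
  moreover have "F pi = F (- pi)"
  proof -
    have "cis (pi * of_int d) = cis (- pi * of_int d)" by (simp add: complex_eq_iff)
    then show ?thesis by (simp only: F_def cis_conv_exp)
  qed
  ultimately show ?thesis using False by simp
qed

text \<open>Orthogonality of the characters, coordinate by coordinate. The real centring
  \<open>a\<close> cancels between the two exponentials, and the weights \<open>w\<close> leave room
  for the tilt.\<close>

lemma lattice_inversion:
  fixes X :: "'c \<Rightarrow> nat \<Rightarrow> int" and x :: "nat \<Rightarrow> int" and w :: "'c \<Rightarrow> complex" and a :: "nat \<Rightarrow> real"
  assumes "finite C"
  shows "(\<integral>\<theta>. of_real (\<Prod>j<k. indicator {-pi..pi} (\<theta> j)) *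
       ((\<Sum>c\<in>C. w c * exp (\<i> * of_real (\<Sum>j<k. \<theta> j * (X c j - a j)))) * exp (- (\<i> * of_real (\<Sum>j<k. \<theta> j * (x j - a j)))))
       \<partial>(PiM {..<k} (\<lambda>_. lborel)))
     = of_real ((2 * pi) ^ k) * (\<Sum>c | c \<in> C \<and> (\<forall>j<k. X c j = x j). w c)"
    and "integrable (PiM {..<k} (\<lambda>_. lborel)) (\<lambda>\<theta>. of_real (\<Prod>j<k. indicator {-pi..pi} (\<theta> j)) *
       ((\<Sum>c\<in>C. w c * exp (\<i> * of_real (\<Sum>j<k. \<theta> j * (X c j - a j)))) * exp (- (\<i> * of_real (\<Sum>j<k. \<theta> j * (x j - a j))))))"
proof -
  interpret product_sigma_finite "\<lambda>_::nat. lborel :: real measure"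
    by (rule product_sigma_finite.intro) (rule lborel.sigma_finite_measure_axioms)
  define f where "f d \<theta> = indicator {-pi..pi} \<theta> *\<^sub>R exp (\<i> * of_real (\<theta> * of_int d))" for d and \<theta> :: real
  have f: "integrable lborel (f d)" "integral\<^sup>L lborel (f d) = (if d = 0 then of_real (2 * pi) else 0)" for d
    using has_bochner_integral_iexp_int[of d] by (auto simp: f_def[abs_def] has_bochner_integral_iff)
  have eq: "of_real (\<Prod>j<k. indicator {-pi..pi} (\<theta> j)) *
       ((\<Sum>c\<in>C. w c * exp (\<i> * of_real (\<Sum>j<k. \<theta> j * (X c j - a j)))) * exp (- (\<i> * of_real (\<Sum>j<k. \<theta> j * (x j - a j)))))
     = (\<Sum>c\<in>C. w c * (\<Prod>j<k. f (X c j - x j) (\<theta> j)))" for \<theta> :: "nat \<Rightarrow> real"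
  proof -
    have "exp (\<i> * of_real (\<Sum>j<k. \<theta> j * (X c j - a j))) * exp (- (\<i> * of_real (\<Sum>j<k. \<theta> j * (x j - a j))))
        = (\<Prod>j<k. exp (\<i> * of_real (\<theta> j * of_int (X c j - x j))))" for c
    proof -
      have "\<i> * of_real (\<Sum>j<k. \<theta> j * (X c j - a j)) + - (\<i> * of_real (\<Sum>j<k. \<theta> j * (x j - a j)))
        = (\<Sum>j<k. \<i> * of_real (\<theta> j * of_int (X c j - x j)))"
        unfolding of_real_sum sum_distrib_left sum_negf[symmetric] sum.distrib[symmetric]
        by (intro sum.cong refl) (simp add: algebra_simps)
      then show ?thesis by (simp only: exp_add[symmetric] exp_sum[OF finite_lessThan])
    qed
    then have e: "of_real (\<Prod>j<k. indicator {-pi..pi} (\<theta> j)) * (w c * exp (\<i> * of_real (\<Sum>j<k. \<theta> j * (X c j - a j)))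
          * exp (- (\<i> * of_real (\<Sum>j<k. \<theta> j * (x j - a j)))))
        = w c * (\<Prod>j<k. f (X c j - x j) (\<theta> j))" for c
      unfolding f_def scaleR_conv_of_real prod.distrib of_real_prod mult.assoc by (simp only: mult.left_commute)
    show ?thesis unfolding sum_distrib_right sum_distrib_left e ..
  qed
  have int: "integrable (PiM {..<k} (\<lambda>_. lborel)) (\<lambda>\<theta>. \<Prod>j<k. f (X c j - x j) (\<theta> j))" for c
    by (rule product_integrable_prod) (auto intro: f)
  show "integrable (PiM {..<k} (\<lambda>_. lborel)) (\<lambda>\<theta>. of_real (\<Prod>j<k. indicator {-pi..pi} (\<theta> j)) *
       ((\<Sum>c\<in>C. w c * exp (\<i> * of_real (\<Sum>j<k. \<theta> j * (X c j - a j)))) * exp (- (\<i> * of_real (\<Sum>j<k. \<theta> j * (x j - a j))))))"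
    unfolding eq by (intro Bochner_Integration.integrable_sum integrable_mult_right int)
  have "(\<integral>\<theta>. (\<Prod>j<k. f (X c j - x j) (\<theta> j)) \<partial>(PiM {..<k} (\<lambda>_. lborel))) =
    (if \<forall>j<k. X c j = x j then of_real ((2 * pi) ^ k) else 0)" for c
  proof -
    have "(\<integral>\<theta>. (\<Prod>j<k. f (X c j - x j) (\<theta> j)) \<partial>(PiM {..<k} (\<lambda>_. lborel))) = (\<Prod>j<k. integral\<^sup>L lborel (f (X c j - x j)))"
      by (rule product_integral_prod) (auto intro: f)
    also have "\<dots> = (\<Prod>j<k. if X c j = x j then of_real (2 * pi) else 0)" by (simp add: f)
    also have "\<dots> = (if \<forall>j<k. X c j = x j then of_real ((2 * pi) ^ k) else 0)"
      by (auto simp: prod_zero_iff)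
    finally show ?thesis .
  qed
  note I = this
  have "(\<integral>\<theta>. (\<Sum>c\<in>C. w c * (\<Prod>j<k. f (X c j - x j) (\<theta> j))) \<partial>(PiM {..<k} (\<lambda>_. lborel))) =
    (\<Sum>c\<in>C. w c * (\<integral>\<theta>. (\<Prod>j<k. f (X c j - x j) (\<theta> j)) \<partial>(PiM {..<k} (\<lambda>_. lborel))))"
    by (subst Bochner_Integration.integral_sum) (simp_all only: integral_mult_right_zero integrable_mult_right int)
  also have "\<dots> = (\<Sum>c\<in>C. if \<forall>j<k. X c j = x j then of_real ((2 * pi) ^ k) * w c else 0)"
    unfolding I by (intro sum.cong refl) auto
  also have "\<dots> = of_real ((2 * pi) ^ k) * (\<Sum>c | c \<in> C \<and> (\<forall>j<k. X c j = x j). w c)"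
    by (simp only: sum_distrib_left sum.inter_filter[OF assms]) (auto intro!: sum.cong)
  finally show "(\<integral>\<theta>. of_real (\<Prod>j<k. indicator {-pi..pi} (\<theta> j)) *
       ((\<Sum>c\<in>C. w c * exp (\<i> * of_real (\<Sum>j<k. \<theta> j * (X c j - a j)))) * exp (- (\<i> * of_real (\<Sum>j<k. \<theta> j * (x j - a j)))))
       \<partial>(PiM {..<k} (\<lambda>_. lborel)))
     = of_real ((2 * pi) ^ k) * (\<Sum>c | c \<in> C \<and> (\<forall>j<k. X c j = x j). w c)"
    unfolding eq .
qed

section \<open>Gaussian vectors\<close>

abbreviation "SN \<equiv> density lborel (\<lambda>x. ennreal (std_normal_density x))"

text \<open>Completing the square turns the imaginary part \<eta> of \<open>w\<close> into a real
  translation of the density (\<open>pt\<close>), so the characteristic function at real arguments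
  suffices and no contour is shifted.\<close>

lemma cexp_normal:
  fixes w :: complex
  shows "integrable SN (\<lambda>x. exp (\<i> * w * of_real x))" (is ?int)
    and "(\<integral>x. exp (\<i> * w * of_real x) \<partial>SN) = exp (- w\<^sup>2 / 2)" (is ?eq)
proof -
  interpret real_distribution SN by (rule real_dist_normal_dist)
  define \<theta> where "\<theta> = Re w"
  define \<eta> where "\<eta> = Im w"
  have w: "w = of_real \<theta> + \<i> * of_real \<eta>" by (simp add: \<theta>_def \<eta>_def complex_eq_iff)
  define g where "g u = (std_normal_density u *\<^sub>R exp (\<i> * of_real (\<theta> * u))) * exp (- (\<i> * of_real (\<theta> * \<eta>)))" for u
  have "integrable lborel (\<lambda>u. std_normal_density u *\<^sub>R exp (\<i> * of_real (\<theta> * u)))"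
  proof -
    have "integrable SN (\<lambda>u. exp (\<i> * of_real (\<theta> * u)))" by (rule integrable_iexp) auto
    then show ?thesis by (subst (asm) integrable_density) auto
  qed
  then have intg: "integrable lborel g" unfolding g_def[abs_def] by (rule integrable_mult_left)
  have "(\<integral>u. std_normal_density u *\<^sub>R exp (\<i> * of_real (\<theta> * u)) \<partial>lborel) = char SN \<theta>"
    unfolding char_def by (subst integral_density) auto
  also have "\<dots> = exp (of_real (- \<theta>\<^sup>2 / 2))"
    unfolding char_std_normal_distribution by (simp only: exp_of_real)
  finally have eg: "integral\<^sup>L lborel g = exp (of_real (- \<theta>\<^sup>2 / 2)) * exp (- (\<i> * of_real (\<theta> * \<eta>)))"
    unfolding g_def by (simp only: integral_mult_left_zero)
  have pt: "std_normal_density x *\<^sub>R exp (\<i> * w * of_real x) = exp (of_real (\<eta>\<^sup>2 / 2)) * g (\<eta> + 1 * x)" for x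
  proof -
    have 1: "exp (\<i> * w * of_real x) = exp (\<i> * of_real (\<theta> * x)) * of_real (exp (- (\<eta> * x)))"
      unfolding w exp_of_real[symmetric] exp_add[symmetric] by (simp add: algebra_simps)
    have 2: "std_normal_density x * exp (- (\<eta> * x)) = exp (\<eta>\<^sup>2 / 2) * std_normal_density (\<eta> + x)"
      unfolding std_normal_density_def
      by (simp add: mult_exp_exp[symmetric] power2_eq_square field_simps flip: exp_add)
    have 3: "exp (\<i> * of_real (\<theta> * (\<eta> + x))) * exp (- (\<i> * of_real (\<theta> * \<eta>))) = exp (\<i> * of_real (\<theta> * x))"
      unfolding exp_add[symmetric] by (simp add: algebra_simps)
    have "std_normal_density x *\<^sub>R exp (\<i> * w * of_real x) = of_real (std_normal_density x * exp (- (\<eta> * x))) * exp (\<i> * of_real (\<theta> * x))"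
      unfolding 1 scaleR_conv_of_real by simp
    also have "\<dots> = of_real (exp (\<eta>\<^sup>2 / 2)) * (of_real (std_normal_density (\<eta> + x)) * exp (\<i> * of_real (\<theta> * x)))"
      unfolding 2 by simp
    also have "\<dots> = exp (of_real (\<eta>\<^sup>2 / 2)) * g (\<eta> + 1 * x)"
      unfolding g_def 3[symmetric] exp_of_real scaleR_conv_of_real by (simp add: mult.assoc)
    finally show ?thesis .
  qed
  have "integrable lborel (\<lambda>x. std_normal_density x *\<^sub>R exp (\<i> * w * of_real x))"
    unfolding pt using lborel_integrable_real_affine[OF intg, of 1 \<eta>] by simp
  then show ?int by (subst integrable_density) auto
  have "(\<integral>x. exp (\<i> * w * of_real x) \<partial>SN) = (\<integral>x. std_normal_density x *\<^sub>R exp (\<i> * w * of_real x) \<partial>lborel)"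
    by (subst integral_density) auto
  also have "\<dots> = exp (of_real (\<eta>\<^sup>2 / 2)) * integral\<^sup>L lborel g"
    unfolding pt using lborel_integral_real_affine[of 1 g \<eta>] by simp
  also have "\<dots> = exp (- w\<^sup>2 / 2)"
    unfolding eg w exp_add[symmetric] by (simp add: power2_eq_square field_simps exp_add[symmetric])
  finally show ?eq .
qed

lemma prob_space_SN: "prob_space SN"
  by (rule real_distribution.axioms(1)[OF real_dist_normal_dist])

lemma product_sigma_finite_SN: "product_sigma_finite (\<lambda>_::nat. SN)"
  using prob_space_SN by (simp add: prob_space_imp_sigma_finite product_sigma_finite.intro)

lemma prob_space_std_normal_vec: "prob_space (std_normal_vec k)"
  unfolding std_normal_vec_def by (rule prob_space_PiM) (rule prob_space_SN)

text \<open>The matrix enters through A A^T alone, so the arbitrary choice behind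
  \<open>sqrt_factor\<close> is harmless.\<close>

lemma normal_vec_char:
  fixes \<zeta> :: "nat \<Rightarrow> complex" and A :: "nat \<Rightarrow> nat \<Rightarrow> real"
  shows "integrable (std_normal_vec k) (\<lambda>z. exp (\<i> * (\<Sum>t<k. \<zeta> t * of_real (\<Sum>j<k. A t j * z j))))" (is ?int)
    and "(\<integral>z. exp (\<i> * (\<Sum>t<k. \<zeta> t * of_real (\<Sum>j<k. A t j * z j))) \<partial>std_normal_vec k)
      = exp (- (\<Sum>s<k. \<Sum>t<k. \<zeta> s * \<zeta> t * of_real (\<Sum>j<k. A s j * A t j)) / 2)" (is ?eq)
proof -
  interpret product_sigma_finite "\<lambda>_::nat. SN" by (rule product_sigma_finite_SN)
  define w where "w j = (\<Sum>t<k. \<zeta> t * of_real (A t j))" for j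
  have eq: "exp (\<i> * (\<Sum>t<k. \<zeta> t * of_real (\<Sum>j<k. A t j * z j))) = (\<Prod>j<k. exp (\<i> * w j * of_real (z j)))" for z
  proof -
    have "(\<Sum>t<k. \<zeta> t * of_real (\<Sum>j<k. A t j * z j)) = (\<Sum>t<k. \<Sum>j<k. \<zeta> t * of_real (A t j) * of_real (z j))"
      by (simp add: sum_distrib_left mult.assoc)
    also have "\<dots> = (\<Sum>j<k. w j * of_real (z j))"
      by (subst sum.swap) (simp add: w_def sum_distrib_right)
    finally show ?thesis by (simp add: sum_distrib_left exp_sum mult.assoc)
  qed
  show ?int unfolding eq std_normal_vec_def by (rule product_integrable_prod) (auto intro: cexp_normal)
  have "(\<integral>z. (\<Prod>j<k. exp (\<i> * w j * of_real (z j))) \<partial>std_normal_vec k) = (\<Prod>j<k. exp (- (w j)\<^sup>2 / 2))"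
    unfolding std_normal_vec_def
    by (subst product_integral_prod) (auto intro: cexp_normal simp: cexp_normal(2))
  also have "\<dots> = exp (- (\<Sum>j<k. (w j)\<^sup>2) / 2)"
    by (simp add: exp_sum[symmetric] sum_negf sum_divide_distrib)
  also have "(\<Sum>j<k. (w j)\<^sup>2) = (\<Sum>j<k. \<Sum>s<k. \<Sum>t<k. \<zeta> s * \<zeta> t * of_real (A s j * A t j))"
    unfolding w_def power2_eq_square sum_product by (intro sum.cong refl) simp
  also have "\<dots> = (\<Sum>s<k. \<Sum>j<k. \<Sum>t<k. \<zeta> s * \<zeta> t * of_real (A s j * A t j))" by (rule sum.swap)
  also have "\<dots> = (\<Sum>s<k. \<Sum>t<k. \<Sum>j<k. \<zeta> s * \<zeta> t * of_real (A s j * A t j))"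
    by (intro sum.cong refl sum.swap)
  also have "\<dots> = (\<Sum>s<k. \<Sum>t<k. \<zeta> s * \<zeta> t * of_real (\<Sum>j<k. A s j * A t j))"
    by (simp only: of_real_sum sum_distrib_left)
  finally show ?eq unfolding eq .
qed

text \<open>For fixed other coordinates at most one value of coordinate \<open>l\<close> solves the
  equation. This discards the faces of the cubes, where the Fourier limit differs from the
  indicator.\<close>

lemma AE_normal_linear_neq:
  assumes "l < k" "A l \<noteq> 0"
  shows "AE z in std_normal_vec k. (\<Sum>j<k. A j * z j) \<noteq> u"
proof -
  interpret product_sigma_finite "\<lambda>_::nat. SN" by (rule product_sigma_finite_SN)
  define J where "J = {..<k} - {l}"
  have kJ: "{..<k} = insert l J" "l \<notin> J" "finite J" using assms by (auto simp: J_def)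
  define P where "P z \<longleftrightarrow> (\<Sum>j<k. A j * z j) = u" for z
  have meas[measurable]: "{z \<in> space (PiM {..<k} (\<lambda>_. SN)). P z} \<in> sets (PiM {..<k} (\<lambda>_. SN))"
    unfolding P_def by measurable
  have "emeasure (PiM {..<k} (\<lambda>_. SN)) {z \<in> space (PiM {..<k} (\<lambda>_. SN)). P z} =
      (\<integral>\<^sup>+z. indicator {z \<in> space (PiM {..<k} (\<lambda>_. SN)). P z} z \<partial>PiM {..<k} (\<lambda>_. SN))"
    by simp
  also have "\<dots> = (\<integral>\<^sup>+x. (\<integral>\<^sup>+y. indicator {z \<in> space (PiM {..<k} (\<lambda>_. SN)). P z} (x(l := y)) \<partial>SN) \<partial>PiM J (\<lambda>_. SN))"
    using meas unfolding kJ(1) by (intro product_nn_integral_insert) (use kJ in auto)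
  also have "\<dots> = (\<integral>\<^sup>+x. 0 \<partial>PiM J (\<lambda>_. SN))"
  proof (rule nn_integral_cong)
    fix x
    define y0 where "y0 = (u - (\<Sum>j\<in>J. A j * x j)) / A l"
    have "AE y in SN. y \<noteq> y0"
      by (subst AE_density) (auto intro: AE_mp[OF AE_lborel_singleton[of y0]])
    then have "AE y in SN. indicator {z \<in> space (PiM {..<k} (\<lambda>_. SN)). P z} (x(l := y)) = (0::ennreal)"
    proof eventually_elim
      fix y assume y: "y \<noteq> y0"
      have "(\<Sum>j\<in>J. A j * (x(l := y)) j) = (\<Sum>j\<in>J. A j * x j)" using kJ by (intro sum.cong) auto
      then have "(\<Sum>j<k. A j * (x(l := y)) j) = A l * y + (\<Sum>j\<in>J. A j * x j)"
        unfolding kJ(1) using kJ(2,3) by simp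
      then have "\<not> P (x(l := y))" using y assms(2) by (auto simp: P_def y0_def field_simps)
      then show "indicator {z \<in> space (PiM {..<k} (\<lambda>_. SN)). P z} (x(l := y)) = (0::ennreal)" by simp
    qed
    then have "(\<integral>\<^sup>+y. indicator {z \<in> space (PiM {..<k} (\<lambda>_. SN)). P z} (x(l := y)) \<partial>SN) = (\<integral>\<^sup>+y. 0 \<partial>SN)"
      by (rule nn_integral_cong_AE)
    then show "(\<integral>\<^sup>+y. indicator {z \<in> space (PiM {..<k} (\<lambda>_. SN)). P z} (x(l := y)) \<partial>SN) = 0" by simp
  qed
  finally have "emeasure (PiM {..<k} (\<lambda>_. SN)) {z \<in> space (PiM {..<k} (\<lambda>_. SN)). P z} = 0" by simp
  then have "AE z in PiM {..<k} (\<lambda>_. SN). \<not> P z"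
    by (subst AE_iff_measurable[OF meas]) auto
  then show ?thesis unfolding std_normal_vec_def P_def .
qed

section \<open>The Dirichlet kernel of an interval\<close>

text \<open>\<open>snc (\<theta> / 2)\<close> is the Fourier transform of the interval [-1/2,
  1/2).\<close>

definition snc :: "real \<Rightarrow> real" where "snc x = (if x = 0 then 1 else sin x / x)"

lemma snc_measurable [measurable]: "snc \<in> borel_measurable borel"
  unfolding snc_def[abs_def] by measurable

lemma isCont_snc: "isCont snc x"
  using isCont_sinc[of x] by (simp add: snc_def[abs_def])

lemma abs_snc_le_1: "\<bar>snc x\<bar> \<le> 1"
  using abs_sin_x_le_abs_x[of x] by (auto simp: snc_def divide_le_eq_1)

lemma abs_one_minus_snc_le: "\<bar>1 - snc x\<bar> \<le> \<bar>x\<bar>"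
proof (cases "\<bar>x\<bar> \<le> 2")
  case True
  have "\<bar>sin x - (\<Sum>k<3. sin_coeff k * x ^ k)\<bar> \<le> inverse (fact 3) * \<bar>x\<bar> ^ 3"
    by (rule Maclaurin_sin_bound)
  then have *: "\<bar>sin x - x\<bar> \<le> \<bar>x\<bar> ^ 3 / 6"
    by (simp add: sin_coeff_def eval_nat_numeral)
  show ?thesis
  proof (cases "x = 0")
    case False
    have "\<bar>1 - snc x\<bar> = \<bar>sin x - x\<bar> / \<bar>x\<bar>"
      using False by (simp add: snc_def abs_minus_commute diff_divide_distrib flip: abs_divide)
    also have "\<dots> \<le> \<bar>x\<bar> ^ 3 / 6 / \<bar>x\<bar>" by (intro divide_right_mono *) auto
    also have "\<dots> = \<bar>x\<bar> * \<bar>x\<bar> / 6" using False by (simp add: power3_eq_cube)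
    also have "\<dots> \<le> \<bar>x\<bar> * 2 / 6" using True by (intro divide_right_mono mult_left_mono) auto
    finally show ?thesis using abs_ge_zero[of x] by linarith
  qed (simp add: snc_def)
next
  case False
  then show ?thesis using abs_snc_le_1[of x] by linarith
qed

text \<open>An antiderivative in \<theta> of \<open>snc (\<theta> / 2) * cos (\<theta> * t)\<close>,
  written with the sine integral so that uniform bounds and limits at infinity can be taken from
  \<open>Si\<close>.\<close>

definition Xi :: "real \<Rightarrow> real \<Rightarrow> real" where
  "Xi t \<theta> = Si (\<theta> * (t + 1/2)) - Si (\<theta> * (t - 1/2))"

lemma DERIV_Xi: "(Xi t has_real_derivative snc (\<theta> / 2) * cos (\<theta> * t)) (at \<theta>)"
proof -
  have "(Xi t has_real_derivative snc (\<theta> * (t + 1/2)) * (t + 1/2) - snc (\<theta> * (t - 1/2)) * (t - 1/2)) (at \<theta>)"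
    unfolding Xi_def[abs_def] snc_def
    by (intro DERIV_diff DERIV_chain2[OF DERIV_Si] DERIV_cmult_right[OF DERIV_ident, simplified])
  also have "snc (\<theta> * (t + 1/2)) * (t + 1/2) - snc (\<theta> * (t - 1/2)) * (t - 1/2) = snc (\<theta> / 2) * cos (\<theta> * t)"
  proof (cases "\<theta> = 0")
    case False
    have s: "snc (\<theta> * y) * y = sin (\<theta> * y) / \<theta>" for y
      using False by (simp add: snc_def)
    have "sin (\<theta> * (t + 1/2)) - sin (\<theta> * (t - 1/2)) = 2 * sin (\<theta> / 2) * cos (\<theta> * t)"
    proof -
      have e: "\<theta> * (t + 1/2) = \<theta> * t + \<theta> / 2" "\<theta> * (t - 1/2) = \<theta> * t - \<theta> / 2" by (simp_all add: field_simps)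
      show ?thesis unfolding e sin_add sin_diff by simp
    qed
    then have "sin (\<theta> * (t + 1/2)) / \<theta> - sin (\<theta> * (t - 1/2)) / \<theta> = 2 * sin (\<theta> / 2) * cos (\<theta> * t) / \<theta>"
      by (simp flip: diff_divide_distrib)
    then show ?thesis unfolding s using False by (simp add: snc_def)
  qed (simp add: snc_def)
  finally show ?thesis .
qed

text \<open>The sine part is odd and integrates to zero; the cosine part has the antiderivative
  \<open>Xi\<close>.\<close>

lemma dirichlet_integral:
  assumes T: "0 \<le> T"
  shows "integrable lborel (\<lambda>\<theta>. of_real (indicator {-T..T} \<theta> * snc (\<theta> / 2)) * exp (\<i> * of_real (\<theta> * t)))" (is "integrable lborel ?f")
    and "(\<integral>\<theta>. of_real (indicator {-T..T} \<theta> * snc (\<theta> / 2)) * exp (\<i> * of_real (\<theta> * t)) \<partial>lborel) = of_real (Xi t T - Xi t (- T))"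
proof -
  define c where "c \<theta> = indicator {-T..T} \<theta> *\<^sub>R (snc (\<theta> / 2) * cos (\<theta> * t))" for \<theta>
  define s where "s \<theta> = indicator {-T..T} \<theta> *\<^sub>R (snc (\<theta> / 2) * sin (\<theta> * t))" for \<theta>
  have cont: "continuous_on S (\<lambda>\<theta>. snc (\<theta> / 2))" for S
    by (rule continuous_on_compose2[of UNIV snc]) (auto intro!: continuous_intros continuous_at_imp_continuous_on isCont_snc)
  have c: "has_bochner_integral lborel c (Xi t T - Xi t (- T))"
    unfolding c_def
  proof (rule has_bochner_integral_FTC_Icc)
    show "(Xi t has_vector_derivative snc (x / 2) * cos (x * t)) (at x within {-T..T})" for x
      using DERIV_Xi[of t x] by (auto simp: has_real_derivative_iff_has_vector_derivative intro: has_vector_derivative_at_within)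
  qed (use T in \<open>auto intro!: continuous_intros cont\<close>)
  have s: "integrable lborel s"
    unfolding s_def by (intro borel_integrable_compact continuous_intros cont compact_Icc)
  have "integral\<^sup>L lborel s = (\<integral>\<theta>. s (0 + (-1) * \<theta>) \<partial>lborel)"
    using lborel_integral_real_affine[of "-1" s 0] by simp
  also have "\<dots> = (\<integral>\<theta>. - s \<theta> \<partial>lborel)"
  proof (rule Bochner_Integration.integral_cong[OF refl])
    fix \<theta>
    show "s (0 + (-1) * \<theta>) = - s \<theta>" by (auto simp: s_def snc_def split: split_indicator)
  qed
  finally have s0: "integral\<^sup>L lborel s = 0" by simp
  have f: "?f = (\<lambda>\<theta>. of_real (c \<theta>) + \<i> * of_real (s \<theta>))"
    by (auto simp: c_def s_def fun_eq_iff exp_eq_polar complex_eq_iff)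
  show "integrable lborel ?f"
    unfolding f using c s by (auto simp: has_bochner_integral_iff)
  show "integral\<^sup>L lborel ?f = of_real (Xi t T - Xi t (- T))"
    unfolding f using c s s0 by (simp add: has_bochner_integral_iff)
qed

lemma Xi_bounded: "\<exists>B. \<forall>t \<theta>. \<bar>Xi t \<theta>\<bar> \<le> B"
proof -
  obtain B where "\<And>T. \<bar>Si T\<bar> \<le> B" using bounded_Si by blast
  then have "\<bar>Xi t \<theta>\<bar> \<le> B + B" for t \<theta> unfolding Xi_def by (intro order_trans[OF abs_triangle_ineq4] add_mono)
  then show ?thesis by blast
qed

text \<open>Each \<open>Si\<close> tends to pi / 2 times a sign, and the difference of the two signs
  is twice the indicator. At the two endpoints the limit would be pi, hence their exclusion.\<close>

lemma Xi_tendsto: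
  assumes "t \<noteq> 1/2" "t \<noteq> - (1/2)"
  shows "(\<lambda>n. Xi t (real n) - Xi t (- real n)) \<longlonglongrightarrow> 2 * pi * indicator {-1/2..<1/2} t"
proof -
  have pos: "(\<lambda>n. Si (real n * y)) \<longlonglongrightarrow> pi / 2" if "0 < y" for y
    by (rule filterlim_compose[OF Si_at_top])
       (auto intro!: filterlim_at_top_mult_tendsto_pos[OF tendsto_const that] filterlim_real_sequentially)
  have neg: "Si (- x) = - Si x" for x
    using Si_neg[of x] Si_neg[of "- x"] by (cases "0 \<le> x") auto
  have lim: "(\<lambda>n. Si (real n * y)) \<longlonglongrightarrow> sgn y * (pi / 2)" if "y \<noteq> 0" for y
  proof (cases "0 < y")
    case False
    then have "(\<lambda>n. - Si (real n * (- y))) \<longlonglongrightarrow> - (pi / 2)" using that by (intro tendsto_minus pos) auto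
    moreover have "- Si (real n * (- y)) = Si (real n * y)" for n using neg[of "real n * y"] by simp
    ultimately show ?thesis using False that by (simp add: sgn_if)
  qed (use pos in simp)
  have "Xi t (- x) = - Xi t x" for x
    unfolding Xi_def mult_minus_left neg by simp
  then have "(\<lambda>n. Xi t (real n) - Xi t (- real n)) = (\<lambda>n. 2 * (Si (real n * (t + 1/2)) - Si (real n * (t - 1/2))))"
    by (auto simp: Xi_def)
  moreover have "\<dots> \<longlonglongrightarrow> 2 * (sgn (t + 1/2) * (pi / 2) - sgn (t - 1/2) * (pi / 2))"
    by (intro tendsto_intros lim) (use assms in auto)
  moreover have "2 * (sgn (t + 1/2) * (pi / 2) - sgn (t - 1/2) * (pi / 2)) = 2 * pi * indicator {-1/2..<1/2} t"
    using assms by (auto simp: sgn_if split: split_indicator)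
  ultimately show ?thesis by simp
qed

section \<open>Fourier inversion for Gaussian cube probabilities\<close>

lemma product_sigma_finite_lborel: "product_sigma_finite (\<lambda>_::nat. lborel :: real measure)"
  by (rule product_sigma_finite.intro) (rule lborel.sigma_finite_measure_axioms)

lemma gauss_integral:
  fixes c :: real
  assumes c: "0 < c"
  shows "integrable (PiM {..<k} (\<lambda>_. lborel)) (\<lambda>\<theta>. exp (- c * (\<Sum>j<k. (\<theta> j)\<^sup>2)))"
    and "(\<integral>\<theta>. exp (- c * (\<Sum>j<k. (\<theta> j)\<^sup>2)) \<partial>(PiM {..<k} (\<lambda>_. lborel))) = sqrt (pi / c) ^ k"
proof -
  interpret product_sigma_finite "\<lambda>_::nat. lborel :: real measure" by (rule product_sigma_finite_lborel)
  define \<sigma> where "\<sigma> = 1 / sqrt (2 * c)"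
  have \<sigma>: "0 < \<sigma>" "\<sigma>\<^sup>2 = 1 / (2 * c)" using c by (simp_all add: \<sigma>_def power_divide)
  have pt: "exp (- c * x\<^sup>2) = sqrt (pi / c) * normal_density 0 \<sigma> x" for x
    using c by (simp add: normal_density_def \<sigma>(2) real_sqrt_divide)
  have i1: "integrable lborel (\<lambda>x. exp (- c * x\<^sup>2))" "(\<integral>x. exp (- c * x\<^sup>2) \<partial>lborel) = sqrt (pi / c)"
    unfolding pt using \<sigma>(1) by auto
  have eq: "exp (- c * (\<Sum>j<k. (\<theta> j)\<^sup>2)) = (\<Prod>j<k. exp (- c * (\<theta> j)\<^sup>2))" for \<theta> :: "nat \<Rightarrow> real"
    by (simp add: sum_distrib_left exp_sum sum_negf flip: sum_negf)
  show "integrable (PiM {..<k} (\<lambda>_. lborel)) (\<lambda>\<theta>. exp (- c * (\<Sum>j<k. (\<theta> j)\<^sup>2)))"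
    unfolding eq by (rule product_integrable_prod[OF finite_lessThan i1(1)])
  show "(\<integral>\<theta>. exp (- c * (\<Sum>j<k. (\<theta> j)\<^sup>2)) \<partial>(PiM {..<k} (\<lambda>_. lborel))) = sqrt (pi / c) ^ k"
    unfolding eq product_integral_prod[OF finite_lessThan i1(1)] i1(2) by simp
qed

lemma norm_exp_quadratic_form:
  fixes V :: "nat \<Rightarrow> nat \<Rightarrow> real" and \<theta> \<eta> :: "nat \<Rightarrow> real"
  shows "norm (exp (- (\<Sum>s<k. \<Sum>t<k. (of_real (\<theta> s) + \<i> * of_real (\<eta> s)) * (of_real (\<theta> t) + \<i> * of_real (\<eta> t)) * of_real (V s t)) / 2))
    = exp ((\<Sum>s<k. \<Sum>t<k. \<eta> s * \<eta> t * V s t) / 2) * exp (- (\<Sum>s<k. \<Sum>t<k. \<theta> s * \<theta> t * V s t) / 2)"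
proof -
  have "Re (\<Sum>s<k. \<Sum>t<k. (of_real (\<theta> s) + \<i> * of_real (\<eta> s)) * (of_real (\<theta> t) + \<i> * of_real (\<eta> t)) * of_real (V s t))
    = (\<Sum>s<k. \<Sum>t<k. \<theta> s * \<theta> t * V s t) - (\<Sum>s<k. \<Sum>t<k. \<eta> s * \<eta> t * V s t)"
    unfolding Re_sum sum_subtractf[symmetric] by (intro sum.cong refl) (simp add: algebra_simps)
  then show ?thesis
    by (simp add: norm_exp_eq_Re field_simps flip: exp_add)
qed

text \<open>Products of \<open>snc\<close> alone are not absolutely integrable, so frequencies are
  first truncated to [-T, T]^k, where Fubini applies. Then T tends to infinity on both sides by
  dominated convergence: \<open>Xi\<close> is uniformly bounded on the Gaussian side, and
  \<open>Q\<close> decays on the frequency side.\<close>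

lemma gaussian_inversion:
  fixes A V :: "nat \<Rightarrow> nat \<Rightarrow> real" and \<eta> y :: "nat \<Rightarrow> real" and L :: real
  assumes V: "\<And>i l. i < k \<Longrightarrow> l < k \<Longrightarrow> (\<Sum>j<k. A i j * A l j) = V i l"
    and L: "0 < L" and VL: "\<And>\<theta>. L * (\<Sum>j<k. (\<theta> j)\<^sup>2) \<le> (\<Sum>s<k. \<Sum>t<k. \<theta> s * \<theta> t * V s t)"
  defines "R \<equiv> \<lambda>t z. \<Sum>j<k. A t j * z j"
    and "Q \<equiv> \<lambda>\<theta>. exp (- (\<Sum>s<k. \<Sum>t<k. (of_real (\<theta> s) + \<i> * of_real (\<eta> s)) * (of_real (\<theta> t) + \<i> * of_real (\<eta> t)) * of_real (V s t)) / 2)"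
  shows "integrable (PiM {..<k} (\<lambda>_. lborel)) (\<lambda>\<theta>. Q \<theta> * (of_real (\<Prod>j<k. snc (\<theta> j / 2)) * exp (- (\<i> * of_real (\<Sum>j<k. \<theta> j * y j)))))"
    and "(\<integral>\<theta>. Q \<theta> * (of_real (\<Prod>j<k. snc (\<theta> j / 2)) * exp (- (\<i> * of_real (\<Sum>j<k. \<theta> j * y j)))) \<partial>(PiM {..<k} (\<lambda>_. lborel)))
      = of_real ((2 * pi) ^ k * (\<integral>z. exp (- (\<Sum>t<k. \<eta> t * R t z)) * (\<Prod>j<k. indicator {-1/2..<1/2} (R j z - y j)) \<partial>std_normal_vec k))"
    and "integrable (std_normal_vec k) (\<lambda>z. exp (- (\<Sum>t<k. \<eta> t * R t z)) * (\<Prod>j<k. indicator {-1/2..<1/2} (R j z - y j)))"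
proof -
  interpret lb: product_sigma_finite "\<lambda>_::nat. lborel :: real measure" by (rule product_sigma_finite_lborel)
  interpret N: prob_space "std_normal_vec k" by (rule prob_space_std_normal_vec)
  define M where "M = PiM {..<k} (\<lambda>_::nat. lborel :: real measure)"
  define N where "N = std_normal_vec k"
  interpret Mf: sigma_finite_measure M
    unfolding M_def by (rule lb.sigma_finite) simp
  interpret P: pair_sigma_finite N M
    unfolding N_def by (intro pair_sigma_finite.intro N.sigma_finite_measure_axioms Mf.sigma_finite_measure_axioms)
  have N_eq: "N = PiM {..<k} (\<lambda>_. SN)" by (simp only: N_def std_normal_vec_def)
  have [measurable]: "(\<lambda>z. z j) \<in> borel_measurable N" "(\<lambda>\<theta>. \<theta> j) \<in> borel_measurable M" if "j \<in> {..<k}" for j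
    using that unfolding N_eq M_def by measurable
  have mR[measurable]: "R t \<in> borel_measurable N" for t
    unfolding R_def by measurable
  have mQ[measurable]: "Q \<in> borel_measurable M" unfolding Q_def by measurable
  define e where "e \<theta> = exp (- (\<i> * of_real (\<Sum>j<k. \<theta> j * y j)))" for \<theta> :: "nat \<Rightarrow> real"
  have me[measurable]: "e \<in> borel_measurable M" unfolding e_def by measurable
  define h where "h T \<theta> = (\<Prod>j<k. indicator {-T..T} (\<theta> j) * snc (\<theta> j / 2))" for T and \<theta> :: "nat \<Rightarrow> real"
  have mh[measurable]: "h T \<in> borel_measurable M" for T unfolding h_def by measurable
  define g where "g z \<theta> = exp (\<i> * (\<Sum>t<k. (of_real (\<theta> t) + \<i> * of_real (\<eta> t)) * of_real (R t z)))" for z \<theta> :: "nat \<Rightarrow> real"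
  define J where "J T z \<theta> = g z \<theta> * (of_real (h T \<theta>) * e \<theta>)" for T z \<theta>
  define x where "x z = exp (- (\<Sum>t<k. \<eta> t * R t z))" for z
  have mx[measurable]: "x \<in> borel_measurable N" unfolding x_def by measurable
  have mg[measurable]: "(\<lambda>(z, \<theta>). g z \<theta>) \<in> borel_measurable (N \<Otimes>\<^sub>M M)"
    unfolding g_def by measurable
  have Dz: "integrable M (J T z)" "integral\<^sup>L M (J T z) = of_real (x z * (\<Prod>j<k. Xi (R j z - y j) T - Xi (R j z - y j) (- T)))"
    if T: "0 \<le> T" for T z
  proof -
    define f where "f j \<theta> = of_real (indicator {-T..T} \<theta> * snc (\<theta> / 2)) * exp (\<i> * of_real (\<theta> * (R j z - y j)))" for j and \<theta> :: real
    have f: "integrable lborel (f j)" "integral\<^sup>L lborel (f j) = of_real (Xi (R j z - y j) T - Xi (R j z - y j) (- T))" for j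
      unfolding f_def using dirichlet_integral[OF T, of "R j z - y j"] by auto
    have J: "J T z = (\<lambda>\<theta>. of_real (x z) * (\<Prod>j<k. f j (\<theta> j)))"
    proof
      fix \<theta>
      have "\<i> * (\<Sum>t<k. (of_real (\<theta> t) + \<i> * of_real (\<eta> t)) * of_real (R t z)) + - (\<i> * of_real (\<Sum>j<k. \<theta> j * y j))
        = of_real (- (\<Sum>t<k. \<eta> t * R t z)) + (\<Sum>j<k. \<i> * of_real (\<theta> j * (R j z - y j)))"
        unfolding of_real_sum sum_distrib_left of_real_minus sum_negf[symmetric] sum.distrib[symmetric]
        by (intro sum.cong refl) (simp add: algebra_simps)
      then have "g z \<theta> * e \<theta> = of_real (x z) * (\<Prod>j<k. exp (\<i> * of_real (\<theta> j * (R j z - y j))))"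
        unfolding g_def e_def x_def exp_add[symmetric] exp_of_real[symmetric] exp_sum[OF finite_lessThan, symmetric] by simp
      then show "J T z \<theta> = of_real (x z) * (\<Prod>j<k. f j (\<theta> j))"
      proof -
        assume ge: "g z \<theta> * e \<theta> = of_real (x z) * (\<Prod>j<k. exp (\<i> * of_real (\<theta> j * (R j z - y j))))"
        have f_prod: "(\<Prod>j<k. f j (\<theta> j)) = of_real (h T \<theta>) * (\<Prod>j<k. exp (\<i> * of_real (\<theta> j * (R j z - y j))))"
          unfolding f_def h_def of_real_prod by (rule prod.distrib)
        have "J T z \<theta> = (g z \<theta> * e \<theta>) * of_real (h T \<theta>)" unfolding J_def by (simp only: mult_ac)
        then show ?thesis unfolding ge f_prod by (simp only: mult_ac)
      qed
    qed
    show "integrable M (J T z)" unfolding J M_def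
      by (intro integrable_mult_right lb.product_integrable_prod f) simp
    show "integral\<^sup>L M (J T z) = of_real (x z * (\<Prod>j<k. Xi (R j z - y j) T - Xi (R j z - y j) (- T)))"
      unfolding J M_def integral_mult_right_zero
      by (subst lb.product_integral_prod) (simp_all add: f)
  qed
  have normJ: "norm (J T z \<theta>) = x z * \<bar>h T \<theta>\<bar>" for T z \<theta>
  proof -
    have "Re (\<i> * (\<Sum>t<k. (of_real (\<theta> t) + \<i> * of_real (\<eta> t)) * of_real (R t z))) = - (\<Sum>t<k. \<eta> t * R t z)"
      by simp
    then show ?thesis unfolding J_def norm_mult g_def e_def x_def norm_exp_eq_Re by simp
  qed
  have intx: "integrable N x"
  proof -
    have "integrable N (\<lambda>z. exp (\<i> * (\<Sum>t<k. (\<i> * of_real (\<eta> t)) * of_real (\<Sum>j<k. A t j * z j))))"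
      unfolding N_def by (rule normal_vec_char)
    then have "integrable N (\<lambda>z. norm (exp (\<i> * (\<Sum>t<k. (\<i> * of_real (\<eta> t)) * of_real (\<Sum>j<k. A t j * z j)))))"
      by (rule integrable_norm)
    then show ?thesis unfolding x_def R_def by (simp add: norm_exp_eq_Re)
  qed
  have gint: "integrable N (\<lambda>z. g z \<theta>)" "integral\<^sup>L N (\<lambda>z. g z \<theta>) = Q \<theta>" for \<theta>
  proof -
    show "integrable N (\<lambda>z. g z \<theta>)" unfolding g_def R_def N_def by (rule normal_vec_char)
    show "integral\<^sup>L N (\<lambda>z. g z \<theta>) = Q \<theta>"
      unfolding g_def R_def N_def normal_vec_char(2) Q_def using V by simp
  qed
  have Fub: "(\<integral>z. of_real (x z * (\<Prod>j<k. Xi (R j z - y j) T - Xi (R j z - y j) (- T))) \<partial>N)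
      = (\<integral>\<theta>. Q \<theta> * (of_real (h T \<theta>) * e \<theta>) \<partial>M)" if T: "0 \<le> T" for T
  proof -
    have "integrable (N \<Otimes>\<^sub>M M) (\<lambda>(z, \<theta>). J T z \<theta>)"
    proof (rule P.Fubini_integrable)
      show "(\<lambda>(z, \<theta>). J T z \<theta>) \<in> borel_measurable (N \<Otimes>\<^sub>M M)" unfolding J_def by measurable
      show "integrable N (\<lambda>z. \<integral>\<theta>. norm (case (z, \<theta>) of (z, \<theta>) \<Rightarrow> J T z \<theta>) \<partial>M)"
        using intx by (simp add: normJ)
      show "AE z in N. integrable M (\<lambda>\<theta>. case (z, \<theta>) of (z, \<theta>) \<Rightarrow> J T z \<theta>)"
        using Dz(1)[OF T] by simp
    qed
    then have *: "(\<integral>\<theta>. (\<integral>z. J T z \<theta> \<partial>N) \<partial>M) = (\<integral>z. (\<integral>\<theta>. J T z \<theta> \<partial>M) \<partial>N)"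
      by (rule P.Fubini_integral)
    have inner: "(\<integral>z. J T z \<theta> \<partial>N) = Q \<theta> * (of_real (h T \<theta>) * e \<theta>)" for \<theta>
      unfolding J_def integral_mult_left_zero gint(2) ..
    show ?thesis using *[symmetric] unfolding Dz(2)[OF T] inner .
  qed
  obtain B where B: "\<And>t \<theta>. \<bar>Xi t \<theta>\<bar> \<le> B" using Xi_bounded by blast
  have lim1: "(\<lambda>n. \<integral>z. of_real (x z * (\<Prod>j<k. Xi (R j z - y j) (real n) - Xi (R j z - y j) (- real n))) \<partial>N)
    \<longlonglongrightarrow> (\<integral>z. complex_of_real (x z * (\<Prod>j<k. 2 * pi * indicator {-1/2..<1/2} (R j z - y j))) \<partial>N)"
  proof (rule integral_dominated_convergence[where w="\<lambda>z. x z * (B + B) ^ k"])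
    show "integrable N (\<lambda>z. x z * (B + B) ^ k)" using intx by simp
    \<comment> \<open>Each coordinate has positive variance, so the cube faces are null and
      \<open>Xi_tendsto\<close> applies almost everywhere.\<close>
    have "AE z in N. R j z - y j \<noteq> 1/2 \<and> R j z - y j \<noteq> - (1/2)" if j: "j < k" for j
    proof -
      have "L * (\<Sum>l<k. (if l = j then 1 else 0 :: real)\<^sup>2) \<le> (\<Sum>s<k. \<Sum>t<k. (if s = j then 1 else 0) * (if t = j then 1 else 0) * V s t)"
        by (rule VL)
      moreover have "(\<Sum>l<k. (if l = j then 1 else 0 :: real)\<^sup>2) = (\<Sum>l<k. if l = j then 1 else 0)"
        by (intro sum.cong) auto
      moreover have "(\<Sum>s<k. \<Sum>t<k. (if s = j then 1 else 0) * (if t = j then 1 else 0) * V s t)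
          = (\<Sum>s<k. if s = j then V j j else 0)"
      proof (rule sum.cong[OF refl])
        fix s
        have "(\<Sum>t<k. (if t = j then 1 else 0) * V j t) = (\<Sum>t<k. if t = j then V j t else 0)"
          by (intro sum.cong) auto
        then have "(\<Sum>t<k. (if t = j then 1 else 0) * V j t) = V j j" using j by simp
        then show "(\<Sum>t<k. (if s = j then 1 else 0) * (if t = j then 1 else 0) * V s t) = (if s = j then V j j else 0)"
          by (cases "s = j") simp_all
      qed
      ultimately have "L \<le> V j j" using j by simp
      then have "(\<Sum>l<k. A j l * A j l) \<noteq> 0" using V[OF j j] L by simp
      then obtain l where l: "l < k" "A j l \<noteq> 0" by (auto elim: sum.not_neutral_contains_not_neutral)
      have "AE z in N. R j z \<noteq> y j + 1/2" "AE z in N. R j z \<noteq> y j - 1/2"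
        unfolding N_def R_def by (rule AE_normal_linear_neq[where A="A j", OF l])+
      then show ?thesis by eventually_elim auto
    qed
    then have "AE z in N. \<forall>j\<in>{..<k}. R j z - y j \<noteq> 1/2 \<and> R j z - y j \<noteq> - (1/2)"
      by (intro AE_finite_allI) auto
    then show "AE z in N. (\<lambda>n. of_real (x z * (\<Prod>j<k. Xi (R j z - y j) (real n) - Xi (R j z - y j) (- real n))))
      \<longlonglongrightarrow> complex_of_real (x z * (\<Prod>j<k. 2 * pi * indicator {-1/2..<1/2} (R j z - y j)))"
      by eventually_elim (intro tendsto_of_real tendsto_mult tendsto_const tendsto_prod Xi_tendsto, auto)
    have "norm (complex_of_real (x z * (\<Prod>j<k. Xi (R j z - y j) (real n) - Xi (R j z - y j) (- real n)))) \<le> x z * (B + B) ^ k" for n z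
    proof -
      have "(\<Prod>j<k. \<bar>Xi (R j z - y j) (real n) - Xi (R j z - y j) (- real n)\<bar>) \<le> (\<Prod>j<k. B + B)"
        by (intro prod_mono conjI abs_ge_zero order_trans[OF abs_triangle_ineq4] add_mono B)
      then show ?thesis unfolding norm_of_real abs_mult abs_prod by (simp add: x_def)
    qed
    then show "AE z in N. norm (complex_of_real (x z * (\<Prod>j<k. Xi (R j z - y j) (real n) - Xi (R j z - y j) (- real n)))) \<le> x z * (B + B) ^ k" for n
      by simp
    have [measurable]: "Xi t \<in> borel_measurable borel" "(\<lambda>t. Xi t T) \<in> borel_measurable borel" for t T
      unfolding Xi_def by measurable
    show "(\<lambda>z. complex_of_real (x z * (\<Prod>j<k. Xi (R j z - y j) (real n) - Xi (R j z - y j) (- real n)))) \<in> borel_measurable N" for n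
      by measurable
  qed measurable
  define h' where "h' \<theta> = (\<Prod>j<k. snc (\<theta> j / 2))" for \<theta> :: "nat \<Rightarrow> real"
  have mh'[measurable]: "h' \<in> borel_measurable M" unfolding h'_def by measurable
  define K where "K = exp ((\<Sum>s<k. \<Sum>t<k. \<eta> s * \<eta> t * V s t) / 2)"
  have intw: "integrable M (\<lambda>\<theta>. K * exp (- (L / 2) * (\<Sum>j<k. (\<theta> j)\<^sup>2)))"
    unfolding M_def using L by (intro integrable_mult_right gauss_integral) auto
  have normQ: "norm (Q \<theta>) \<le> K * exp (- (L / 2) * (\<Sum>j<k. (\<theta> j)\<^sup>2))" for \<theta>
    unfolding Q_def norm_exp_quadratic_form K_def using VL[of \<theta>] by (intro mult_left_mono) auto
  have h'1: "\<bar>h' \<theta>\<bar> \<le> 1" for \<theta> unfolding h'_def abs_prod by (intro prod_le_1) (auto simp: abs_snc_le_1)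
  have h1: "\<bar>h T \<theta>\<bar> \<le> 1" for T \<theta>
    unfolding h_def abs_prod by (intro prod_le_1) (auto simp: abs_mult abs_snc_le_1 split: split_indicator)
  have norme: "norm (e \<theta>) = 1" for \<theta> unfolding e_def norm_exp_eq_Re by simp
  have bnd: "norm (Q \<theta> * (of_real c * e \<theta>)) \<le> K * exp (- (L / 2) * (\<Sum>j<k. (\<theta> j)\<^sup>2))" if "\<bar>c\<bar> \<le> 1" for \<theta> c
  proof -
    have "norm (Q \<theta> * (of_real c * e \<theta>)) \<le> norm (Q \<theta>) * 1"
      unfolding norm_mult norme using that by (intro mult_left_mono) auto
    then show ?thesis using normQ[of \<theta>] by simp
  qed
  have lim2: "(\<lambda>n. \<integral>\<theta>. Q \<theta> * (of_real (h (real n) \<theta>) * e \<theta>) \<partial>M) \<longlonglongrightarrow> (\<integral>\<theta>. Q \<theta> * (of_real (h' \<theta>) * e \<theta>) \<partial>M)"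
  proof (rule integral_dominated_convergence[where w="\<lambda>\<theta>. K * exp (- (L / 2) * (\<Sum>j<k. (\<theta> j)\<^sup>2))"])
    show "integrable M (\<lambda>\<theta>. K * exp (- (L / 2) * (\<Sum>j<k. (\<theta> j)\<^sup>2)))" by (rule intw)
    show "AE \<theta> in M. (\<lambda>n. Q \<theta> * (of_real (h (real n) \<theta>) * e \<theta>)) \<longlonglongrightarrow> Q \<theta> * (of_real (h' \<theta>) * e \<theta>)"
    proof (rule AE_I2)
      fix \<theta> :: "nat \<Rightarrow> real"
      obtain n0 :: nat where n0: "(\<Sum>j<k. \<bar>\<theta> j\<bar>) \<le> real n0" using real_arch_simple[of "\<Sum>j<k. \<bar>\<theta> j\<bar>"] by (elim exE)
      have "h (real n) \<theta> = h' \<theta>" if "n0 \<le> n" for n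
      unfolding h_def h'_def
      proof (rule prod.cong[OF refl])
        fix j assume "j \<in> {..<k}"
        then have "\<bar>\<theta> j\<bar> \<le> (\<Sum>j<k. \<bar>\<theta> j\<bar>)" by (intro member_le_sum) auto
        then have "\<bar>\<theta> j\<bar> \<le> real n" using n0 that by linarith
        then show "indicator {-real n..real n} (\<theta> j) * snc (\<theta> j / 2) = snc (\<theta> j / 2)" by (auto simp: indicator_def)
      qed
      then have "\<forall>\<^sub>F n in sequentially. Q \<theta> * (of_real (h' \<theta>) * e \<theta>) = Q \<theta> * (of_real (h (real n) \<theta>) * e \<theta>)"
        by (intro eventually_sequentiallyI[of n0]) simp
      then show "(\<lambda>n. Q \<theta> * (of_real (h (real n) \<theta>) * e \<theta>)) \<longlonglongrightarrow> Q \<theta> * (of_real (h' \<theta>) * e \<theta>)"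
        by (rule Lim_transform_eventually[OF tendsto_const])
    qed
    show "AE \<theta> in M. norm (Q \<theta> * (of_real (h (real n) \<theta>) * e \<theta>)) \<le> K * exp (- (L / 2) * (\<Sum>j<k. (\<theta> j)\<^sup>2))" for n
      by (intro AE_I2 bnd h1)
  qed measurable
  have "(\<integral>\<theta>. Q \<theta> * (of_real (h' \<theta>) * e \<theta>) \<partial>M) = (\<integral>z. complex_of_real (x z * (\<Prod>j<k. 2 * pi * indicator {-1/2..<1/2} (R j z - y j))) \<partial>N)"
    using lim2 lim1 unfolding Fub[OF of_nat_0_le_iff] by (rule LIMSEQ_unique)
  also have "\<dots> = of_real (\<integral>z. (2 * pi) ^ k * (x z * (\<Prod>j<k. indicator {-1/2..<1/2} (R j z - y j))) \<partial>N)"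
    unfolding integral_complex_of_real[symmetric] prod.distrib by (simp add: mult_ac)
  finally show "(\<integral>\<theta>. Q \<theta> * (of_real (\<Prod>j<k. snc (\<theta> j / 2)) * exp (- (\<i> * of_real (\<Sum>j<k. \<theta> j * y j)))) \<partial>(PiM {..<k} (\<lambda>_. lborel)))
      = of_real ((2 * pi) ^ k * (\<integral>z. exp (- (\<Sum>t<k. \<eta> t * R t z)) * (\<Prod>j<k. indicator {-1/2..<1/2} (R j z - y j)) \<partial>std_normal_vec k))"
    unfolding h'_def e_def M_def N_def x_def by simp
  have "integrable M (\<lambda>\<theta>. Q \<theta> * (of_real (h' \<theta>) * e \<theta>))"
    by (rule Bochner_Integration.integrable_bound[OF intw]) (auto intro!: AE_I2 order_trans[OF bnd[OF h'1]])
  then show "integrable (PiM {..<k} (\<lambda>_. lborel)) (\<lambda>\<theta>. Q \<theta> * (of_real (\<Prod>j<k. snc (\<theta> j / 2)) * exp (- (\<i> * of_real (\<Sum>j<k. \<theta> j * y j)))))"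
    unfolding h'_def e_def M_def .
  have "integrable N (\<lambda>z. x z * (\<Prod>j<k. indicator {-1/2..<1/2} (R j z - y j)))"
  proof (rule Bochner_Integration.integrable_bound[OF intx])
    show "AE z in N. norm (x z * (\<Prod>j<k. indicator {-1/2..<1/2} (R j z - y j))) \<le> norm (x z)"
    proof (rule AE_I2)
      fix z
      have "(\<Prod>j<k. \<bar>indicator {-1/2..<1/2} (R j z - y j) :: real\<bar>) \<le> 1" by (intro prod_le_1) (auto split: split_indicator)
      then show "norm (x z * (\<Prod>j<k. indicator {-1/2..<1/2} (R j z - y j))) \<le> norm (x z)"
        unfolding real_norm_def abs_mult abs_prod by (simp add: mult_left_le)
    qed
  qed measurable
  then show "integrable (std_normal_vec k) (\<lambda>z. exp (- (\<Sum>t<k. \<eta> t * R t z)) * (\<Prod>j<k. indicator {-1/2..<1/2} (R j z - y j)))"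
    unfolding x_def N_def .
qed

section \<open>The pointwise and the total variation bound\<close>

context palette_deg
begin

abbreviation "dimW \<equiv> 2 * m - 1"

lemma sqrt_factor_Sigma:
  assumes N: "0 < N" and il: "i < dimW" "l < dimW"
  defines "V \<equiv> \<lambda>s t. N * Sigma_cov r m p s t"
  shows "(\<Sum>j<dimW. sqrt_factor dimW V i j * sqrt_factor dimW V l j) = V i l"
proof -
  have "\<exists>A. \<forall>i<dimW. \<forall>l<dimW. (\<Sum>j<dimW. A i j * A l j) = V i l"
  proof (rule cholesky)
    show "V i l = V l i" for i l unfolding V_def Sigma_sym[of i l] ..
    fix x :: "nat \<Rightarrow> real" assume "\<exists>i<dimW. x i \<noteq> 0"
    then obtain i where i: "i < dimW" "x i \<noteq> 0" by auto
    then have "0 < (x i)\<^sup>2" by simp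
    also have "\<dots> \<le> (\<Sum>t<dimW. (x t)\<^sup>2)" using i by (intro member_le_sum[of i "{..<dimW}" "\<lambda>t. (x t)\<^sup>2"]) auto
    finally have "0 < qf_gap * (\<Sum>t<dimW. (x t)\<^sup>2)" using qf_gap_pos by simp
    also have "\<dots> \<le> (\<Sum>s<dimW. \<Sum>t<dimW. x s * x t * Sigma_cov r m p s t)" by (rule Sigma_pos)
    finally have "0 < N * (\<Sum>s<dimW. \<Sum>t<dimW. x s * x t * Sigma_cov r m p s t)" using N by simp
    then show "0 < (\<Sum>i<dimW. \<Sum>l<dimW. x i * x l * V i l)" by (simp add: V_def sum_distrib_left mult_ac)
  qed
  then have "\<forall>i<dimW. \<forall>l<dimW. (\<Sum>j<dimW. sqrt_factor dimW V i j * sqrt_factor dimW V l j) = V i l"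
    unfolding sqrt_factor_def by (rule someI_ex)
  then show ?thesis using il by blast
qed

end

lemma discrete_normal_integral:
  fixes a :: "nat \<Rightarrow> real" and x :: "nat \<Rightarrow> int" and V :: "nat \<Rightarrow> nat \<Rightarrow> real" and k :: nat
  defines "R \<equiv> \<lambda>t z. \<Sum>j<k. sqrt_factor k V t j * z j"
  shows "discrete_normal k a V x = (\<integral>z. (\<Prod>j<k. indicator {-1/2..<1/2} (R j z - (x j - a j))) \<partial>std_normal_vec k)"
    and "{z \<in> space (std_normal_vec k). \<forall>j<k. R j z - (x j - a j) \<in> {-1/2..<1/2}} \<in> sets (std_normal_vec k)" (is "?S \<in> _")
    and "discrete_normal k a V x = measure (std_normal_vec k) {z \<in> space (std_normal_vec k). \<forall>j<k. R j z - (x j - a j) \<in> {-1/2..<1/2}}"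
proof -
  have [measurable]: "(\<lambda>z. z j) \<in> borel_measurable (std_normal_vec k)" if "j \<in> {..<k}" for j
    using that unfolding std_normal_vec_def by measurable
  have [measurable]: "R t \<in> borel_measurable (std_normal_vec k)" for t
    unfolding R_def by measurable
  show S: "?S \<in> sets (std_normal_vec k)" by measurable
  have "{z \<in> space (std_normal_vec k). \<forall>t<k. real_of_int (x t) - 1/2 \<le> (if t < k then a t + (\<Sum>j<k. sqrt_factor k V t j * z j) else 0)
      \<and> (if t < k then a t + (\<Sum>j<k. sqrt_factor k V t j * z j) else 0) < real_of_int (x t) + 1/2} = ?S"
    by (auto simp: R_def algebra_simps)
  then show 1: "discrete_normal k a V x = measure (std_normal_vec k) ?S"
    unfolding discrete_normal_def normal_prob_def by (rule arg_cong)
  have "measure (std_normal_vec k) ?S = (\<integral>z. indicator ?S z \<partial>std_normal_vec k)"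
    using S by simp
  also have "\<dots> = (\<integral>z. (\<Prod>j<k. indicator {-1/2..<1/2} (R j z - (x j - a j))) \<partial>std_normal_vec k)"
  proof (rule Bochner_Integration.integral_cong[OF refl])
    fix z assume "z \<in> space (std_normal_vec k)"
    then have eq: "z \<in> ?S \<longleftrightarrow> (\<forall>j<k. R j z - (x j - a j) \<in> {-1/2..<1/2})" by simp
    show "indicator ?S z = (\<Prod>j<k. indicator {-1/2..<1/2} (R j z - (x j - a j)) :: real)"
    proof (cases "z \<in> ?S")
      case True
      then have 1: "(\<Prod>j<k. indicator {-1/2..<1/2} (R j z - (x j - a j)) :: real) = 1"
        unfolding eq by (intro prod.neutral ballI indicator_simps(1)) blast
      show ?thesis unfolding 1 by (rule indicator_simps(1)[OF True])
    next
      case False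
      then obtain j where "j < k" "R j z - (x j - a j) \<notin> {-1/2..<1/2}" unfolding eq by blast
      then have 0: "(\<Prod>j<k. indicator {-1/2..<1/2} (R j z - (x j - a j)) :: real) = 0"
        by (intro prod_zero bexI[of _ j] indicator_simps(2)) auto
      show ?thesis unfolding 0 by (rule indicator_simps(2)[OF False])
    qed
  qed
  finally show "discrete_normal k a V x = (\<integral>z. (\<Prod>j<k. indicator {-1/2..<1/2} (R j z - (x j - a j))) \<partial>std_normal_vec k)"
    using 1 by simp
qed

text \<open>Distinct lattice points have disjoint half-open cubes.\<close>

lemma sum_discrete_normal_le_1:
  assumes "finite F" "F \<subseteq> lattice k"
  shows "(\<Sum>x\<in>F. discrete_normal k a V x) \<le> 1"
proof -
  interpret N: prob_space "std_normal_vec k" by (rule prob_space_std_normal_vec)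
  define S where "S x = {z \<in> space (std_normal_vec k). \<forall>j<k. (\<Sum>l<k. sqrt_factor k V j l * z l) - (x j - a j) \<in> {-1/2..<1/2}}"
    for x :: "nat \<Rightarrow> int"
  have meas: "S x \<in> sets (std_normal_vec k)" for x
    unfolding S_def by (rule discrete_normal_integral(2))
  have disj: "disjoint_family_on S F"
    unfolding disjoint_family_on_def
  proof (intro ballI impI)
    fix x x' assume x: "x \<in> F" "x' \<in> F" "x \<noteq> x'"
    show "S x \<inter> S x' = {}"
    proof (rule ccontr)
      assume "S x \<inter> S x' \<noteq> {}"
      then obtain z where z: "z \<in> S x" "z \<in> S x'" by blast
      have "x j = x' j" if j: "j < k" for j
      proof -
        have "\<bar>real_of_int (x j) - real_of_int (x' j)\<bar> < 1"
        proof -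
          let ?r = "\<Sum>l<k. sqrt_factor k V j l * z l"
          have "?r - (x j - a j) \<in> {-1/2..<1/2}" "?r - (x' j - a j) \<in> {-1/2..<1/2}"
            using z j unfolding S_def by blast+
          then show ?thesis unfolding atLeastLessThan_iff by linarith
        qed
        then show ?thesis by linarith
      qed
      moreover have "x j = x' j" if "\<not> j < k" for j
      proof -
        have "x \<in> lattice k" "x' \<in> lattice k" using x assms(2) by auto
        then show ?thesis using that by (simp add: lattice_def)
      qed
      ultimately show False using x(3) by (auto simp: fun_eq_iff)
    qed
  qed
  have "S ` F \<subseteq> sets (std_normal_vec k)" using meas by blast
  then have "(\<Sum>x\<in>F. measure (std_normal_vec k) (S x)) = measure (std_normal_vec k) (\<Union>x\<in>F. S x)"
    by (rule N.finite_measure_finite_Union[OF assms(1) _ disj, symmetric])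
  also have "\<dots> \<le> 1" by (rule N.prob_le_1)
  finally show ?thesis unfolding discrete_normal_integral(3) S_def .
qed

text \<open>Two geometric series with ratio exp (- t), one on each side of \<open>a\<close>, and 1 -
  exp (- t) >= t / 2 on (0, 1].\<close>

lemma sum_exp_int_le:
  fixes a t :: real
  assumes "finite G" and t: "0 < t" "t \<le> 1"
  shows "(\<Sum>i\<in>G. exp (- t * \<bar>of_int i - a\<bar>)) \<le> 4 / t"
proof -
  define q where "q = exp (- t)"
  have q: "0 < q" "q < 1" using t by (auto simp: q_def)
  have geo: "(\<Sum>j\<in>J. q ^ j) \<le> 2 / t" if "finite J" for J
  proof -
    have "(\<Sum>j\<in>J. q ^ j) \<le> (\<Sum>j. q ^ j)"
      using that q by (intro sum_le_suminf summable_geometric) auto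
    also have "\<dots> = 1 / (1 - q)" using q by (intro suminf_geometric) auto
    also have "\<dots> \<le> 2 / t"
    proof -
      have "1 + t \<le> exp t" by (rule exp_ge_add_one_self)
      then have "q \<le> 1 / (1 + t)" using t by (simp add: q_def exp_minus field_simps)
      also have "1 / (1 + t) \<le> 1 - t / 2"
        using t mult_left_mono[of t 1 t] by (simp add: field_simps)
      finally show ?thesis using t q by (simp add: field_simps)
    qed
    finally show ?thesis .
  qed
  have half: "(\<Sum>i\<in>H. exp (- t * \<bar>of_int i - a\<bar>)) \<le> 2 / t"
    if H: "finite H" and f: "inj_on f H" and le: "\<And>i. i \<in> H \<Longrightarrow> real (f i) \<le> \<bar>of_int i - a\<bar>" for H and f :: "int \<Rightarrow> nat"
  proof -
    have "(\<Sum>i\<in>H. exp (- t * \<bar>of_int i - a\<bar>)) \<le> (\<Sum>i\<in>H. q ^ f i)"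
      using le t by (intro sum_mono) (auto simp: q_def exp_of_nat_mult[symmetric] mult.commute)
    also have "\<dots> = (\<Sum>j\<in>f ` H. q ^ j)" using f by (simp add: sum.reindex)
    also have "\<dots> \<le> 2 / t" using H by (intro geo) auto
    finally show ?thesis .
  qed
  have "(\<Sum>i\<in>G. exp (- t * \<bar>of_int i - a\<bar>)) =
     (\<Sum>i\<in>{i\<in>G. \<lceil>a\<rceil> \<le> i}. exp (- t * \<bar>of_int i - a\<bar>)) + (\<Sum>i\<in>{i\<in>G. \<not> \<lceil>a\<rceil> \<le> i}. exp (- t * \<bar>of_int i - a\<bar>))"
    by (subst sum.union_disjoint[symmetric]) (use assms(1) in \<open>auto intro!: sum.cong\<close>)
  also have "(\<Sum>i\<in>{i\<in>G. \<lceil>a\<rceil> \<le> i}. exp (- t * \<bar>of_int i - a\<bar>)) \<le> 2 / t"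
    by (rule half[where f="\<lambda>i. nat (i - \<lceil>a\<rceil>)"]) (use assms(1) in \<open>auto simp: inj_on_def, linarith\<close>)
  \<comment> \<open>Left of \<open>a\<close> the exponent counts from \<lceil>a\<rceil> - 1, which
    lies below \<open>a\<close>; counting from \<lceil>a\<rceil> could exceed the distance.\<close>
  also have "(\<Sum>i\<in>{i\<in>G. \<not> \<lceil>a\<rceil> \<le> i}. exp (- t * \<bar>of_int i - a\<bar>)) \<le> 2 / t"
    by (rule half[where f="\<lambda>i. nat (\<lceil>a\<rceil> - 1 - i)"]) (use assms(1) in \<open>auto simp: inj_on_def, linarith\<close>)
  finally show ?thesis by simp
qed

text \<open>The exponential factorises over coordinates, and a finite \<open>F\<close> sits inside a
  finite grid, where the sum becomes a product of one-dimensional sums.\<close>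

lemma sum_lattice_exp_le:
  fixes a :: "nat \<Rightarrow> real"
  assumes F: "finite F" "F \<subseteq> lattice k" and t: "0 < t" "t \<le> 1"
  shows "(\<Sum>x\<in>F. exp (- t * (\<Sum>j<k. \<bar>of_int (x j) - a j\<bar>))) \<le> (4 / t) ^ k"
proof -
  define G where "G = (\<Union>j<k. (\<lambda>x. x j) ` F)"
  have G: "finite G" using F by (simp add: G_def)
  define g where "g j i = exp (- t * \<bar>of_int i - a j\<bar>)" for j and i :: int
  \<comment> \<open>Lattice points are 0 from \<open>k\<close> on while \<open>PiE\<close> demands
    \<open>undefined\<close> there, so they are transferred by restriction.\<close>
  have inj: "inj_on (\<lambda>x. restrict x {..<k}) F"
  proof (rule inj_onI)
    fix x x' assume x: "x \<in> F" "x' \<in> F" and eq: "restrict x {..<k} = restrict x' {..<k}"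
    show "x = x'"
    proof
      fix j
      show "x j = x' j"
      proof (cases "j < k")
        case True then show ?thesis using fun_cong[OF eq, of j] by simp
      next
        case False
        have "x \<in> lattice k" "x' \<in> lattice k" using x F(2) by auto
        then show ?thesis using False by (simp add: lattice_def)
      qed
    qed
  qed
  have "(\<Sum>x\<in>F. exp (- t * (\<Sum>j<k. \<bar>of_int (x j) - a j\<bar>))) = (\<Sum>x\<in>F. \<Prod>j<k. g j (restrict x {..<k} j))"
    by (intro sum.cong refl) (simp add: g_def sum_distrib_left exp_sum[symmetric])
  also have "\<dots> = (\<Sum>x\<in>(\<lambda>x. restrict x {..<k}) ` F. \<Prod>j<k. g j (x j))"
    using inj by (simp add: sum.reindex)
  also have "\<dots> \<le> (\<Sum>x\<in>PiE {..<k} (\<lambda>_. G). \<Prod>j<k. g j (x j))"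
    using G F by (intro sum_mono2 finite_PiE) (auto simp: G_def g_def intro!: prod_nonneg split: if_splits)
  also have "\<dots> = (\<Prod>j<k. \<Sum>i\<in>G. g j i)"
    by (rule prod_sum_PiE[symmetric]) (use G in auto)
  also have "\<dots> \<le> (\<Prod>j<k. 4 / t)"
    unfolding g_def using sum_exp_int_le[OF G t] by (intro prod_mono) (auto intro!: sum_nonneg)
  finally show ?thesis by simp
qed

lemma abs_one_minus_prod_snc_le:
  fixes \<theta> :: "nat \<Rightarrow> real" and k :: nat
  shows "\<bar>1 - (\<Prod>j<k. snc (\<theta> j / 2))\<bar> \<le> (\<Sum>j<k. \<bar>\<theta> j\<bar>)"
proof (induction k)
  case (Suc k)
  define P where "P = (\<Prod>j<k. snc (\<theta> j / 2))"
  have "1 - P * snc (\<theta> k / 2) = (1 - P) * snc (\<theta> k / 2) + (1 - snc (\<theta> k / 2))"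
    by (simp add: algebra_simps)
  then have "\<bar>1 - P * snc (\<theta> k / 2)\<bar> \<le> \<bar>1 - P\<bar> * \<bar>snc (\<theta> k / 2)\<bar> + \<bar>1 - snc (\<theta> k / 2)\<bar>"
    by (metis abs_mult abs_triangle_ineq)
  also have "\<dots> \<le> (\<Sum>j<k. \<bar>\<theta> j\<bar>) * 1 + \<bar>\<theta> k / 2\<bar>"
    using Suc.IH by (intro add_mono mult_mono abs_snc_le_1 abs_one_minus_snc_le) (auto simp: P_def sum_nonneg)
  finally show ?case by (simp add: P_def)
qed simp

text \<open>Everything is reduced to finite subsets; \<open>P\<close> is summable because P <= Q +
  |P - Q|.\<close>

lemma dTV_le:
  assumes P: "\<And>x. 0 \<le> P x" and Q: "\<And>x. 0 \<le> Q x"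
    and QF: "\<And>F. finite F \<Longrightarrow> F \<subseteq> lattice k \<Longrightarrow> (\<Sum>x\<in>F. Q x) \<le> 1"
    and PQ: "\<And>F. finite F \<Longrightarrow> F \<subseteq> lattice k \<Longrightarrow> (\<Sum>x\<in>F. \<bar>P x - Q x\<bar>) \<le> B"
  shows "dTV k P Q \<le> B"
  unfolding dTV_def
proof (rule cSUP_least)
  fix A assume "A \<in> Pow (lattice k)"
  then have A: "A \<subseteq> lattice k" by simp
  have Qs: "Q summable_on A"
    using Q QF A by (intro nonneg_bdd_above_summable_on) (auto intro!: bdd_aboveI[where M=1])
  have Ps: "P summable_on A"
  proof (rule nonneg_bdd_above_summable_on)
    show "bdd_above (sum P ` {F. F \<subseteq> A \<and> finite F})"
    proof (rule bdd_aboveI[where M="1 + B"], clarify)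
      fix F assume F: "F \<subseteq> A" "finite F"
      have "sum P F \<le> (\<Sum>x\<in>F. Q x + \<bar>P x - Q x\<bar>)" by (intro sum_mono) auto
      also have "\<dots> \<le> 1 + B" unfolding sum.distrib using F A by (intro add_mono QF PQ) auto
      finally show "sum P F \<le> 1 + B" .
    qed
  qed (use P in auto)
  have abs: "(\<lambda>x. \<bar>P x - Q x\<bar>) summable_on A"
    using PQ A by (intro nonneg_bdd_above_summable_on) (auto intro!: bdd_aboveI[where M=B])
  have "infsum P A - infsum Q A = (\<Sum>\<^sub>\<infinity>x\<in>A. P x - Q x)"
    using infsum_add[OF Ps, of "\<lambda>x. - Q x"] Qs by (simp add: infsum_uminus summable_on_uminus)
  also have "\<bar>\<dots>\<bar> \<le> (\<Sum>\<^sub>\<infinity>x\<in>A. \<bar>P x - Q x\<bar>)"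
    using norm_infsum_bound[of "\<lambda>x. P x - Q x" A] abs by simp
  also have "\<dots> \<le> B"
    using abs PQ A by (intro infsum_le_finite_sums) auto
  finally show "\<bar>infsum P A - infsum Q A\<bar> \<le> B" .
qed auto

section \<open>Comparison of the tilted Fourier integrands and summation over the lattice\<close>

context colour_graph
begin

text \<open>One rate for both characteristic functions: at most the decay rate of W, and at most
  half of \<open>qf_gap\<close> as \<open>gauss_compare\<close> demands.\<close>

definition gauss_rate :: real where "gauss_rate = min decay_rate (qf_gap / 2)"

lemma gauss_rate_pos: "0 < gauss_rate"
  using qf_gap_pos pm_pos m_ge by (simp add: gauss_rate_def decay_rate_def)

text \<open>Normalised so that \<open>n * (4 * (1 + r) * tilt)\<^sup>2\<close> equals 1, the limit
  allowed by \<open>char_decay\<close>.\<close>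

definition tilt :: real where "tilt = 1 / (4 * (1 + r) * sqrt n)"

lemma tilt_bounds:
  assumes n: "1 \<le> n"
  shows "0 < tilt" "4 * (1 + r) * tilt = 1 / sqrt n" "tilt \<le> 1" "sqrt n * tilt \<le> 1" "tilt \<le> 1 / sqrt n"
proof -
  have n0: "0 < sqrt n" "1 \<le> sqrt n" using n by auto
  show 1: "0 < tilt" using n0 by (simp add: tilt_def)
  show 2: "4 * (1 + r) * tilt = 1 / sqrt n" by (simp add: tilt_def)
  have "1 * tilt \<le> 4 * (1 + r) * tilt" using 1 by (intro mult_right_mono) auto
  then show 3: "tilt \<le> 1 / sqrt n" using 2 by simp
  also have "\<dots> \<le> 1" using n0 by simp
  finally show "tilt \<le> 1" .
  show "sqrt n * tilt \<le> 1" using 3 n0 by (simp add: field_simps)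
qed

text \<open>The prefactor of \<open>gauss_compare\<close> on the box, where \<tau> <= 4 dimW + 1
  because pi < 4 and \<open>tilt\<close> is at most 1. The factor exp 1 covers the loss from the
  imaginary parts.\<close>

definition char_const :: real where "char_const = 4 * stein_const ^ 3 * exp (2 * stein_const * (4 * dimW + 1)) * decay_const * exp 1"

text \<open>The 6 stems from u^3 <= 6 exp u, the last factor from completing the square in
  \<open>integrand_bound\<close>.\<close>

definition integrand_const :: real where "integrand_const = (6 * char_const + exp 1) * exp (1 + dimW\<^sup>2 / (2 * gauss_rate))"

lemma decay_const_pos: "0 < decay_const" by (simp add: decay_const_def)

lemma char_const_nonneg: "0 \<le> char_const" using decay_const_pos by (simp add: char_const_def)

context
  fixes \<eta> :: "nat \<Rightarrow> real"
  assumes n: "1 \<le> n" and \<eta>: "\<And>t. \<bar>\<eta> t\<bar> \<le> tilt"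
begin

definition zeta :: "(nat \<Rightarrow> real) \<Rightarrow> nat \<Rightarrow> complex" where
  "zeta \<theta> t = of_real (\<theta> t) + \<i> * of_real (\<eta> t)"

text \<open>The characteristic function of the centred W at a complex frequency. With
  \<open>undefined\<close> as base colouring, the overridden colourings are the extensional
  functions that form \<open>colourings\<close>.\<close>

definition Psi :: "(nat \<Rightarrow> real) \<Rightarrow> complex" where
  "Psi \<theta> = EE {..<n} (\<lambda>c. exp (\<i> * Zt (aof (zeta \<theta>)) (bof (zeta \<theta>)) c)) (\<lambda>_. undefined)"

definition QQ :: "(nat \<Rightarrow> real) \<Rightarrow> complex" where
  "QQ \<theta> = exp (- (\<Sum>s<dimW. \<Sum>t<dimW. (of_real (\<theta> s) + \<i> * of_real (\<eta> s)) * (of_real (\<theta> t) + \<i> * of_real (\<eta> t))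
      * of_real (real n * Sigma_cov r m p s t)) / 2)"

lemma QQ_qf: "QQ \<theta> = exp (- (of_nat n * qf (aof (zeta \<theta>)) (bof (zeta \<theta>)) / 2))"
proof -
  have "(\<Sum>s<dimW. \<Sum>t<dimW. zeta \<theta> s * zeta \<theta> t * of_real (real n * Sigma_cov r m p s t)) = of_nat n * qf (aof (zeta \<theta>)) (bof (zeta \<theta>))"
    unfolding Sigma_quadratic_form[symmetric] by (simp add: sum_distrib_left mult_ac)
  then show ?thesis unfolding QQ_def zeta_def by simp
qed

lemma n_qf_eta_le: "n * (6 * ((1 + r) * tilt)\<^sup>2) \<le> 1"
proof -
  have "real (4 * (1 + r)) * tilt = 4 * ((1 + r) * tilt)" by simp
  then have "n * (6 * ((1 + r) * tilt)\<^sup>2) = 6 / 16 * (n * (4 * (1 + r) * tilt)\<^sup>2)"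
    by (simp only: power_mult_distrib[of 4]) simp
  also have "n * (4 * (1 + r) * tilt)\<^sup>2 = 1" unfolding tilt_bounds(2)[OF n] using n by (simp add: power_divide)
  finally show ?thesis by simp
qed

lemma norm_QQ_le: "norm (QQ \<theta>) \<le> exp 1 * exp (- gauss_rate * n * (\<Sum>j<dimW. (\<theta> j)\<^sup>2))"
proof -
  have S: "(\<Sum>s<dimW. \<Sum>t<dimW. z s * z t * (real n * Sigma_cov r m p s t)) = n * (\<Sum>s<dimW. \<Sum>t<dimW. z s * z t * Sigma_cov r m p s t)" for z
    by (simp add: sum_distrib_left mult_ac)
  have "(\<Sum>s<dimW. \<Sum>t<dimW. \<eta> s * \<eta> t * Sigma_cov r m p s t) = qf (aof \<eta>) (bof \<eta>)"
    using Sigma_quadratic_form[of \<eta>] by simp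
  also have "\<dots> \<le> 6 * ((1 + r) * tilt)\<^sup>2"
    using \<eta> tilt_bounds(1)[OF n] by (intro qf_upper) (auto simp: aof_def bof_def)
  finally have "n * (\<Sum>s<dimW. \<Sum>t<dimW. \<eta> s * \<eta> t * Sigma_cov r m p s t) \<le> n * (6 * ((1 + r) * tilt)\<^sup>2)"
    by (intro mult_left_mono) auto
  then have 1: "n * (\<Sum>s<dimW. \<Sum>t<dimW. \<eta> s * \<eta> t * Sigma_cov r m p s t) / 2 \<le> 1" using n_qf_eta_le by linarith
  have T0: "0 \<le> n * (\<Sum>j<dimW. (\<theta> j)\<^sup>2)" by (simp add: sum_nonneg)
  have "gauss_rate * (n * (\<Sum>j<dimW. (\<theta> j)\<^sup>2)) \<le> qf_gap / 2 * (n * (\<Sum>j<dimW. (\<theta> j)\<^sup>2))"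
    using T0 by (intro mult_right_mono) (auto simp: gauss_rate_def)
  also have "\<dots> = n * (qf_gap * (\<Sum>j<dimW. (\<theta> j)\<^sup>2)) / 2" by simp
  also have "\<dots> \<le> n * (\<Sum>s<dimW. \<Sum>t<dimW. \<theta> s * \<theta> t * Sigma_cov r m p s t) / 2"
    using Sigma_pos[of \<theta>] by (intro divide_right_mono mult_left_mono) auto
  finally have 2: "gauss_rate * n * (\<Sum>j<dimW. (\<theta> j)\<^sup>2) \<le> n * (\<Sum>s<dimW. \<Sum>t<dimW. \<theta> s * \<theta> t * Sigma_cov r m p s t) / 2"
    by (simp only: mult.assoc)
  show ?thesis
    unfolding QQ_def norm_exp_quadratic_form S using 1 2 by (intro mult_mono) auto
qed

lemma Psi_compare:
  assumes box: "\<And>j. j < dimW \<Longrightarrow> \<bar>\<theta> j\<bar> \<le> pi"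
  shows "norm (Psi \<theta> - QQ \<theta>) \<le> char_const * n * ((\<Sum>j<dimW. \<bar>\<theta> j\<bar>) + tilt) ^ 3 * exp (- gauss_rate * n * (\<Sum>j<dimW. (\<theta> j)\<^sup>2))"
proof -
  let ?a = "aof (zeta \<theta>)" and ?b = "bof (zeta \<theta>)"
  define \<tau> where "\<tau> = (\<Sum>j<dimW. \<bar>\<theta> j\<bar>) + tilt"
  define T where "T = (\<Sum>j<dimW. (\<theta> j)\<^sup>2)"
  define \<omega> where "\<omega> = 6 * ((1 + r) * tilt)\<^sup>2"
  have tilt: "0 < tilt" by (rule tilt_bounds[OF n])
  have \<tau>0: "0 \<le> \<tau>" using tilt by (simp add: \<tau>_def sum_nonneg)
  have aR: "Re (?a i) = aof \<theta> i" "Im (?a i) = aof \<eta> i" "Re (?b i) = bof \<theta> i" "Im (?b i) = bof \<eta> i" for i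
    by (simp_all add: aof_def bof_def zeta_def)
  have idx: "i < m \<Longrightarrow> i < dimW" "i < m - 1 \<Longrightarrow> m + i < dimW" for i using m_ge by auto
  have nz: "norm (zeta \<theta> t) \<le> \<tau>" if "t < dimW" for t
  proof -
    have "norm (zeta \<theta> t) \<le> \<bar>\<theta> t\<bar> + \<bar>\<eta> t\<bar>"
      unfolding zeta_def by (rule order_trans[OF norm_triangle_ineq]) (simp add: norm_mult)
    also have "\<bar>\<theta> t\<bar> \<le> (\<Sum>j<dimW. \<bar>\<theta> j\<bar>)" using that by (intro member_le_sum) auto
    finally show ?thesis using \<eta>[of t] by (simp add: \<tau>_def)
  qed
  have na: "norm (?a i) \<le> \<tau>" and nb: "norm (?b i) \<le> \<tau>" for i
    using nz idx \<tau>0 by (auto simp: aof_def bof_def)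
  have T: "(\<Sum>i<m. (Re (?a i))\<^sup>2) + (\<Sum>i<m-1. (Re (?b i))\<^sup>2) = T"
    unfolding aR T_def by (rule aof_bof_norm)
  have T0: "0 \<le> T" by (simp add: T_def sum_nonneg)
  have "norm (EE {..<n} (\<lambda>c. exp (\<i> * Zt ?a ?b c)) (\<lambda>_. undefined) - exp (- (of_nat n * qf ?a ?b / 2)))
    \<le> n * (4 * (stein_const * \<tau>) ^ 3 * exp (2 * (stein_const * \<tau>)) * decay_const) * exp (n * \<omega> / 2) * exp (- gauss_rate * n * T)"
  proof (rule gauss_compare[where la=qf_gap])
    show "norm (?a i) \<le> \<tau>" "norm (?b i) \<le> \<tau>" for i by (rule na nb)+
    show "?a i = 0" "?b i = 0" if "i \<ge> m" for i using that by (simp_all add: aof_def bof_def)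
    fix s :: real and B :: "nat set" and L :: "(nat \<Rightarrow> nat) \<Rightarrow> complex" and M :: real
    assume s: "0 \<le> s" "s \<le> 1" and B: "B \<subseteq> {..<n}" "card B \<le> (r + 1) ^ 5" and L: "depends_on B L" "\<And>c. norm (L c) \<le> M"
    have M0: "0 \<le> M" using order_trans[OF norm_ge_zero L(2)] by blast
    have "norm (EE {..<n} (\<lambda>c. L c * exp (\<i> * of_real s * Zt ?a ?b c)) (\<lambda>_. undefined))
      \<le> M * (decay_const * exp (- decay_rate * n * s\<^sup>2 * ((\<Sum>i<m. (Re (?a i))\<^sup>2) + (\<Sum>i<m-1. (Re (?b i))\<^sup>2))))"
    proof (rule char_decay[OF s _ _ _ _ _ _ _ B L])
      show "\<bar>Im (?a i)\<bar> \<le> tilt" "\<bar>Im (?b i)\<bar> \<le> tilt" for i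
        unfolding aR using \<eta> tilt by (auto simp: aof_def bof_def)
      show "4 * (1 + r) * tilt \<le> 1" unfolding tilt_bounds(2)[OF n] using n by simp
      show "n * (4 * (1 + r) * tilt)\<^sup>2 \<le> 1" unfolding tilt_bounds(2)[OF n] using n by (simp add: power_divide)
      show "\<bar>Re (?a i)\<bar> \<le> pi" "\<bar>Re (?b i)\<bar> \<le> pi" for i
        unfolding aR using box idx by (auto simp: aof_def bof_def)
      show "?b (m - 1) = 0" by (simp add: bof_def)
    qed
    also have "\<dots> \<le> M * (decay_const * exp (- gauss_rate * n * s\<^sup>2 * T))"
    proof (intro mult_left_mono M0)
      have "gauss_rate * (n * s\<^sup>2 * T) \<le> decay_rate * (n * s\<^sup>2 * T)" using T0 by (intro mult_right_mono) (auto simp: gauss_rate_def)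
      then show "exp (- decay_rate * n * s\<^sup>2 * ((\<Sum>i<m. (Re (?a i))\<^sup>2) + (\<Sum>i<m-1. (Re (?b i))\<^sup>2))) \<le> exp (- gauss_rate * n * s\<^sup>2 * T)"
        unfolding T by (simp add: mult.assoc)
    qed (use decay_const_pos in simp)
    finally show "norm (EE {..<n} (\<lambda>c. L c * exp (\<i> * of_real s * Zt ?a ?b c)) (\<lambda>_. undefined)) \<le> M * (decay_const * exp (- gauss_rate * n * s\<^sup>2 * T))" .
  next
    have "qf_gap * T \<le> qf (aof \<theta>) (bof \<theta>)" unfolding T_def aof_bof_norm[symmetric] by (rule qf_lower) (simp add: bof_def)
    moreover have "qf (aof \<eta>) (bof \<eta>) \<le> \<omega>"
      unfolding \<omega>_def using \<eta> tilt by (intro qf_upper) (auto simp: aof_def bof_def)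
    ultimately show "qf_gap * T - \<omega> \<le> Re (qf ?a ?b)" unfolding Re_qf aR by simp
    show "gauss_rate \<le> qf_gap / 2" by (simp add: gauss_rate_def)
    show "0 \<le> \<omega>" by (simp add: \<omega>_def)
  qed (use T0 decay_const_pos in auto)
  also have "\<dots> \<le> char_const * n * \<tau> ^ 3 * exp (- gauss_rate * n * T)"
  proof (rule mult_right_mono)
    have "(\<Sum>j<dimW. \<bar>\<theta> j\<bar>) \<le> (\<Sum>j<dimW. 4)"
      using box pi_less_4 by (intro sum_mono) force
    then have "\<tau> \<le> 4 * dimW + 1" unfolding \<tau>_def using tilt_bounds(3)[OF n] by simp
    then have "stein_const * \<tau> \<le> stein_const * real (4 * dimW + 1)" by (intro mult_left_mono of_nat_0_le_iff)
    then have "2 * (stein_const * \<tau>) \<le> 2 * stein_const * (4 * dimW + 1)" by linarith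
    then have "exp (2 * (stein_const * \<tau>)) \<le> exp (2 * stein_const * (4 * dimW + 1))" by simp
    moreover have "exp (n * \<omega> / 2) \<le> exp 1" using n_qf_eta_le unfolding \<omega>_def by simp
    ultimately have "n * (4 * (stein_const * \<tau>) ^ 3 * exp (2 * (stein_const * \<tau>)) * decay_const) * exp (n * \<omega> / 2)
      \<le> n * (4 * (stein_const * \<tau>) ^ 3 * exp (2 * stein_const * (4 * dimW + 1)) * decay_const) * exp 1"
    proof -
      have gen: "0 \<le> N \<Longrightarrow> 0 \<le> c \<Longrightarrow> 0 \<le> A \<Longrightarrow> 0 \<le> X \<Longrightarrow> X \<le> Y \<Longrightarrow> 0 \<le> Z \<Longrightarrow> Z \<le> W \<Longrightarrow>
          N * (c * X * A) * Z \<le> N * (c * Y * A) * W" for N c A X Y Z W :: real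
        by (intro mult_mono mult_left_mono mult_right_mono mult_nonneg_nonneg) auto
      assume "exp (2 * (stein_const * \<tau>)) \<le> exp (2 * stein_const * (4 * dimW + 1))" "exp (n * \<omega> / 2) \<le> exp 1"
      then show ?thesis
        by (intro gen) (use decay_const_pos \<tau>0 in \<open>auto intro!: mult_nonneg_nonneg zero_le_power\<close>)
    qed
    also have "\<dots> = char_const * n * \<tau> ^ 3" by (simp only: char_const_def power_mult_distrib mult_ac)
    finally show "n * (4 * (stein_const * \<tau>) ^ 3 * exp (2 * (stein_const * \<tau>)) * decay_const) * exp (n * \<omega> / 2) \<le> char_const * n * \<tau> ^ 3" .
  qed simp
  finally show ?thesis unfolding Psi_def QQ_qf \<tau>_def T_def .
qed

text \<open>Inside the box the error is that of \<open>Psi_compare\<close> plus the deviation of the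
  \<open>snc\<close> product from 1, which is O(\<tau>). Outside only the Gaussian is left, and
  since \<tau> >= 1 there it obeys the same bound.\<close>

lemma integrand_bound:
  "norm (of_real (\<Prod>j<dimW. indicator {-pi..pi} (\<theta> j)) * Psi \<theta> - QQ \<theta> * of_real (\<Prod>j<dimW. snc (\<theta> j / 2)))
    \<le> integrand_const / sqrt n * exp (- (gauss_rate * n / 2) * (\<Sum>j<dimW. (\<theta> j)\<^sup>2))"
proof -
  define \<tau> where "\<tau> = (\<Sum>j<dimW. \<bar>\<theta> j\<bar>) + tilt"
  define T where "T = (\<Sum>j<dimW. (\<theta> j)\<^sup>2)"
  define P where "P = (\<Prod>j<dimW. snc (\<theta> j / 2))"
  have T0: "0 \<le> T" by (simp add: T_def sum_nonneg)
  have tilt: "0 < tilt" by (rule tilt_bounds[OF n])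
  have \<tau>0: "0 \<le> \<tau>" using tilt by (simp add: \<tau>_def sum_nonneg)
  have n0: "0 < sqrt n" using n by simp
  let ?e = "exp (- gauss_rate * n * T)"
  have Q: "norm (QQ \<theta>) \<le> exp 1 * ?e" unfolding T_def by (rule norm_QQ_le)
  have main: "norm (of_real (\<Prod>j<dimW. indicator {-pi..pi} (\<theta> j)) * Psi \<theta> - QQ \<theta> * of_real P) \<le> (char_const * n * \<tau> ^ 3 + exp 1 * \<tau>) * ?e"
  proof (cases "\<forall>j<dimW. \<bar>\<theta> j\<bar> \<le> pi")
    case True
    then have ind: "(\<Prod>j<dimW. indicator {-pi..pi} (\<theta> j)) = (1::real)"
      by (intro prod.neutral) (auto simp: abs_le_iff)
    have "norm (1 - of_real P :: complex) = \<bar>1 - P\<bar>" by (metis norm_of_real of_real_1 of_real_diff)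
    also have "\<dots> \<le> \<tau>" using abs_one_minus_prod_snc_le[of \<theta> dimW] tilt by (simp add: P_def \<tau>_def)
    finally have 1: "norm (1 - of_real P :: complex) \<le> \<tau>" .
    have "Psi \<theta> - QQ \<theta> * of_real P = (Psi \<theta> - QQ \<theta>) + QQ \<theta> * (1 - of_real P)" by (simp add: algebra_simps)
    then have "norm (Psi \<theta> - QQ \<theta> * of_real P) \<le> norm (Psi \<theta> - QQ \<theta>) + norm (QQ \<theta>) * norm (1 - of_real P :: complex)"
      by (metis norm_mult norm_triangle_ineq)
    also have "\<dots> \<le> char_const * n * \<tau> ^ 3 * ?e + (exp 1 * ?e) * \<tau>"
      using True Q 1 unfolding \<tau>_def T_def by (intro add_mono mult_mono Psi_compare) auto
    finally show ?thesis unfolding ind by (simp add: algebra_simps)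
  next
    case False
    then obtain j where j: "j < dimW" "\<not> \<bar>\<theta> j\<bar> \<le> pi" by auto
    then have ind: "(\<Prod>j<dimW. indicator {-pi..pi} (\<theta> j)) = (0::real)"
      by (intro prod_zero) (auto simp: abs_le_iff intro!: bexI[of _ j])
    have "1 \<le> \<bar>\<theta> j\<bar>" using j(2) pi_ge_two by linarith
    also have "\<dots> \<le> (\<Sum>j<dimW. \<bar>\<theta> j\<bar>)" using j by (intro member_le_sum) auto
    finally have \<tau>1: "1 \<le> \<tau>" using tilt by (simp add: \<tau>_def)
    have P1: "\<bar>P\<bar> \<le> 1" unfolding P_def abs_prod by (intro prod_le_1) (auto simp: abs_snc_le_1)
    have "norm (QQ \<theta> * of_real P) \<le> (exp 1 * ?e) * 1"
      unfolding norm_mult norm_of_real by (intro mult_mono Q P1) auto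
    also have "\<dots> \<le> (exp 1 * ?e) * \<tau>" using \<tau>1 by (intro mult_left_mono) auto
    also have "\<dots> \<le> (char_const * n * \<tau> ^ 3 + exp 1 * \<tau>) * ?e"
      using char_const_nonneg \<tau>0 by (simp add: algebra_simps)
    finally show ?thesis unfolding ind by simp
  qed
  \<comment> \<open>On the scale u = sqrt n \<tau>, both n \<tau>^3 and \<tau> are n^(-1/2) times a
    power of u, which half of the Gaussian exponent absorbs.\<close>
  define u where "u = sqrt n * \<tau>"
  have u0: "0 \<le> u" using \<tau>0 by (simp add: u_def)
  have \<tau>u: "\<tau> = u / sqrt n" using n0 by (simp add: u_def)
  have "n * \<tau> ^ 3 = u ^ 3 / sqrt n"
  proof -
    have "real n = sqrt n * sqrt n" by simp
    then show ?thesis unfolding \<tau>u using n0 by (simp add: power3_eq_cube field_simps)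
  qed
  then have "char_const * n * \<tau> ^ 3 + exp 1 * \<tau> = (char_const * u ^ 3 + exp 1 * u) / sqrt n"
    using \<tau>u by (simp add: add_divide_distrib mult.assoc)
  also have "\<dots> \<le> (char_const * (6 * exp u) + exp 1 * exp u) / sqrt n"
  proof (intro divide_right_mono add_mono mult_left_mono char_const_nonneg)
    have "u ^ 3 / fact 3 \<le> exp u"
    proof -
      have "(\<Sum>k\<in>{3}. u ^ k / fact k) \<le> (\<Sum>k. u ^ k / fact k)"
        using u0 summable_exp[of u] by (intro sum_le_suminf) (auto simp: field_simps)
      then show ?thesis by (simp add: exp_def field_simps)
    qed
    then show "u ^ 3 \<le> 6 * exp u" by (simp add: fact_numeral)
    show "u \<le> exp u" using exp_ge_add_one_self[of u] by linarith
  qed auto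
  also have "\<dots> = (6 * char_const + exp 1) * exp u / sqrt n" by (simp add: algebra_simps)
  also have "\<dots> \<le> (6 * char_const + exp 1) * exp (1 + dimW\<^sup>2 / (2 * gauss_rate) + gauss_rate * n / 2 * T) / sqrt n"
  proof (intro divide_right_mono mult_left_mono)
    have "\<bar>\<theta> j\<bar> \<le> sqrt T" if "j < dimW" for j
    proof -
      have "(\<theta> j)\<^sup>2 \<le> T" unfolding T_def using that by (intro member_le_sum[of j "{..<dimW}" "\<lambda>j. (\<theta> j)\<^sup>2"]) auto
      then have "sqrt ((\<theta> j)\<^sup>2) \<le> sqrt T" by (rule real_sqrt_le_mono)
      then show ?thesis by simp
    qed
    then have "(\<Sum>j<dimW. \<bar>\<theta> j\<bar>) \<le> (\<Sum>j<dimW. sqrt T)" by (intro sum_mono) auto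
    then have "sqrt n * (\<Sum>j<dimW. \<bar>\<theta> j\<bar>) \<le> sqrt n * (dimW * sqrt T)" using n0 by (intro mult_left_mono) auto
    then have "u \<le> dimW * (sqrt n * sqrt T) + 1"
      using tilt_bounds(4)[OF n] by (simp add: u_def \<tau>_def algebra_simps)
    \<comment> \<open>AM-GM weighs the linear term in sqrt (n T) against half of the quadratic
      exponent.\<close>
    also have "dimW * (sqrt n * sqrt T) \<le> dimW\<^sup>2 / (2 * gauss_rate) + gauss_rate * n / 2 * T"
    proof -
      define v where "v = sqrt n * sqrt T"
      have v2: "v\<^sup>2 = n * T" using T0 by (simp add: v_def power_mult_distrib)
      have "0 \<le> (real dimW - gauss_rate * v)\<^sup>2" by simp
      then have "2 * gauss_rate * (dimW * v) \<le> (real dimW)\<^sup>2 + gauss_rate\<^sup>2 * v\<^sup>2" by (simp add: power2_eq_square algebra_simps)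
      then have "dimW * v \<le> ((real dimW)\<^sup>2 + gauss_rate\<^sup>2 * v\<^sup>2) / (2 * gauss_rate)"
        using gauss_rate_pos by (simp add: field_simps)
      also have "\<dots> = (real dimW)\<^sup>2 / (2 * gauss_rate) + gauss_rate / 2 * v\<^sup>2"
        using gauss_rate_pos by (simp add: add_divide_distrib power2_eq_square)
      finally show ?thesis unfolding v2 v_def[symmetric] by simp
    qed
    finally show "exp u \<le> exp (1 + dimW\<^sup>2 / (2 * gauss_rate) + gauss_rate * n / 2 * T)" by simp
  qed (use char_const_nonneg in auto)
  also have "\<dots> = integrand_const / sqrt n * exp (gauss_rate * n / 2 * T)" by (simp add: integrand_const_def exp_add)
  finally have "(char_const * n * \<tau> ^ 3 + exp 1 * \<tau>) * ?e \<le> integrand_const / sqrt n * exp (gauss_rate * n / 2 * T) * ?e"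
    by (intro mult_right_mono) auto
  also have "\<dots> = integrand_const / sqrt n * exp (- (gauss_rate * n / 2) * T)"
  proof -
    have "exp (gauss_rate * n / 2 * T) * ?e = exp (- (gauss_rate * n / 2) * T)" unfolding exp_add[symmetric] by (simp add: field_simps)
    then show ?thesis by (simp only: mult.assoc)
  qed
  finally show ?thesis using main unfolding P_def T_def by linarith
qed

end

text \<open>The bound of \<open>integrand_bound\<close> integrated over all frequencies and divided
  by (2 pi)^dimW, without its powers of n.\<close>

definition lattice_const :: real where "lattice_const = (1 / (2 * pi)) ^ dimW * integrand_const * sqrt (2 * pi / gauss_rate) ^ dimW"
text \<open>Bounds the variation of the tilt weight over a unit cube, where its exponent deviates by
  at most dimW / sqrt n from the value at the lattice point.\<close>

definition cube_const :: real where "cube_const = dimW * exp dimW"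
definition dTV_const :: real where "dTV_const = lattice_const * (16 * (1 + r)) ^ dimW + cube_const"

lemma finite_colourings: "finite (colourings n m)"
  by (simp add: colourings_def finite_PiE)

lemma colouring_prob_nonneg: "c \<in> colourings n m \<Longrightarrow> 0 \<le> colouring_prob p n c"
  using weight_nonneg[of c "{..<n}"] by (simp add: colourings_def colouring_prob_def)

lemma law_W_nonneg: "0 \<le> law_W E n m p x"
  unfolding law_W_def by (intro sum_nonneg) (auto intro: colouring_prob_nonneg)

text \<open>The imaginary part of the frequency becomes a real reweighting of the colourings, the
  form that \<open>lattice_inversion\<close> accepts.\<close>

lemma Psi_eq_sum:
  assumes n: "1 \<le> n" and \<eta>: "\<And>t. \<bar>\<eta> t\<bar> \<le> tilt"
  shows "Psi \<eta> \<theta> = (\<Sum>c\<in>colourings n m.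
     of_real (colouring_prob p n c * exp (- (\<Sum>t<dimW. \<eta> t * (W_stat E n m c t - n * nu r m p t)))) *
     exp (\<i> * of_real (\<Sum>t<dimW. \<theta> t * (W_stat E n m c t - n * nu r m p t))))"
  unfolding Psi_def[OF n \<eta>] EE_def colourings_def
proof (rule sum.cong[OF refl])
  fix c assume c: "c \<in> PiE {..<n} (\<lambda>_. {..<m})"
  have ov: "override_on (\<lambda>_. undefined) c {..<n} = c"
    using c by (auto simp: override_on_def fun_eq_iff PiE_iff extensional_def)
  have "\<i> * Zt (aof (zeta \<eta> \<theta>)) (bof (zeta \<eta> \<theta>)) c =
      of_real (- (\<Sum>t<dimW. \<eta> t * (W_stat E n m c t - n * nu r m p t))) + \<i> * of_real (\<Sum>t<dimW. \<theta> t * (W_stat E n m c t - n * nu r m p t))"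
  proof -
    have Z: "Zt (aof (zeta \<eta> \<theta>)) (bof (zeta \<eta> \<theta>)) c =
        (\<Sum>t<dimW. zeta \<eta> \<theta> t * of_real (W_stat E n m c t - n * nu r m p t))"
      by (rule Zt_W) (use c in auto)
    have tm: "\<i> * (zeta \<eta> \<theta> t * of_real y) = of_real (- (\<eta> t * y)) + \<i> * of_real (\<theta> t * y)" for t y
      unfolding zeta_def[OF n \<eta>] by (simp add: algebra_simps)
    show ?thesis
      unfolding Z sum_distrib_left tm sum.distrib by (simp only: of_real_sum of_real_minus sum_negf sum_distrib_left)
  qed
  then show "(\<Prod>v<n. p (c v)) *\<^sub>R exp (\<i> * Zt (aof (zeta \<eta> \<theta>)) (bof (zeta \<eta> \<theta>)) (override_on (\<lambda>_. undefined) c {..<n})) =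
     of_real (colouring_prob p n c * exp (- (\<Sum>t<dimW. \<eta> t * (W_stat E n m c t - n * nu r m p t)))) *
     exp (\<i> * of_real (\<Sum>t<dimW. \<theta> t * (W_stat E n m c t - n * nu r m p t)))"
    by (simp only: ov exp_add exp_of_real scaleR_conv_of_real colouring_prob_def of_real_mult mult.assoc)
qed

text \<open>Inversion under the tilt compares s P with I, where P is the probability of x, s the
  tilt weight at x and I the tilted Gaussian integral over the cube around x. The weight is nearly
  constant on the cube, so I is close to s D; dividing by s produces the exponential decay in
  x.\<close>

lemma pointwise_bound:
  fixes x :: "nat \<Rightarrow> int"
  assumes n: "1 \<le> n" and x: "x \<in> lattice dimW"
  defines "D \<equiv> discrete_normal dimW (\<lambda>t. real n * nu r m p t) (\<lambda>s t. real n * Sigma_cov r m p s t) x"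
  shows "\<bar>law_W E n m p x - D\<bar> \<le>
    exp (- tilt * (\<Sum>j<dimW. \<bar>x j - n * nu r m p j\<bar>)) * (lattice_const / (sqrt n * sqrt n ^ dimW)) + cube_const / sqrt n * D"
proof -
  define a where "a t = n * nu r m p t" for t
  define y where "y t = x t - a t" for t
  \<comment> \<open>Signs are chosen per coordinate so that the tilt weight at \<open>x\<close> is
    as large as the bound \<open>tilt\<close> permits.\<close>
  define \<eta> where "\<eta> t = - tilt * sgn (y t)" for t
  define V where "V s t = real n * Sigma_cov r m p s t" for s t
  define R where "R t z = (\<Sum>j<dimW. sqrt_factor dimW V t j * z j)" for t and z :: "nat \<Rightarrow> real"
  define P where "P = law_W E n m p x"
  have n0: "0 < sqrt n" "0 < real n" using n by auto
  have tIp: "0 < tilt" by (rule tilt_bounds[OF n])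
  have \<eta>: "\<bar>\<eta> t\<bar> \<le> tilt" for t using tIp by (simp add: \<eta>_def abs_mult sgn_if)
  note ne = n \<eta>
  have tilt: "4 * (1 + r) * tilt = 1 / sqrt n" "tilt \<le> 1 / sqrt n" by (rule tilt_bounds[OF n])+
  have \<eta>y: "(\<Sum>t<dimW. \<eta> t * y t) = - tilt * (\<Sum>t<dimW. \<bar>y t\<bar>)"
    unfolding \<eta>_def sum_distrib_left by (intro sum.cong refl) (simp add: abs_sgn mult_ac)
  define s where "s = exp (- (\<Sum>t<dimW. \<eta> t * y t))"
  have s0: "0 < s" by (simp add: s_def)
  define e where "e \<theta> = exp (- (\<i> * of_real (\<Sum>j<dimW. \<theta> j * y j)))" for \<theta>
  let ?M = "PiM {..<dimW} (\<lambda>_. lborel :: real measure)"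
  define w where "w c = complex_of_real (colouring_prob p n c * exp (- (\<Sum>t<dimW. \<eta> t * (W_stat E n m c t - a t))))" for c
  have Psi: "Psi \<eta> \<theta> = (\<Sum>c\<in>colourings n m. w c * exp (\<i> * of_real (\<Sum>t<dimW. \<theta> t * (W_stat E n m c t - a t))))" for \<theta>
    unfolding Psi_eq_sum[OF ne] w_def a_def ..
  have mem: "W_stat E n m c = x \<longleftrightarrow> (\<forall>j<dimW. W_stat E n m c j = x j)" for c
  proof
    assume h: "\<forall>j<dimW. W_stat E n m c j = x j"
    show "W_stat E n m c = x"
    proof
      fix j
      show "W_stat E n m c j = x j"
        using h x m_ge by (cases "j < dimW") (auto simp: lattice_def W_stat_def)
    qed
  qed simp
  have "(\<Sum>c | c \<in> colourings n m \<and> (\<forall>j<dimW. W_stat E n m c j = x j). w c) =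
      (\<Sum>c | c \<in> colourings n m \<and> (\<forall>j<dimW. W_stat E n m c j = x j). of_real (colouring_prob p n c * s))"
    by (intro sum.cong refl) (simp add: w_def s_def y_def)
  also have "\<dots> = of_real (s * P)"
    unfolding P_def law_W_def mem by (simp add: sum_distrib_left mult.commute)
  finally have wsum: "(\<Sum>c | c \<in> colourings n m \<and> (\<forall>j<dimW. W_stat E n m c j = x j). w c) = of_real (s * P)" .
  have inv1: "(\<integral>\<theta>. of_real (\<Prod>j<dimW. indicator {-pi..pi} (\<theta> j)) * (Psi \<eta> \<theta> * e \<theta>) \<partial>?M) = of_real ((2 * pi) ^ dimW * (s * P))"
    and int1: "integrable ?M (\<lambda>\<theta>. of_real (\<Prod>j<dimW. indicator {-pi..pi} (\<theta> j)) * (Psi \<eta> \<theta> * e \<theta>))"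
    using lattice_inversion[OF finite_colourings, of dimW w "W_stat E n m" a x]
    unfolding Psi e_def y_def wsum by simp_all
  define I where "I = (\<integral>z. exp (- (\<Sum>t<dimW. \<eta> t * R t z)) * (\<Prod>j<dimW. indicator {-1/2..<1/2} (R j z - y j)) \<partial>std_normal_vec dimW)"
  have VA: "(\<Sum>j<dimW. sqrt_factor dimW V i j * sqrt_factor dimW V l j) = V i l" if "i < dimW" "l < dimW" for i l
    using sqrt_factor_Sigma[OF n0(2) that] unfolding V_def .
  have VL: "n * qf_gap * (\<Sum>j<dimW. (\<theta> j)\<^sup>2) \<le> (\<Sum>s<dimW. \<Sum>t<dimW. \<theta> s * \<theta> t * V s t)" for \<theta>
    using mult_left_mono[OF Sigma_pos[of \<theta>], of "real n"] by (simp add: V_def sum_distrib_left mult_ac)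
  have L: "0 < n * qf_gap" using n0 qf_gap_pos by simp
  note gi = gaussian_inversion[where A="sqrt_factor dimW V" and V=V and L="n * qf_gap" and k=dimW and \<eta>=\<eta> and y=y, OF VA L VL, folded R_def]
  have QQ: "QQ \<eta> \<theta> = exp (- (\<Sum>s<dimW. \<Sum>t<dimW. (of_real (\<theta> s) + \<i> * of_real (\<eta> s)) * (of_real (\<theta> t) + \<i> * of_real (\<eta> t)) * of_real (V s t)) / 2)" for \<theta>
    unfolding QQ_def[OF ne] V_def ..
  have inv2: "(\<integral>\<theta>. QQ \<eta> \<theta> * (of_real (\<Prod>j<dimW. snc (\<theta> j / 2)) * e \<theta>) \<partial>?M) = of_real ((2 * pi) ^ dimW * I)"
    unfolding QQ e_def I_def by (rule gi(2))
  have int2: "integrable ?M (\<lambda>\<theta>. QQ \<eta> \<theta> * (of_real (\<Prod>j<dimW. snc (\<theta> j / 2)) * e \<theta>))"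
    unfolding QQ e_def by (rule gi(1))
  have intI: "integrable (std_normal_vec dimW) (\<lambda>z. exp (- (\<Sum>t<dimW. \<eta> t * R t z)) * (\<Prod>j<dimW. indicator {-1/2..<1/2} (R j z - y j)))"
    by (rule gi(3))
  let ?f = "\<lambda>\<theta>. of_real (\<Prod>j<dimW. indicator {-pi..pi} (\<theta> j)) * (Psi \<eta> \<theta> * e \<theta>) - QQ \<eta> \<theta> * (of_real (\<Prod>j<dimW. snc (\<theta> j / 2)) * e \<theta>)"
  let ?g = "\<lambda>\<theta>. integrand_const / sqrt n * exp (- (gauss_rate * n / 2) * (\<Sum>j<dimW. (\<theta> j)\<^sup>2))"
  have ccn: "0 < gauss_rate * n / 2" using gauss_rate_pos n0 by simp
  have norme: "norm (e \<theta>) = 1" for \<theta> unfolding e_def norm_exp_eq_Re by simp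
  have fg: "norm (?f \<theta>) \<le> ?g \<theta>" for \<theta>
  proof -
    have "?f \<theta> = (of_real (\<Prod>j<dimW. indicator {-pi..pi} (\<theta> j)) * Psi \<eta> \<theta> - QQ \<eta> \<theta> * of_real (\<Prod>j<dimW. snc (\<theta> j / 2))) * e \<theta>"
      by (simp only: left_diff_distrib mult.assoc)
    then show ?thesis using integrand_bound[OF ne, of \<theta>] by (simp only: norm_mult norme mult_1_right)
  qed
  have "of_real ((2 * pi) ^ dimW * (s * P - I)) = integral\<^sup>L ?M ?f"
    unfolding Bochner_Integration.integral_diff[OF int1 int2] inv1 inv2 by (simp add: right_diff_distrib)
  then have "norm (complex_of_real ((2 * pi) ^ dimW * (s * P - I))) = norm (integral\<^sup>L ?M ?f)" by (rule arg_cong)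
  also have "\<dots> \<le> integral\<^sup>L ?M ?g"
    using int1 int2 gauss_integral(1)[OF ccn, of dimW]
    by (intro order_trans[OF integral_norm_bound] integral_mono integrable_norm Bochner_Integration.integrable_diff integrable_mult_right fg)
  also have "\<dots> = integrand_const / sqrt n * sqrt (pi / (gauss_rate * n / 2)) ^ dimW"
    unfolding integral_mult_right_zero gauss_integral(2)[OF ccn] ..
  finally have "(2 * pi) ^ dimW * \<bar>s * P - I\<bar> \<le> integrand_const / sqrt n * sqrt (pi / (gauss_rate * n / 2)) ^ dimW"
    unfolding norm_of_real abs_mult by simp
  then have "\<bar>s * P - I\<bar> \<le> (integrand_const / sqrt n * sqrt (pi / (gauss_rate * n / 2)) ^ dimW) / (2 * pi) ^ dimW"
  proof -
    have "K * X \<le> Y \<Longrightarrow> 0 < K \<Longrightarrow> X \<le> Y / K" for K X Y :: real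
      by (simp add: pos_le_divide_eq mult.commute)
    moreover assume "(2 * pi) ^ dimW * \<bar>s * P - I\<bar> \<le> integrand_const / sqrt n * sqrt (pi / (gauss_rate * n / 2)) ^ dimW"
    ultimately show ?thesis by (metis pi_gt_zero zero_less_mult_iff zero_less_numeral zero_less_power)
  qed
  also have "sqrt (pi / (gauss_rate * n / 2)) = sqrt (2 * pi / gauss_rate) / sqrt n"
    by (simp add: real_sqrt_divide[symmetric])
  also have "(integrand_const / sqrt n * (sqrt (2 * pi / gauss_rate) / sqrt n) ^ dimW) / (2 * pi) ^ dimW = lattice_const / (sqrt n * sqrt n ^ dimW)"
    unfolding lattice_const_def by (simp only: power_divide power_one) simp
  finally have b1: "\<bar>s * P - I\<bar> \<le> lattice_const / (sqrt n * sqrt n ^ dimW)" .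
  have D: "D = (\<integral>z. (\<Prod>j<dimW. indicator {-1/2..<1/2} (R j z - y j)) \<partial>std_normal_vec dimW)"
    unfolding D_def R_def y_def a_def V_def by (rule discrete_normal_integral(1))
  define J where "J z = (\<Prod>j<dimW. indicator {-1/2..<1/2} (R j z - y j) :: real)" for z
  have J: "0 \<le> J z" for z unfolding J_def by (intro prod_nonneg) auto
  have intJ: "integrable (std_normal_vec dimW) J"
  proof -
    have "integrable (std_normal_vec dimW) (\<lambda>z. exp (- (\<Sum>t<dimW. 0 * R t z)) * (\<Prod>j<dimW. indicator {-1/2..<1/2} (R j z - y j)) :: real)"
      unfolding R_def
      by (rule gaussian_inversion(3)[where A="sqrt_factor dimW V" and V=V and L="n * qf_gap" and k=dimW and \<eta>="\<lambda>_. 0" and y=y, OF VA L VL])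
    then show ?thesis unfolding J_def by simp
  qed
  define d where "d = dimW / sqrt n"
  have sn1: "1 \<le> sqrt n" using n by simp
  have d: "0 \<le> d" "d \<le> dimW" using n0 sn1 by (auto simp: d_def divide_le_eq mult_le_cancel_left1)
  have pt: "\<bar>exp (- (\<Sum>t<dimW. \<eta> t * R t z)) * J z - s * J z\<bar> \<le> s * (cube_const / sqrt n) * J z" for z
  proof (cases "\<forall>j<dimW. R j z - y j \<in> {-1/2..<1/2}")
    case True
    define u where "u = - (\<Sum>t<dimW. \<eta> t * (R t z - y t))"
    have "\<bar>u\<bar> \<le> (\<Sum>t<dimW. tilt * 1)"
      unfolding u_def abs_minus_cancel
    proof (rule order_trans[OF sum_abs], rule sum_mono)
      fix t assume "t \<in> {..<dimW}"
      then have "\<bar>R t z - y t\<bar> \<le> 1" using True unfolding atLeastLessThan_iff by (force simp: abs_le_iff)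
      then show "\<bar>\<eta> t * (R t z - y t)\<bar> \<le> tilt * 1" unfolding abs_mult using \<eta>[of t] by (intro mult_mono) auto
    qed
    also have "\<dots> = dimW * tilt" by simp
    also have "\<dots> \<le> dimW * (1 / sqrt n)" using tilt by (intro mult_left_mono) auto
    finally have u: "\<bar>u\<bar> \<le> d" by (simp add: d_def)
    have "\<bar>exp u - 1\<bar> = norm (exp (complex_of_real u) - 1)" by (metis exp_of_real norm_of_real of_real_1 of_real_diff)
    also have "\<dots> \<le> \<bar>u\<bar> * exp \<bar>u\<bar>" using norm_exp_minus_1_le[of "complex_of_real u"] by simp
    also have "\<dots> \<le> d * exp dimW" using u d by (intro mult_mono) auto
    also have "\<dots> = cube_const / sqrt n" by (simp add: d_def cube_const_def)
    finally have u1: "\<bar>exp u - 1\<bar> \<le> cube_const / sqrt n" .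
    have "exp (- (\<Sum>t<dimW. \<eta> t * R t z)) = s * exp u"
      unfolding s_def u_def exp_add[symmetric] by (simp add: right_diff_distrib sum_subtractf)
    then have "exp (- (\<Sum>t<dimW. \<eta> t * R t z)) * J z - s * J z = s * (exp u - 1) * J z" by (simp add: algebra_simps)
    then have "\<bar>exp (- (\<Sum>t<dimW. \<eta> t * R t z)) * J z - s * J z\<bar> = s * \<bar>exp u - 1\<bar> * J z"
      using s0 J[of z] by (simp add: abs_mult)
    also have "\<dots> \<le> s * (cube_const / sqrt n) * J z" using u1 s0 J by (intro mult_right_mono mult_left_mono) auto
    finally show ?thesis .
  next
    case False
    then obtain j where "j < dimW" "R j z - y j \<notin> {-1/2..<1/2}" by blast
    then have "J z = 0" unfolding J_def by (intro prod_zero bexI[of _ j] indicator_simps(2)) auto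
    then show ?thesis by simp
  qed
  have intI': "integrable (std_normal_vec dimW) (\<lambda>z. exp (- (\<Sum>t<dimW. \<eta> t * R t z)) * J z)"
    unfolding J_def by (rule intI)
  have DJ: "D = integral\<^sup>L (std_normal_vec dimW) J" unfolding D J_def ..
  have IJ: "I = (\<integral>z. exp (- (\<Sum>t<dimW. \<eta> t * R t z)) * J z \<partial>std_normal_vec dimW)"
    unfolding I_def J_def ..
  have ID: "I - s * D = (\<integral>z. exp (- (\<Sum>t<dimW. \<eta> t * R t z)) * J z - s * J z \<partial>std_normal_vec dimW)"
    using Bochner_Integration.integral_diff[OF intI' integrable_mult_right[OF intJ, of s]]
    unfolding IJ DJ by (simp only: integral_mult_right_zero)
  have "\<bar>I - s * D\<bar> \<le> (\<integral>z. \<bar>exp (- (\<Sum>t<dimW. \<eta> t * R t z)) * J z - s * J z\<bar> \<partial>std_normal_vec dimW)"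
    unfolding ID by (rule integral_abs_bound)
  also have "\<dots> \<le> (\<integral>z. s * (cube_const / sqrt n) * J z \<partial>std_normal_vec dimW)"
    by (rule integral_mono[OF integrable_abs[OF Bochner_Integration.integrable_diff[OF intI' integrable_mult_right[OF intJ]]] integrable_mult_right[OF intJ] pt])
  also have "\<dots> = s * (cube_const / sqrt n) * D" unfolding DJ by (rule integral_mult_right_zero)
  finally have b2: "\<bar>I - s * D\<bar> \<le> s * (cube_const / sqrt n * D)" by (simp only: mult.assoc)
  have "s * \<bar>P - D\<bar> = \<bar>s * (P - D)\<bar>" using s0 by (simp add: abs_mult)
  also have "s * (P - D) = (s * P - I) + (I - s * D)" by (simp add: right_diff_distrib)
  also have "\<bar>\<dots>\<bar> \<le> lattice_const / (sqrt n * sqrt n ^ dimW) + s * (cube_const / sqrt n * D)"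
    by (rule order_trans[OF abs_triangle_ineq add_mono[OF b1 b2]])
  finally have sP: "s * \<bar>P - D\<bar> \<le> lattice_const / (sqrt n * sqrt n ^ dimW) + s * (cube_const / sqrt n * D)" .
  have "\<bar>P - D\<bar> = inverse s * (s * \<bar>P - D\<bar>)" using s0 by simp
  also have "\<dots> \<le> inverse s * (lattice_const / (sqrt n * sqrt n ^ dimW) + s * (cube_const / sqrt n * D))"
    using s0 by (intro mult_left_mono sP) simp
  also have "\<dots> = inverse s * (lattice_const / (sqrt n * sqrt n ^ dimW)) + cube_const / sqrt n * D"
  proof -
    have "inverse s * (X + s * Y) = inverse s * X + Y" for X Y
      using s0 by (simp add: distrib_left)
    then show ?thesis .
  qed
  also have "inverse s = exp (- tilt * (\<Sum>j<dimW. \<bar>y j\<bar>))" unfolding s_def \<eta>y by (simp add: exp_minus)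
  finally show ?thesis unfolding P_def y_def a_def .
qed

text \<open>The lattice sum of the exponentials is at most (4 / tilt)^dimW, of order sqrt n ^ dimW,
  and cancels that power in the pointwise bound; n^(-1/2) remains.\<close>

lemma dTV_bound:
  assumes n: "1 \<le> n"
  shows "dTV dimW (law_W E n m p) (discrete_normal dimW (\<lambda>t. real n * nu r m p t) (\<lambda>s t. real n * Sigma_cov r m p s t)) \<le> dTV_const / sqrt n"
proof (rule dTV_le)
  let ?D = "discrete_normal dimW (\<lambda>t. real n * nu r m p t) (\<lambda>s t. real n * Sigma_cov r m p s t)"
  show "0 \<le> law_W E n m p x" for x by (rule law_W_nonneg)
  show "0 \<le> ?D x" for x unfolding discrete_normal_integral(3) by (rule measure_nonneg)
  fix F assume F: "finite F" "F \<subseteq> lattice dimW"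
  show D1: "(\<Sum>x\<in>F. ?D x) \<le> 1" by (rule sum_discrete_normal_le_1[OF F])
  have n0: "0 < sqrt n" using n by simp
  have tilt: "0 < tilt" "tilt \<le> 1" by (rule tilt_bounds[OF n])+
  have C40: "0 \<le> cube_const" by (simp add: cube_const_def)
  have C30: "0 \<le> lattice_const" using char_const_nonneg gauss_rate_pos by (simp add: lattice_const_def integrand_const_def)
  have "(\<Sum>x\<in>F. \<bar>law_W E n m p x - ?D x\<bar>) \<le>
    (\<Sum>x\<in>F. exp (- tilt * (\<Sum>j<dimW. \<bar>x j - n * nu r m p j\<bar>)) * (lattice_const / (sqrt n * sqrt n ^ dimW)) + cube_const / sqrt n * ?D x)"
    using F by (intro sum_mono pointwise_bound[OF n]) auto
  also have "\<dots> = (\<Sum>x\<in>F. exp (- tilt * (\<Sum>j<dimW. \<bar>x j - n * nu r m p j\<bar>))) * (lattice_const / (sqrt n * sqrt n ^ dimW)) + cube_const / sqrt n * (\<Sum>x\<in>F. ?D x)"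
    by (simp only: sum.distrib sum_distrib_left sum_distrib_right)
  also have "\<dots> \<le> (4 / tilt) ^ dimW * (lattice_const / (sqrt n * sqrt n ^ dimW)) + cube_const / sqrt n * 1"
    using C30 C40 n0 by (intro add_mono mult_right_mono mult_left_mono sum_lattice_exp_le[OF F tilt] D1) auto
  also have "4 / tilt = 16 * (1 + r) * sqrt n" using n0 by (simp add: tilt_def)
  also have "(16 * (1 + r) * sqrt n) ^ dimW * (lattice_const / (sqrt n * sqrt n ^ dimW)) + cube_const / sqrt n * 1 = dTV_const / sqrt n"
  proof -
    have "(X * Y) ^ dimW * (C / (Y * Y ^ dimW)) + B / Y * 1 = (C * X ^ dimW + B) / Y" if "0 < Y" for X Y C B :: real
      using that by (simp add: power_mult_distrib add_divide_distrib)
    from this[OF n0, of "16 * (1 + r)"] show ?thesis unfolding dTV_const_def by simp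
  qed
  finally show "(\<Sum>x\<in>F. \<bar>law_W E n m p x - ?D x\<bar>) \<le> dTV_const / sqrt n" .
qed

lemma dTV_const_nonneg: "0 \<le> dTV_const"
  using char_const_nonneg gauss_rate_pos by (simp add: dTV_const_def cube_const_def lattice_const_def integrand_const_def)

end

theorem theorem4p5:
  fixes r m :: nat and p :: "nat \<Rightarrow> real"
    and G :: "nat \<Rightarrow> nat \<Rightarrow> nat \<Rightarrow> bool" and S :: "nat set"
  assumes "r \<ge> 1" and "m \<ge> 3"
    and "\<forall>i<m. p i > 0" and "(\<Sum>i<m. p i) = 1"
    and "\<forall>n\<in>S. regular_graph (G n) n r"
  shows "\<exists>C. \<forall>n\<in>S. n \<ge> 2 \<longrightarrow>
           dTV (2 * m - 1) (law_W (G n) n m p)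
               (discrete_normal (2 * m - 1) (\<lambda>t. real n * nu r m p t)
                                (\<lambda>s t. real n * Sigma_cov r m p s t))
           \<le> C * ln (real n) / sqrt (real n)"
\<comment> \<open>\<open>dTV_const\<close> depends on m, p and r but not on the graph or on n, so it
  can be named before n is fixed. Dividing by ln 2 makes room for the logarithm, since ln n >= ln
  2.\<close>
proof (rule exI[of _ "colour_graph.dTV_const m p r / ln 2"], intro ballI impI)
  fix n assume n: "n \<in> S" "n \<ge> 2"
  interpret colour_graph m p r "G n" n
    using assms n by unfold_locales auto
  have "1 \<le> n" using n by simp
  then have "dTV (2 * m - 1) (law_W (G n) n m p)
      (discrete_normal (2 * m - 1) (\<lambda>t. real n * nu r m p t) (\<lambda>s t. real n * Sigma_cov r m p s t)) \<le> dTV_const / sqrt n"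
    by (rule dTV_bound)
  also have "\<dots> \<le> (dTV_const / ln 2 * ln n) / sqrt n"
  proof (rule divide_right_mono)
    have "ln 2 \<le> ln (real n)" using n by simp
    then have "dTV_const / ln 2 * ln 2 \<le> dTV_const / ln 2 * ln n" using dTV_const_nonneg by (intro mult_left_mono) auto
    then show "dTV_const \<le> dTV_const / ln 2 * ln n" by simp
  qed simp
  finally show "dTV (2 * m - 1) (law_W (G n) n m p)
      (discrete_normal (2 * m - 1) (\<lambda>t. real n * nu r m p t) (\<lambda>s t. real n * Sigma_cov r m p s t))
    \<le> dTV_const / ln 2 * ln (real n) / sqrt (real n)" .
qed

end
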